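(* Let $d\ge 1$ and let $(M_p)_{p\in\mathbb{N}_0}$ be a sequence of positive real numbers such that: (i) $M_p^{1/p}\to+\infty$ as $p\to+\infty$; (ii) there is $H>0$ such that for any $C>0$ there is $B>0$ with $s^{s/2}M_p\le BC^sH^{s+p}M_{s+p}$ for all $s,p\in\mathbb{N}_0$; (iii) $M_p^2\le M_{p-1}M_{p+1}$ for all $p\in\mathbb{N}$. Then the space $\mathcal{S}_{(M_p)}(\mathbb{R}^d)$ is nuclear if and only if there exist $A,H>0$ such that $M_{p+1}\le AH^pM_p$ for all $p\in\mathbb{N}_0$.
   Context: $\mathcal{S}_{(M_p)}(\mathbb{R}^d)$ is the locally convex space of all $f\in C^\infty(\mathbb{R}^d)$ such that for every $j\in\mathbb{N}$ $$\sup_{\alpha,\beta\in\mathbb{N}_0^d}\frac{j^{|\alpha+\beta|}}{M_{|\alpha+\beta|}}\|x^\alpha\partial^\beta f(x)\|_2<+\infty,$$ where $\|\cdot\|_2$ is the $L^2(\mathbb{R}^d)$ norm, with the topology given by these seminorms ($j\in\mathbb{N}$). The convention $0^0=1$ is used; $\mathbb{N}=\{1,2,\dots\}$ and $\mathbb{N}_0=\mathbb{N}\cup\{0\}$. *)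

theory Defs
  imports "HOL-Analysis.Analysis"
begin

subsection \<open>Partial derivatives and smooth functions on Euclidean space\<close>

definition partial_deriv :: "'n::finite \<Rightarrow> (real^'n \<Rightarrow> complex) \<Rightarrow> real^'n \<Rightarrow> complex" where
  "partial_deriv i f x = vector_derivative (\<lambda>t. f (x + t *\<^sub>R axis i 1)) (at 0)"

text \<open>The second conjunct ensures that \<^const>\<open>partial_deriv\<close>, which is total, is applied only where
  the partial derivative exists.\<close>

definition smooth_functions :: "(real^'n::finite \<Rightarrow> complex) set" where
  "smooth_functions = {f. \<forall>is.
     continuous_on UNIV (foldr partial_deriv is f) \<and>
     (\<forall>i x. (\<lambda>t. foldr partial_deriv is f (x + t *\<^sub>R axis i 1)) differentiable (at 0))}"

text \<open>Multi-indices are functions \<open>'n \<Rightarrow> nat\<close>. Since \<open>'n\<close> carries no order, an enumeration of the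
  coordinates is chosen; on smooth functions the order of differentiation is irrelevant.\<close>

definition coords :: "'n::finite list" where
  "coords = (SOME is. set is = UNIV \<and> distinct is)"

definition multi_deriv :: "('n::finite \<Rightarrow> nat) \<Rightarrow> (real^'n \<Rightarrow> complex) \<Rightarrow> real^'n \<Rightarrow> complex" where
  "multi_deriv \<beta> f = foldr (\<lambda>i. partial_deriv i ^^ \<beta> i) coords f"

definition monomial :: "('n::finite \<Rightarrow> nat) \<Rightarrow> real^'n \<Rightarrow> real" where
  "monomial \<alpha> x = (\<Prod>i\<in>UNIV. (x $ i) ^ \<alpha> i)"

definition msize :: "('n::finite \<Rightarrow> nat) \<Rightarrow> nat" where
  "msize \<alpha> = (\<Sum>i\<in>UNIV. \<alpha> i)"

subsection \<open>The space and its topology\<close>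

definition square_integrable :: "(real^'n::finite \<Rightarrow> complex) \<Rightarrow> bool" where
  "square_integrable f \<longleftrightarrow> f \<in> borel_measurable lborel \<and> integrable lborel (\<lambda>x. (cmod (f x))\<^sup>2)"

definition L2_norm :: "(real^'n::finite \<Rightarrow> complex) \<Rightarrow> real" where
  "L2_norm f = sqrt (LINT x|lborel. (cmod (f x))\<^sup>2)"

definition weighted_term ::
  "(nat \<Rightarrow> real) \<Rightarrow> nat \<Rightarrow> (real^'n::finite \<Rightarrow> complex) \<Rightarrow> ('n \<Rightarrow> nat) \<times> ('n \<Rightarrow> nat) \<Rightarrow> real" where
  "weighted_term M j f = (\<lambda>(\<alpha>, \<beta>).
     real j ^ msize (\<lambda>i. \<alpha> i + \<beta> i) / M (msize (\<lambda>i. \<alpha> i + \<beta> i)) *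
     L2_norm (\<lambda>x. of_real (monomial \<alpha> x) * multi_deriv \<beta> f x))"

text \<open>Finiteness of the supremum comprises square integrability, because the Bochner integral in
  \<^const>\<open>L2_norm\<close> takes the value 0 on non-integrable functions.\<close>

definition S_space :: "(nat \<Rightarrow> real) \<Rightarrow> (real^'n::finite \<Rightarrow> complex) set" where
  "S_space M = {f \<in> smooth_functions.
     (\<forall>\<alpha> \<beta>. square_integrable (\<lambda>x. of_real (monomial \<alpha> x) * multi_deriv \<beta> f x)) \<and>
     (\<forall>j\<ge>1. bdd_above (range (weighted_term M j f)))}"

definition S_seminorm :: "(nat \<Rightarrow> real) \<Rightarrow> nat \<Rightarrow> (real^'n::finite \<Rightarrow> complex) \<Rightarrow> real" where
  "S_seminorm M j f = (SUP ab. weighted_term M j f ab)"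

definition seminorm_topology ::
  "('a \<Rightarrow> complex) set \<Rightarrow> (('a \<Rightarrow> complex) \<Rightarrow> real) set \<Rightarrow> ('a \<Rightarrow> complex) topology" where
  "seminorm_topology E P = topology_generated_by
     {{g \<in> E. p (\<lambda>x. g x - f x) < e} | p f e. p \<in> P \<and> f \<in> E \<and> e > 0}"

definition S_topology :: "(nat \<Rightarrow> real) \<Rightarrow> (real^'n::finite \<Rightarrow> complex) topology" where
  "S_topology M = seminorm_topology (S_space M) (S_seminorm M ` {1..})"

subsection \<open>Nuclear locally convex spaces of complex-valued functions\<close>

definition linear_functional_on ::
  "('a \<Rightarrow> complex) set \<Rightarrow> (('a \<Rightarrow> complex) \<Rightarrow> complex) \<Rightarrow> bool" where
  "linear_functional_on E \<phi> \<longleftrightarrow>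
     (\<forall>f\<in>E. \<forall>g\<in>E. \<phi> (\<lambda>x. f x + g x) = \<phi> f + \<phi> g) \<and>
     (\<forall>c. \<forall>f\<in>E. \<phi> (\<lambda>x. c * f x) = c * \<phi> f)"

definition seminorm_on :: "('a \<Rightarrow> complex) set \<Rightarrow> (('a \<Rightarrow> complex) \<Rightarrow> real) \<Rightarrow> bool" where
  "seminorm_on E p \<longleftrightarrow>
     (\<forall>f\<in>E. 0 \<le> p f) \<and>
     (\<forall>f\<in>E. \<forall>g\<in>E. p (\<lambda>x. f x + g x) \<le> p f + p g) \<and>
     (\<forall>c. \<forall>f\<in>E. p (\<lambda>x. c * f x) = cmod c * p f)"

definition continuous_seminorm ::
  "('a \<Rightarrow> complex) set \<Rightarrow> ('a \<Rightarrow> complex) topology \<Rightarrow> (('a \<Rightarrow> complex) \<Rightarrow> real) \<Rightarrow> bool" where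
  "continuous_seminorm E T p \<longleftrightarrow> seminorm_on E p \<and> continuous_map T euclideanreal p"

text \<open>For seminorms \<open>p \<le> q\<close> on \<open>E\<close>: the canonical map \<open>E/ker q \<rightarrow> E/ker p\<close> between the local normed
  spaces is a nuclear operator \<open>\<Sum>k. \<phi> k \<otimes> y k\<close>, where \<open>c k\<close> bounds the dual norm of \<open>\<phi> k\<close> and hence
  \<open>\<Sum>k. \<parallel>\<phi> k\<parallel> \<parallel>y k\<parallel> < \<infinity>\<close>. Allowing \<open>y k\<close> in the completion of \<open>E/ker p\<close> gives the same notion, since
  each such element is the sum of a series in \<open>E/ker p\<close> whose norms add up to at most
  \<open>1 + \<epsilon>\<close> times its norm.\<close>

definition nuclear_canonical_map ::
  "('a \<Rightarrow> complex) set \<Rightarrow> (('a \<Rightarrow> complex) \<Rightarrow> real) \<Rightarrow> (('a \<Rightarrow> complex) \<Rightarrow> real) \<Rightarrow> bool" where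
  "nuclear_canonical_map E q p \<longleftrightarrow>
     (\<exists>(\<phi> :: nat \<Rightarrow> ('a \<Rightarrow> complex) \<Rightarrow> complex) (y :: nat \<Rightarrow> 'a \<Rightarrow> complex) (c :: nat \<Rightarrow> real).
        (\<forall>k. linear_functional_on E (\<phi> k)) \<and>
        (\<forall>k. y k \<in> E) \<and>
        (\<forall>k. 0 \<le> c k \<and> (\<forall>f\<in>E. cmod (\<phi> k f) \<le> c k * q f)) \<and>
        summable (\<lambda>k. c k * p (y k)) \<and>
        (\<forall>f\<in>E. (\<lambda>n. p (\<lambda>x. f x - (\<Sum>k<n. \<phi> k f * y k x))) \<longlonglongrightarrow> 0))"

definition nuclear_space :: "('a \<Rightarrow> complex) set \<Rightarrow> ('a \<Rightarrow> complex) topology \<Rightarrow> bool" where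
  "nuclear_space E T \<longleftrightarrow>
     (\<forall>p. continuous_seminorm E T p \<longrightarrow>
        (\<exists>q. continuous_seminorm E T q \<and> (\<forall>f\<in>E. p f \<le> q f) \<and> nuclear_canonical_map E q p))"

end

theory Submission
  imports Defs "HOL-Probability.Distributions"
begin

text \<open>
The proof identifies the space with a weighted sequence space by means of the orthonormal Hermite
functions \<open>h\<^sub>\<alpha>\<close> (\<open>nhermite\<close>). Put \<open>E t = sup\<^sub>m t\<^sup>m / M\<^sub>m\<close> (\<open>assoc_fun\<close>) and write \<open>A\<close> for the lowering
operator \<open>x\<^sub>l + \<partial>\<^sub>l\<close> and \<open>p\<^sub>j\<close> for the \<open>j\<close>-th seminorm. Two estimates carry everything.

\<^item> \<open>p\<^sub>k h\<^sub>\<alpha> \<le> B E (2k \<surd>|\<alpha>|)\<close> (\<open>S_seminorm_nhermite\<close>). A coordinate or a partial derivative sends \<open>h\<^sub>\<alpha>\<close>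
to a combination of two neighbours with coefficients of size \<open>\<surd>|\<alpha>|\<close>, so \<open>m\<close> of them cost at most
\<open>(2(|\<alpha>| + m))\<close> to the power \<open>m/2\<close>.

\<^item> \<open>|\<langle>f, h\<^sub>\<alpha>\<rangle>| E (\<theta> j \<surd>n) \<le> B p\<^sub>j f\<close> if \<open>\<alpha>\<close> has a coordinate \<open>\<alpha>\<^sub>l \<ge> n\<close>, with \<open>\<theta> > 0\<close> independent of
\<open>j\<close>; more precisely the square root of a sum of \<open>|\<langle>f, h\<^sub>\<alpha>\<rangle>|\<^sup>2\<close> over finitely many such \<open>\<alpha>\<close> is bounded in
this way (\<open>hcoeff_decay\<close>). The coefficient of \<open>f\<close> at \<open>\<alpha>\<close> is that of \<open>A\<^sup>m f\<close> at \<open>\<alpha> - m e\<^sub>l\<close> divided by at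
least \<open>\<surd>n\<close> to the power \<open>m\<close>, as long as \<open>2m \<le> n\<close>, and Bessel's inequality applies to \<open>A\<^sup>m f\<close>. Bringing
\<open>A\<^sup>m\<close> to the order "coordinates to the left of derivatives" produces commutator terms: those that have
lost \<open>s\<close> of the \<open>m\<close> factors are bounded by a constant to the power \<open>m\<close> times \<open>s\<^bsup>s/2\<^esup> M\<^bsub>m-s\<^esub> / j\<^bsup>m-s\<^esup>\<close>. This
is exactly what the hypothesis on \<open>s\<^bsup>s/2\<^esup> M\<^sub>p\<close> absorbs. The same hypothesis makes the terms of \<open>E\<close> with
\<open>m\<close> large compared to \<open>n\<close> harmless, in both estimates.

For sufficiency, \<open>M\<^bsub>p+1\<^esub> \<le> A h\<^sup>p M\<^sub>p\<close> gives \<open>t E t \<le> A E (h t)\<close>, hence any power of \<open>t\<close> is gained by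
enlarging the argument of \<open>E\<close> by a factor. Choosing \<open>j\<close> large after \<open>k\<close>, the products of
\<open>sup |\<langle>f, h\<^sub>\<alpha>\<rangle>| / p\<^sub>j f\<close> and \<open>p\<^sub>k h\<^sub>\<alpha>\<close> are summable over \<open>\<alpha>\<close>, and \<open>f = \<Sum>\<^sub>\<alpha> \<langle>f, h\<^sub>\<alpha>\<rangle> h\<^sub>\<alpha>\<close> is the nuclear
representation. Its convergence in \<open>p\<^sub>k\<close> (\<open>hermite_expansion_converges\<close>) follows from the \<open>L\<^sup>2\<close>-completeness
of the Hermite functions (\<open>hermite_complete\<close>) by testing \<open>x\<^sup>\<alpha> \<partial>\<^sup>\<beta>\<close> of the remainder against Hermite sums.

Completeness itself is an approximation argument: power series in \<open>|x|\<^sup>2\<close> show that the closed span of the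
Hermite functions contains all \<open>x\<^sup>\<alpha> exp (- t |x|\<^sup>2)\<close> with \<open>t \<ge> 1/2\<close>, hence \<open>exp (- |x|\<^sup>2/2)\<close> times every
polynomial in the bounded functions \<open>exp (- |x|\<^sup>2/2)\<close> and \<open>x\<^sub>i exp (- |x|\<^sup>2/2)\<close>, to which the theorem of
Weierstrass applies.

For necessity, fix \<open>j\<close> with \<open>\<theta> j \<ge> 2\<close>, suppose that the map from \<open>q\<close> to \<open>p\<^sub>j\<close> is nuclear with
representation \<open>\<Sum>\<^sub>i \<phi>\<^sub>i \<otimes> y\<^sub>i\<close>, and let \<open>q \<le> C p\<^sub>k\<close>. Compose the identity with the projection \<open>R\<close> onto the \<open>n + 1\<close> Hermite functions whose index
lies on a fixed axis between \<open>n\<close> and \<open>2n\<close>. The trace \<open>n + 1 = \<Sum>\<^sub>i \<phi>\<^sub>i (R y\<^sub>i)\<close> is at most the norm of \<open>R\<close> from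
\<open>p\<^sub>j\<close> to \<open>q\<close> times \<open>\<Sum>\<^sub>i \<parallel>\<phi>\<^sub>i\<parallel> p\<^sub>j y\<^sub>i\<close> (\<open>nuclear_trace_bound\<close>), and by the two estimates this norm is
\<open>O(\<surd>(n+1) E (3k \<surd>n) / E (2 \<surd>n))\<close>. Hence \<open>t E t \<le> K E (\<kappa> t)\<close>. By log-convexity the supremum
\<open>E (M\<^bsub>p+1\<^esub> / M\<^sub>p)\<close> is attained at \<open>m = p\<close>, so \<open>t = M\<^bsub>p+1\<^esub> / (\<kappa> M\<^sub>p)\<close> yields the growth condition.
\<close>

section \<open>Square-integrable functions\<close>

definition ip :: "(real^'n::finite \<Rightarrow> complex) \<Rightarrow> (real^'n \<Rightarrow> complex) \<Rightarrow> complex" where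
  "ip f g = (LINT x|lborel. f x * cnj (g x))"

lemma sqint_measurable: "square_integrable f \<Longrightarrow> f \<in> borel_measurable borel"
  by (simp add: square_integrable_def)

lemma sqint_mult_integrable:
  assumes "square_integrable f" "square_integrable g"
  shows "integrable lborel (\<lambda>x. f x * cnj (g x))"
proof (rule Bochner_Integration.integrable_bound)
  show "integrable lborel (\<lambda>x. (cmod (f x))\<^sup>2 + (cmod (g x))\<^sup>2)"
    using assms by (auto simp: square_integrable_def)
  show "(\<lambda>x. f x * cnj (g x)) \<in> borel_measurable lborel"
  proof -
    have c: "cnj \<in> borel_measurable borel"
      by (intro borel_measurable_continuous_onI continuous_on_cnj continuous_on_id)
    show ?thesis
      using sqint_measurable[OF assms(1)] measurable_compose[OF sqint_measurable[OF assms(2)] c]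
      by simp
  qed
  have "a * b \<le> a\<^sup>2 + b\<^sup>2" if "a \<ge> 0" "b \<ge> 0" for a b :: real
    using sum_squares_bound[of a b] mult_nonneg_nonneg[OF that] by linarith
  then show "AE x in lborel. norm (f x * cnj (g x)) \<le> norm ((cmod (f x))\<^sup>2 + (cmod (g x))\<^sup>2)"
    by (simp add: norm_mult)
qed

lemma sqint_add:
  assumes "square_integrable f" "square_integrable g"
  shows "square_integrable (\<lambda>x. f x + g x)"
  unfolding square_integrable_def
proof
  show m: "(\<lambda>x. f x + g x) \<in> borel_measurable lborel"
    using assms by (auto simp: square_integrable_def)
  show "integrable lborel (\<lambda>x. (cmod (f x + g x))\<^sup>2)"
  proof (rule Bochner_Integration.integrable_bound)
    show "integrable lborel (\<lambda>x. 2 * (cmod (f x))\<^sup>2 + 2 * (cmod (g x))\<^sup>2)"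
      using assms by (auto simp: square_integrable_def)
    show "(\<lambda>x. (cmod (f x + g x))\<^sup>2) \<in> borel_measurable lborel"
      using m by measurable
    have "(cmod (a + b))\<^sup>2 \<le> 2 * (cmod a)\<^sup>2 + 2 * (cmod b)\<^sup>2" for a b
    proof -
      have "(cmod (a + b))\<^sup>2 \<le> (cmod a + cmod b)\<^sup>2"
        by (intro power_mono norm_triangle_ineq) auto
      also have "\<dots> \<le> 2 * (cmod a)\<^sup>2 + 2 * (cmod b)\<^sup>2"
        using sum_squares_bound[of "cmod a" "cmod b"] by (simp add: power2_sum)
      finally show ?thesis .
    qed
    then show "AE x in lborel. norm ((cmod (f x + g x))\<^sup>2) \<le> norm (2 * (cmod (f x))\<^sup>2 + 2 * (cmod (g x))\<^sup>2)"
      by auto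
  qed
qed

lemma sqint_cmult: "square_integrable f \<Longrightarrow> square_integrable (\<lambda>x. c * f x)"
  by (auto simp: square_integrable_def norm_mult power_mult_distrib)

lemma sqint_zero: "square_integrable (\<lambda>x. 0)"
  by (simp add: square_integrable_def)

lemma sqint_diff:
  "square_integrable f \<Longrightarrow> square_integrable g \<Longrightarrow> square_integrable (\<lambda>x. f x - g x)"
  using sqint_add[of f "\<lambda>x. (-1) * g x"] sqint_cmult[of g "-1"] by simp

lemma sqint_sum:
  "(\<And>i. i \<in> I \<Longrightarrow> square_integrable (f i)) \<Longrightarrow> square_integrable (\<lambda>x. \<Sum>i\<in>I. f i x)"
  by (induction I rule: infinite_finite_induct) (auto intro: sqint_add sqint_zero)

lemma ip_add_left:
  assumes "square_integrable f" "square_integrable g" "square_integrable h"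
  shows "ip (\<lambda>x. f x + g x) h = ip f h + ip g h"
  unfolding ip_def using assms by (simp add: ring_distribs sqint_mult_integrable)

lemma ip_cmult_left: "ip (\<lambda>x. c * f x) h = c * ip f h"
  by (simp add: ip_def mult.assoc)

lemma ip_cnj: "ip g f = cnj (ip f g)"
  unfolding ip_def Bochner_Integration.integral_cnj[symmetric] by (simp add: mult.commute)

lemma ip_zero_left: "ip (\<lambda>x. 0) h = 0"
  by (simp add: ip_def)

lemma ip_diff_left:
  assumes "square_integrable f" "square_integrable g" "square_integrable h"
  shows "ip (\<lambda>x. f x - g x) h = ip f h - ip g h"
  unfolding ip_def using assms by (simp add: ring_distribs sqint_mult_integrable)

lemma ip_sum_left:
  "(\<And>i. i \<in> I \<Longrightarrow> square_integrable (f i)) \<Longrightarrow> square_integrable h \<Longrightarrow>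
   ip (\<lambda>x. \<Sum>i\<in>I. f i x) h = (\<Sum>i\<in>I. ip (f i) h)"
  by (induction I rule: infinite_finite_induct) (auto simp: ip_zero_left ip_add_left sqint_sum)

lemma ip_add_right:
  assumes "square_integrable f" "square_integrable g" "square_integrable h"
  shows "ip h (\<lambda>x. f x + g x) = ip h f + ip h g"
  using ip_add_left[OF assms] by (simp add: ip_cnj[of h f] ip_cnj[of h g] ip_cnj[of h "\<lambda>x. f x + g x"])

lemma ip_diff_right:
  assumes "square_integrable f" "square_integrable g" "square_integrable h"
  shows "ip h (\<lambda>x. f x - g x) = ip h f - ip h g"
  using ip_diff_left[OF assms] by (simp add: ip_cnj[of h f] ip_cnj[of h g] ip_cnj[of h "\<lambda>x. f x - g x"])

lemma ip_cmult_right: "ip h (\<lambda>x. c * f x) = cnj c * ip h f"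
  by (simp add: ip_cnj[of h f] ip_cnj[of h "\<lambda>x. c * f x"] ip_cmult_left)

lemma ip_sum_right:
  "(\<And>i. i \<in> I \<Longrightarrow> square_integrable (f i)) \<Longrightarrow> square_integrable h \<Longrightarrow>
   ip h (\<lambda>x. \<Sum>i\<in>I. f i x) = (\<Sum>i\<in>I. ip h (f i))"
  by (simp add: ip_cnj[of h "\<lambda>x. \<Sum>i\<in>I. f i x"] ip_cnj[of h "f i" for i] ip_sum_left)

lemma L2_norm_nonneg [simp]: "0 \<le> L2_norm f"
  by (simp add: L2_norm_def)

lemma L2_norm_power2: "(L2_norm f)\<^sup>2 = (LINT x|lborel. (cmod (f x))\<^sup>2)"
  by (simp add: L2_norm_def)

lemma ip_self: "ip f f = of_real ((L2_norm f)\<^sup>2)"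
  by (simp add: ip_def L2_norm_power2 complex_norm_square[symmetric] flip: of_real_power)

lemma L2_norm_zero [simp]: "L2_norm (\<lambda>x. 0) = 0"
  by (simp add: L2_norm_def)

lemma L2_norm_cmult: "L2_norm (\<lambda>x. c * f x) = cmod c * L2_norm f"
  by (simp add: L2_norm_def norm_mult power_mult_distrib real_sqrt_mult)

lemma L2_norm_mono:
  assumes "square_integrable g" "f \<in> borel_measurable borel" "\<And>x. cmod (f x) \<le> cmod (g x)"
  shows "square_integrable f" "L2_norm f \<le> L2_norm g"
proof -
  have le: "(cmod (f x))\<^sup>2 \<le> (cmod (g x))\<^sup>2" for x
    using assms(3) by (intro power_mono) auto
  have i: "integrable lborel (\<lambda>x. (cmod (f x))\<^sup>2)"
    by (rule Bochner_Integration.integrable_bound[where f="\<lambda>x. (cmod (g x))\<^sup>2"])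
       (use assms le in \<open>auto simp: square_integrable_def\<close>)
  then show "square_integrable f"
    using assms by (simp add: square_integrable_def)
  show "L2_norm f \<le> L2_norm g"
    unfolding L2_norm_def using i assms le
    by (intro real_sqrt_le_mono integral_mono) (auto simp: square_integrable_def)
qed

lemma ip_Cauchy_Schwarz:
  assumes f: "square_integrable f" and g: "square_integrable g"
  shows "cmod (ip f g) \<le> L2_norm f * L2_norm g"
proof (cases "L2_norm g = 0")
  case True
  have "AE x in lborel. (cmod (g x))\<^sup>2 = 0"
    using integral_nonneg_eq_0_iff_AE[of lborel "\<lambda>x. (cmod (g x))\<^sup>2"] True g
    by (auto simp: L2_norm_def square_integrable_def)
  then have "AE x in lborel. f x * cnj (g x) = 0" by auto
  then have "ip f g = 0"
    unfolding ip_def by (rule integral_eq_zero_AE)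
  then show ?thesis using True by simp
next
  case False
  define N where "N = (L2_norm g)\<^sup>2"
  define c where "c = ip f g / N"
  have N: "N > 0" using False by (simp add: N_def)
  have ss: "square_integrable (\<lambda>x. f x - c * g x)"
    using f g by (intro sqint_diff sqint_cmult)
  have "0 \<le> Re (ip (\<lambda>x. f x - c * g x) (\<lambda>x. f x - c * g x))"
    unfolding ip_self by simp
  also have "ip (\<lambda>x. f x - c * g x) (\<lambda>x. f x - c * g x) =
      ip f f - cnj c * ip f g - c * ip g f + c * cnj c * ip g g"
    using f g ss by (simp add: ip_diff_left ip_diff_right ip_cmult_left ip_cmult_right
        sqint_cmult algebra_simps)
  also have "\<dots> = of_real ((L2_norm f)\<^sup>2 - (cmod (ip f g))\<^sup>2 / N)"
  proof -
    have sq: "ip f g * cnj (ip f g) = of_real ((cmod (ip f g))\<^sup>2)"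
      by (rule complex_norm_square[symmetric])
    have 1: "cnj c * ip f g = of_real ((cmod (ip f g))\<^sup>2 / N)"
      unfolding of_real_divide sq[symmetric] by (simp add: c_def)
    have 2: "c * ip g f = of_real ((cmod (ip f g))\<^sup>2 / N)"
      unfolding of_real_divide sq[symmetric] by (simp add: c_def ip_cnj[of g f])
    have 3: "c * cnj c * ip g g = of_real ((cmod (ip f g))\<^sup>2 / N)"
      unfolding of_real_divide sq[symmetric]
      using N by (simp add: c_def ip_self N_def[symmetric] del: of_real_power)
    show ?thesis unfolding 1 2 3 by (simp add: ip_self)
  qed
  finally have "(cmod (ip f g))\<^sup>2 / N \<le> (L2_norm f)\<^sup>2" by simp
  then have "(cmod (ip f g))\<^sup>2 \<le> (L2_norm f * L2_norm g)\<^sup>2"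
    using N by (simp add: divide_le_eq N_def power_mult_distrib)
  then show ?thesis by (rule power2_le_imp_le) simp
qed

lemma L2_norm_triangle:
  assumes f: "square_integrable f" and g: "square_integrable g"
  shows "L2_norm (\<lambda>x. f x + g x) \<le> L2_norm f + L2_norm g"
proof -
  have "of_real ((L2_norm (\<lambda>x. f x + g x))\<^sup>2) = ip f f + ip f g + (ip g f + ip g g)"
    unfolding ip_self[of "\<lambda>x. f x + g x", symmetric]
    using f g by (simp add: ip_add_left ip_add_right sqint_add algebra_simps)
  then have "(L2_norm (\<lambda>x. f x + g x))\<^sup>2 = Re (ip f f + ip f g + (ip g f + ip g g))"
    by (metis Re_complex_of_real)
  also have "\<dots> = (L2_norm f)\<^sup>2 + 2 * Re (ip f g) + (L2_norm g)\<^sup>2"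
    by (simp add: ip_self ip_cnj[of g f])
  also have "\<dots> \<le> (L2_norm f)\<^sup>2 + 2 * (L2_norm f * L2_norm g) + (L2_norm g)\<^sup>2"
    using ip_Cauchy_Schwarz[OF f g] complex_Re_le_cmod[of "ip f g"] by linarith
  also have "\<dots> = (L2_norm f + L2_norm g)\<^sup>2" by (simp add: power2_sum)
  finally show ?thesis by (rule power2_le_imp_le) simp
qed

lemma Bessel_inequality:
  assumes f: "square_integrable f" and e: "\<And>i. i \<in> I \<Longrightarrow> square_integrable (e i)"
    and on: "\<And>i j. i \<in> I \<Longrightarrow> j \<in> I \<Longrightarrow> ip (e i) (e j) = (if i = j then 1 else 0)"
    and I: "finite I"
  shows "(\<Sum>i\<in>I. (cmod (ip f (e i)))\<^sup>2) \<le> (L2_norm f)\<^sup>2"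
proof -
  define g where "g = (\<lambda>x. \<Sum>i\<in>I. ip f (e i) * e i x)"
  have g: "square_integrable g" unfolding g_def by (intro sqint_sum sqint_cmult e)
  have S: "(\<Sum>i\<in>I. ip f (e i) * cnj (ip f (e i))) = of_real (\<Sum>i\<in>I. (cmod (ip f (e i)))\<^sup>2)"
    unfolding of_real_sum by (intro sum.cong refl complex_norm_square[symmetric])
  have fg: "ip f g = of_real (\<Sum>i\<in>I. (cmod (ip f (e i)))\<^sup>2)"
    unfolding g_def S[symmetric] mult.commute[of "ip f (e i)" "cnj z" for i z] using f e
    by (simp add: ip_sum_right sqint_cmult ip_cmult_right)
  have ge: "ip g (e j) = ip f (e j)" if "j \<in> I" for j
  proof -
    have "ip g (e j) = (\<Sum>i\<in>I. ip f (e i) * ip (e i) (e j))"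
      unfolding g_def using e that by (simp add: ip_sum_left sqint_cmult ip_cmult_left)
    also have "\<dots> = (\<Sum>i\<in>I. if i = j then ip f (e j) else 0)"
      using that by (intro sum.cong) (auto simp: on)
    finally show ?thesis using that I by simp
  qed
  have gg: "ip g g = of_real (\<Sum>i\<in>I. (cmod (ip f (e i)))\<^sup>2)"
  proof -
    have "ip g g = (\<Sum>i\<in>I. cnj (ip f (e i)) * ip g (e i))"
      by (subst (2) g_def) (use g e in \<open>simp add: ip_sum_right sqint_cmult ip_cmult_right\<close>)
    also have "\<dots> = (\<Sum>i\<in>I. ip f (e i) * cnj (ip f (e i)))"
      by (intro sum.cong) (auto simp: ge)
    finally show ?thesis using S by simp
  qed
  define s where "s = (\<Sum>i\<in>I. (cmod (ip f (e i)))\<^sup>2)"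
  have s0: "s \<ge> 0" unfolding s_def by (intro sum_nonneg) auto
  have sg: "s = (L2_norm g)\<^sup>2" using gg unfolding ip_self s_def of_real_eq_iff by simp
  have "s \<le> L2_norm f * L2_norm g"
    using ip_Cauchy_Schwarz[OF f g] s0 unfolding fg s_def[symmetric] by simp
  then have "L2_norm g * L2_norm g \<le> L2_norm f * L2_norm g" by (simp add: sg power2_eq_square)
  then have "L2_norm g \<le> L2_norm f"
    by (metis L2_norm_nonneg less_eq_real_def mult_le_cancel_right not_le)
  then have "(L2_norm g)\<^sup>2 \<le> (L2_norm f)\<^sup>2" by (intro power_mono) auto
  then show ?thesis using sg s_def by simp
qed

section \<open>Smooth functions\<close>

text \<open>The definition of \<^const>\<open>smooth_functions\<close> quantifies over all iterated partial derivatives; membership is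
therefore shown by exhibiting a set of functions that is stable under all partial derivatives.\<close>

lemma smooth_functionsI:
  assumes "f \<in> C" "\<And>g i. g \<in> C \<Longrightarrow> partial_deriv i g \<in> C"
    and "\<And>g. g \<in> C \<Longrightarrow> continuous_on UNIV g"
    and "\<And>g i x. g \<in> C \<Longrightarrow> (\<lambda>t. g (x + t *\<^sub>R axis i 1)) differentiable (at 0)"
  shows "f \<in> smooth_functions"
proof -
  have "foldr partial_deriv is f \<in> C" for "is"
    by (induction "is") (use assms in auto)
  then show ?thesis using assms by (auto simp: smooth_functions_def)
qed

lemma smooth_foldr_partial_deriv:
  assumes "f \<in> smooth_functions" shows "foldr partial_deriv is f \<in> smooth_functions"
  unfolding smooth_functions_def mem_Collect_eq
proof (rule allI)
  fix js
  show "continuous_on UNIV (foldr partial_deriv js (foldr partial_deriv is f)) \<and>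
     (\<forall>i x. (\<lambda>t. foldr partial_deriv js (foldr partial_deriv is f) (x + t *\<^sub>R axis i 1)) differentiable (at 0))"
    using spec[OF assms[unfolded smooth_functions_def mem_Collect_eq], of "js @ is"] by simp
qed

lemma smooth_functionsD:
  assumes "f \<in> smooth_functions"
  shows "continuous_on UNIV f" "(\<lambda>t. f (x + t *\<^sub>R axis i 1)) differentiable (at 0)"
proof -
  have "continuous_on UNIV (foldr partial_deriv [] f) \<and>
     (\<forall>i x. (\<lambda>t. foldr partial_deriv [] f (x + t *\<^sub>R axis i 1)) differentiable (at 0))"
    using assms unfolding smooth_functions_def mem_Collect_eq by (rule spec)
  then show "continuous_on UNIV f" "(\<lambda>t. f (x + t *\<^sub>R axis i 1)) differentiable (at 0)" by auto
qed

lemma smooth_partial_deriv: "f \<in> smooth_functions \<Longrightarrow> partial_deriv i f \<in> smooth_functions"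
  using smooth_foldr_partial_deriv[of f "[i]"] by simp

lemma smooth_continuous: "f \<in> smooth_functions \<Longrightarrow> continuous_on UNIV f"
  by (rule smooth_functionsD)

lemma smooth_has_partial_deriv:
  assumes "f \<in> smooth_functions"
  shows "((\<lambda>t. f (x + t *\<^sub>R axis i 1)) has_vector_derivative partial_deriv i f x) (at 0)"
  using smooth_functionsD(2)[OF assms] unfolding partial_deriv_def by (simp add: vector_derivative_works)

lemma partial_deriv_eqI:
  "((\<lambda>t. f (x + t *\<^sub>R axis i 1)) has_vector_derivative D) (at 0) \<Longrightarrow> partial_deriv i f x = D"
  unfolding partial_deriv_def by (rule vector_derivative_at)

lemma partial_deriv_add:
  assumes "f \<in> smooth_functions" "g \<in> smooth_functions"
  shows "partial_deriv i (\<lambda>x. f x + g x) = (\<lambda>x. partial_deriv i f x + partial_deriv i g x)"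
  by (rule ext, rule partial_deriv_eqI)
     (intro has_vector_derivative_add smooth_has_partial_deriv assms)

lemma partial_deriv_cmult:
  assumes "f \<in> smooth_functions"
  shows "partial_deriv i (\<lambda>x. c * f x) = (\<lambda>x. c * partial_deriv i f x)"
  by (rule ext, rule partial_deriv_eqI)
     (intro has_vector_derivative_mult_right smooth_has_partial_deriv assms)

lemma partial_deriv_zero: "partial_deriv i (\<lambda>x. 0) = (\<lambda>x. 0)"
  by (rule ext, rule partial_deriv_eqI) simp

lemma has_partial_deriv_coord:
  assumes "f \<in> smooth_functions"
  shows "((\<lambda>t. of_real ((x + t *\<^sub>R axis i 1) $ l) * f (x + t *\<^sub>R axis i 1)) has_vector_derivative
      of_real (x $ l) * partial_deriv i f x + (if i = l then f x else 0)) (at 0)"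
proof -
  have 1: "((\<lambda>t. complex_of_real (x $ l + t * (if i = l then 1 else 0))) has_vector_derivative
      (if i = l then 1 else 0)) (at 0)"
    by (auto intro!: derivative_eq_intros has_vector_derivative_of_real
        simp: has_real_derivative_iff_has_vector_derivative[symmetric])
  have eq: "(x + t *\<^sub>R axis i 1) $ l = x $ l + t * (if i = l then 1 else 0)" for t
    by (simp add: axis_def)
  show ?thesis
    using has_vector_derivative_mult[OF 1 smooth_has_partial_deriv[OF assms, of x i]]
    unfolding eq by (simp split: if_splits)
qed

lemma partial_deriv_coord:
  assumes "f \<in> smooth_functions"
  shows "partial_deriv i (\<lambda>x. of_real (x $ l) * f x) =
     (\<lambda>x. of_real (x $ l) * partial_deriv i f x + (if i = l then 1 else 0) * f x)"
proof (rule ext, rule partial_deriv_eqI)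
  fix x
  have eq: "(if i = l then 1 else 0) * f x = (if i = l then f x else 0)" by simp
  show "((\<lambda>t. of_real ((x + t *\<^sub>R axis i 1) $ l) * f (x + t *\<^sub>R axis i 1)) has_vector_derivative
      of_real (x $ l) * partial_deriv i f x + (if i = l then 1 else 0) * f x) (at 0)"
    unfolding eq by (rule has_partial_deriv_coord[OF assms])
qed

lemma smooth_zero: "(\<lambda>x. 0) \<in> smooth_functions"
  by (rule smooth_functionsI[where C="{\<lambda>x. 0}"]) (auto simp: partial_deriv_zero)

lemma smooth_add:
  assumes "f \<in> smooth_functions" "g \<in> smooth_functions"
  shows "(\<lambda>x. f x + g x) \<in> smooth_functions"
proof (rule smooth_functionsI[where C="{\<lambda>x. f x + g x | f g. f \<in> smooth_functions \<and> g \<in> smooth_functions}"])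
  show "(\<lambda>x. f x + g x) \<in> {\<lambda>x. f x + g x | f g. f \<in> smooth_functions \<and> g \<in> smooth_functions}"
    using assms by blast
next
  fix h i assume "h \<in> {\<lambda>x. f x + g x | f g. f \<in> smooth_functions \<and> g \<in> smooth_functions}"
  then obtain f g where h: "h = (\<lambda>x. f x + g x)" "f \<in> smooth_functions" "g \<in> smooth_functions" by blast
  then show "partial_deriv i h \<in> {\<lambda>x. f x + g x | f g. f \<in> smooth_functions \<and> g \<in> smooth_functions}"
    using smooth_partial_deriv[OF h(2)] smooth_partial_deriv[OF h(3)] by (auto simp: partial_deriv_add)
  show "continuous_on UNIV h" unfolding h(1) by (intro continuous_intros smooth_continuous h)
  show "(\<lambda>t. h (x + t *\<^sub>R axis i 1)) differentiable at 0" for x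
    unfolding h(1) using has_vector_derivative_add[OF smooth_has_partial_deriv[OF h(2)] smooth_has_partial_deriv[OF h(3)]]
    by (rule differentiableI_vector)
qed

lemma smooth_cmult:
  assumes "f \<in> smooth_functions"
  shows "(\<lambda>x. c * f x) \<in> smooth_functions"
proof (rule smooth_functionsI[where C="{\<lambda>x. c * f x | f. f \<in> smooth_functions}"])
  show "(\<lambda>x. c * f x) \<in> {\<lambda>x. c * f x | f. f \<in> smooth_functions}"
    using assms by blast
next
  fix h i assume "h \<in> {\<lambda>x. c * f x | f. f \<in> smooth_functions}"
  then obtain f where h: "h = (\<lambda>x. c * f x)" "f \<in> smooth_functions" by blast
  then show "partial_deriv i h \<in> {\<lambda>x. c * f x | f. f \<in> smooth_functions}"
    using smooth_partial_deriv[OF h(2)] by (auto simp: partial_deriv_cmult)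
  show "continuous_on UNIV h" unfolding h(1) by (intro continuous_intros smooth_continuous h)
  show "(\<lambda>t. h (x + t *\<^sub>R axis i 1)) differentiable at 0" for x
    unfolding h(1) using has_vector_derivative_mult_right[OF smooth_has_partial_deriv[OF h(2)]]
    by (rule differentiableI_vector)
qed

lemma smooth_sum:
  "(\<And>i. i \<in> I \<Longrightarrow> f i \<in> smooth_functions) \<Longrightarrow> (\<lambda>x. \<Sum>i\<in>I. f i x) \<in> smooth_functions"
  by (induction I rule: infinite_finite_induct) (auto intro: smooth_add smooth_zero)

lemma smooth_coord:
  assumes "f \<in> smooth_functions"
  shows "(\<lambda>x. of_real (x $ l) * f x) \<in> smooth_functions"
proof (rule smooth_functionsI[where C="{\<lambda>x. of_real (x $ l) * f x + g x | f g. f \<in> smooth_functions \<and> g \<in> smooth_functions}"])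
  let ?C = "{\<lambda>x. of_real (x $ l) * f x + g x | f g. f \<in> smooth_functions \<and> g \<in> smooth_functions}"
  show "(\<lambda>x. of_real (x $ l) * f x) \<in> ?C"
    using assms smooth_zero by force
  fix h i assume "h \<in> ?C"
  then obtain f g where h: "h = (\<lambda>x. of_real (x $ l) * f x + g x)" "f \<in> smooth_functions" "g \<in> smooth_functions" by blast
  have D: "((\<lambda>t. h (x + t *\<^sub>R axis i 1)) has_vector_derivative
       (of_real (x $ l) * partial_deriv i f x + (if i = l then f x else 0)) + partial_deriv i g x) (at 0)" for x
    unfolding h(1) by (intro has_vector_derivative_add has_partial_deriv_coord smooth_has_partial_deriv h)
  then show "(\<lambda>t. h (x + t *\<^sub>R axis i 1)) differentiable at 0" for x
    by (rule differentiableI_vector)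
  have "partial_deriv i h = (\<lambda>x. of_real (x $ l) * partial_deriv i f x +
     ((if i = l then 1 else 0) * f x + partial_deriv i g x))"
  proof (rule ext, rule partial_deriv_eqI)
    fix x
    have eq: "of_real (x $ l) * partial_deriv i f x + ((if i = l then 1 else 0) * f x + partial_deriv i g x)
      = (of_real (x $ l) * partial_deriv i f x + (if i = l then f x else 0)) + partial_deriv i g x"
      by simp
    show "((\<lambda>t. h (x + t *\<^sub>R axis i 1)) has_vector_derivative
       of_real (x $ l) * partial_deriv i f x + ((if i = l then 1 else 0) * f x + partial_deriv i g x)) (at 0)"
      unfolding eq by (rule D)
  qed
  moreover have "(\<lambda>x. (if i = l then 1 else 0) * f x + partial_deriv i g x) \<in> smooth_functions"
    by (intro smooth_add smooth_cmult smooth_partial_deriv h)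
  ultimately show "partial_deriv i h \<in> ?C" using smooth_partial_deriv[OF h(2), of i]
    by (intro CollectI exI conjI)
  show "continuous_on UNIV h" unfolding h(1)
    by (intro continuous_intros smooth_continuous h)
qed

section \<open>Integration by parts\<close>

lemma integral_translate:
  fixes f :: "real^'n::finite \<Rightarrow> complex"
  assumes "f \<in> borel_measurable borel"
  shows "(LINT x|lborel. f (x + a)) = (LINT x|lborel. f x)"
    and "integrable lborel f \<Longrightarrow> integrable lborel (\<lambda>x. f (x + a))"
proof -
  have d: "distr lborel borel ((+) a) = (lborel :: (real^'n) measure)" by (rule lborel_distr_plus)
  have "(LINT x|lborel. f x) = (LINT x|distr lborel borel ((+) a). f x)" by (simp add: d)
  also have "\<dots> = (LINT x|lborel. f (a + x))" using assms by (subst integral_distr) auto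
  finally show "(LINT x|lborel. f (x + a)) = (LINT x|lborel. f x)" by (simp add: add.commute)
  assume "integrable lborel f"
  then have "integrable (distr lborel borel ((+) a)) f" by (simp add: d)
  then have "integrable lborel (\<lambda>x. f (a + x))" using assms by (subst (asm) integrable_distr_eq) auto
  then show "integrable lborel (\<lambda>x. f (x + a))" by (simp add: add.commute)
qed

text \<open>By translation invariance \<open>F (x + e) - F x\<close> has integral \<open>0\<close>. It is the integral of \<open>D (x + s e)\<close> over
\<open>0 \<le> s \<le> 1\<close>, and by Fubini's theorem its integral over \<open>x\<close> is that of \<open>D\<close>. Integrability of \<open>F\<close> and \<open>D\<close> is what
\<open>L\<^sup>2\<close> bounds on two factors of \<open>F\<close> provide.\<close>

lemma integral_partial_deriv_eq_0:
  fixes F D :: "real^'n::finite \<Rightarrow> complex"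
  assumes der: "\<And>x. ((\<lambda>t. F (x + t *\<^sub>R axis i 1)) has_vector_derivative D x) (at 0)"
    and cD: "continuous_on UNIV D" and cF: "continuous_on UNIV F"
    and iF: "integrable lborel F" and iD: "integrable lborel D"
  shows "(LINT x|lborel. D x) = 0"
proof -
  define e :: "real^'n" where "e = axis i 1"
  have mF: "F \<in> borel_measurable borel" and mD: "D \<in> borel_measurable borel"
    using cD cF by (auto intro: borel_measurable_continuous_onI)
  have der2: "((\<lambda>t. F (x + t *\<^sub>R e)) has_vector_derivative D (x + s *\<^sub>R e)) (at s)" for x s
  proof -
    have "((\<lambda>t. F ((x + s *\<^sub>R e) + t *\<^sub>R e)) has_vector_derivative D (x + s *\<^sub>R e)) (at 0)"
      using der[of "x + s *\<^sub>R e"] by (simp add: e_def)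
    then have "(((\<lambda>t. F ((x + s *\<^sub>R e) + t *\<^sub>R e)) \<circ> (\<lambda>t. t - s)) has_vector_derivative (1 *\<^sub>R D (x + s *\<^sub>R e))) (at s)"
      by (intro vector_diff_chain_at) (auto intro!: derivative_eq_intros)
    then show ?thesis by (simp add: o_def algebra_simps)
  qed
  define Q where "Q = (\<lambda>s x. indicator {0..1::real} s *\<^sub>R D (x + s *\<^sub>R e))"
  have "continuous_on UNIV (\<lambda>p::real \<times> (real^'n). D (snd p + fst p *\<^sub>R e))"
    by (intro continuous_on_compose2[OF cD] continuous_intros) auto
  then have mQ': "(\<lambda>p::real \<times> (real^'n). D (snd p + fst p *\<^sub>R e)) \<in> borel_measurable (lborel \<Otimes>\<^sub>M lborel)"
    by (simp add: lborel_prod borel_measurable_continuous_onI)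
  have mQ: "case_prod Q \<in> borel_measurable (lborel \<Otimes>\<^sub>M lborel)"
    unfolding Q_def split_beta' by (intro borel_measurable_scaleR mQ') auto
  have nD: "(LINT x|lborel. norm (Q s x)) = indicator {0..1} s * (LINT x|lborel. norm (D x))" for s
  proof -
    have "(LINT x|lborel. complex_of_real (norm (D (x + s *\<^sub>R e)))) = (LINT x|lborel. complex_of_real (norm (D x)))"
      by (rule integral_translate) (use mD in auto)
    then have "(LINT x|lborel. norm (D (x + s *\<^sub>R e))) = (LINT x|lborel. norm (D x))"
      by (simp only: integral_complex_of_real of_real_eq_iff)
    then show ?thesis by (auto simp: Q_def indicator_def)
  qed
  have iQ: "integrable (lborel \<Otimes>\<^sub>M lborel) (case_prod Q)"
  proof (rule lborel_pair.Fubini_integrable[OF mQ])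
    show "integrable lborel (\<lambda>s. LINT x|lborel. norm (case_prod Q (s, x)))"
      by (simp add: nD)
    show "AE s in lborel. integrable lborel (\<lambda>x. case_prod Q (s, x))"
      unfolding Q_def using integral_translate(2)[OF mD iD] by auto
  qed
  have inner1: "(LINT s|lborel. Q s x) = F (x + e) - F x" for x
  proof -
    have "(LINT s|lborel. Q s x) = F (x + 1 *\<^sub>R e) - F (x + 0 *\<^sub>R e)"
      unfolding Q_def
      by (rule integral_FTC_atLeastAtMost)
        (auto intro!: has_vector_derivative_at_within der2 continuous_on_compose2[OF cD] continuous_intros)
    then show ?thesis by simp
  qed
  have inner2: "(LINT x|lborel. Q s x) = indicator {0..1} s *\<^sub>R (LINT x|lborel. D x)" for s
    unfolding Q_def using integral_translate(1)[OF mD, of "s *\<^sub>R e"] by simp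
  have "(LINT x|lborel. LINT s|lborel. Q s x) = (LINT s|lborel. LINT x|lborel. Q s x)"
    by (rule lborel_pair.Fubini_integral[OF iQ])
  moreover have "(LINT x|lborel. LINT s|lborel. Q s x) = 0"
    unfolding inner1 using integral_translate[OF mF, of e] iF by simp
  moreover have "(LINT s|lborel. LINT x|lborel. Q s x) = (LINT x|lborel. D x)"
    unfolding inner2 by (subst integral_scaleR_left) auto
  ultimately show ?thesis by simp
qed

lemma ip_partial_deriv:
  assumes f: "f \<in> smooth_functions" and g: "g \<in> smooth_functions"
    and sf: "square_integrable f" "square_integrable (partial_deriv i f)"
    and sg: "square_integrable g" "square_integrable (partial_deriv i g)"
  shows "ip (partial_deriv i f) g = - ip f (partial_deriv i g)"
proof -
  have "(LINT x|lborel. f x * cnj (partial_deriv i g x) + partial_deriv i f x * cnj (g x)) = 0"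
  proof (rule integral_partial_deriv_eq_0[where F="\<lambda>x. f x * cnj (g x)" and i=i])
    show "((\<lambda>t. f (x + t *\<^sub>R axis i 1) * cnj (g (x + t *\<^sub>R axis i 1))) has_vector_derivative
         f x * cnj (partial_deriv i g x) + partial_deriv i f x * cnj (g x)) (at 0)" for x
      using has_vector_derivative_mult[OF smooth_has_partial_deriv[OF f, of x i]
         has_vector_derivative_cnj[OF smooth_has_partial_deriv[OF g, of x i]]] by simp
    show "integrable lborel (\<lambda>x. f x * cnj (partial_deriv i g x) + partial_deriv i f x * cnj (g x))"
      by (intro Bochner_Integration.integrable_add sqint_mult_integrable assms)
  qed (intro continuous_intros smooth_continuous smooth_partial_deriv sqint_mult_integrable assms)+
  then show ?thesis unfolding ip_def
    using sqint_mult_integrable[OF sf(2) sg(1)] sqint_mult_integrable[OF sf(1) sg(2)]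
    by (simp add: eq_neg_iff_add_eq_0 add.commute)
qed

section \<open>Integrability of polynomials times Gaussians\<close>

lemma measurable_coord: "(\<lambda>x::real^'n::finite. x $ i) \<in> borel_measurable borel"
  by (intro borel_measurable_continuous_onI continuous_intros)

lemma bij_betw_axis: "bij_betw (\<lambda>i. axis i (1::real)) UNIV (Basis :: (real^'n::finite) set)"
  unfolding bij_betw_def by (auto simp: inj_on_def axis_eq_axis Basis_vec_def)

lemma integrable_prod_coords:
  fixes f :: "'n::finite \<Rightarrow> real \<Rightarrow> real"
  assumes int: "\<And>i. integrable lborel (f i)"
  shows "integrable lborel (\<lambda>x::real^'n. \<Prod>i\<in>UNIV. f i (x $ i))"
proof (rule integrableI_bounded)
  have m: "f i \<in> borel_measurable borel" for i
    using borel_measurable_integrable[OF int[of i]] by simp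
  show "(\<lambda>x::real^'n. \<Prod>i\<in>UNIV. f i (x $ i)) \<in> borel_measurable lborel"
    using measurable_compose[OF measurable_coord m] by (auto intro!: borel_measurable_prod)
  define ix where "ix b = (SOME i. b = axis i (1::real))" for b :: "real^'n"
  have ix: "ix (axis i 1) = i" for i
    unfolding ix_def by (rule some_equality) (auto simp: axis_eq_axis)
  have "(\<integral>\<^sup>+x. ennreal (norm (\<Prod>i\<in>UNIV. f i ((x::real^'n) $ i))) \<partial>lborel) =
     (\<integral>\<^sup>+x. (\<Prod>b\<in>Basis. ennreal \<bar>f (ix b) ((x::real^'n) \<bullet> b)\<bar>) \<partial>lborel)"
  proof (intro nn_integral_cong)
    fix x :: "real^'n"
    have "(\<Prod>b\<in>Basis. ennreal \<bar>f (ix b) (x \<bullet> b)\<bar>) = (\<Prod>i\<in>UNIV. ennreal \<bar>f i (x $ i)\<bar>)"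
      by (subst prod.reindex_bij_betw[OF bij_betw_axis, symmetric]) (simp add: ix inner_axis)
    then show "ennreal (norm (\<Prod>i\<in>UNIV. f i (x $ i))) = (\<Prod>b\<in>Basis. ennreal \<bar>f (ix b) (x \<bullet> b)\<bar>)"
      by (simp add: prod_ennreal abs_prod)
  qed
  also have "\<dots> = (\<Prod>b\<in>(Basis::(real^'n) set). \<integral>\<^sup>+x. ennreal \<bar>f (ix b) x\<bar> \<partial>lborel)"
    using m by (intro nn_integral_lborel_prod) auto
  also have "\<dots> < \<infinity>"
  proof -
    have "(\<integral>\<^sup>+x. ennreal \<bar>f i x\<bar> \<partial>lborel) < \<infinity>" for i
      using int[of i] by (simp add: integrable_iff_bounded)
    then show ?thesis by (simp add: less_top[symmetric] ennreal_prod_eq_top)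
  qed
  finally show "(\<integral>\<^sup>+x. ennreal (norm (\<Prod>i\<in>UNIV. f i ((x::real^'n) $ i))) \<partial>lborel) < \<infinity>" .
qed

lemma integrable_power_gaussian:
  fixes t :: real assumes "t > 0"
  shows "integrable lborel (\<lambda>x. x ^ k * exp (- t * x\<^sup>2))"
proof -
  \<comment> \<open>the standard deviation for which the normal density is a multiple of \<open>exp (- t x\<^sup>2)\<close>\<close>
  define s where "s = sqrt (1 / (2 * t))"
  have s: "s > 0" "2 * s\<^sup>2 = 1 / t" using assms by (auto simp: s_def)
  have "integrable lborel (\<lambda>x. sqrt (2 * pi * s\<^sup>2) * (normal_density 0 s x * (x - 0)^k))"
    by (intro integrable_mult_right integrable_normal_moment s)
  also have "(\<lambda>x. sqrt (2 * pi * s\<^sup>2) * (normal_density 0 s x * (x - 0)^k)) = (\<lambda>x. x ^ k * exp (- t * x\<^sup>2))"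
  proof -
    have "sqrt (2 * pi * s\<^sup>2) > 0" using s(1) by simp
    moreover have "- x\<^sup>2 / (2 * s\<^sup>2) = - t * x\<^sup>2" for x using s assms by simp
    ultimately show ?thesis using s(1) by (simp add: normal_density_def fun_eq_iff)
  qed
  finally show ?thesis .
qed

lemma monomial_exp_eq:
  fixes x :: "real^'n::finite"
  shows "monomial \<alpha> x * exp (- t * (norm x)\<^sup>2) = (\<Prod>i\<in>UNIV. (x $ i) ^ \<alpha> i * exp (- t * (x $ i)\<^sup>2))"
proof -
  have "(norm x)\<^sup>2 = (\<Sum>i\<in>UNIV. (x $ i)\<^sup>2)"
    unfolding power2_norm_eq_inner inner_vec_def by (simp add: power2_eq_square)
  then have "- t * (norm x)\<^sup>2 = (\<Sum>i\<in>UNIV. - t * (x $ i)\<^sup>2)"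
    by (simp only: sum_distrib_left)
  then have "exp (- t * (norm x)\<^sup>2) = (\<Prod>i\<in>UNIV. exp (- t * (x $ i)\<^sup>2))"
    by (simp only: exp_sum finite)
  then show ?thesis by (simp add: monomial_def prod.distrib)
qed

lemma integrable_monomial_gaussian:
  fixes \<alpha> :: "'n::finite \<Rightarrow> nat"
  assumes "t > 0"
  shows "integrable lborel (\<lambda>x::real^'n. monomial \<alpha> x * exp (- t * (norm x)\<^sup>2))"
  unfolding monomial_exp_eq by (intro integrable_prod_coords integrable_power_gaussian assms)

lemma continuous_monomial: "continuous_on UNIV (monomial \<alpha>)"
  unfolding monomial_def by (intro continuous_intros)

lemma sqint_monomial_gaussian:
  fixes \<alpha> :: "'n::finite \<Rightarrow> nat"
  assumes "t > 0"
  shows "square_integrable (\<lambda>x::real^'n. of_real (monomial \<alpha> x * exp (- t * (norm x)\<^sup>2)))"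
  unfolding square_integrable_def
proof
  show "(\<lambda>x::real^'n. complex_of_real (monomial \<alpha> x * exp (- t * (norm x)\<^sup>2))) \<in> borel_measurable lborel"
    by (auto intro!: borel_measurable_continuous_onI continuous_intros continuous_monomial)
  have "(cmod (of_real (monomial \<alpha> x * exp (- t * (norm x)\<^sup>2))))\<^sup>2 =
     monomial (\<lambda>i. 2 * \<alpha> i) x * exp (- (2 * t) * (norm x)\<^sup>2)" for x :: "real^'n"
    unfolding norm_of_real power2_abs
    by (simp add: power_mult_distrib monomial_def power_mult prod_power_distrib flip: exp_double power_mult)
       (simp add: mult.commute)
  then show "integrable lborel (\<lambda>x::real^'n. (cmod (of_real (monomial \<alpha> x * exp (- t * (norm x)\<^sup>2))))\<^sup>2)"
    using integrable_monomial_gaussian[of "2 * t" "\<lambda>i. 2 * \<alpha> i"] assms by simp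
qed

section \<open>Hermite functions of one variable\<close>

text \<open>The physicists' Hermite polynomials; \<open>hermite_fun\<close> below is not normalised.\<close>

fun hermite_poly :: "nat \<Rightarrow> real poly" where
  "hermite_poly 0 = 1"
| "hermite_poly (Suc 0) = [:0, 2:]"
| "hermite_poly (Suc (Suc n)) = [:0, 2:] * hermite_poly (Suc n) - smult (2 * real (Suc n)) (hermite_poly n)"

definition hermite_fun :: "nat \<Rightarrow> real \<Rightarrow> real" where
  "hermite_fun n x = poly (hermite_poly n) x * exp (- x\<^sup>2 / 2)"

lemma hermite_fun_Suc:
  "hermite_fun (Suc n) x = 2 * x * hermite_fun n x - 2 * real n * hermite_fun (n - 1) x"
  by (cases n) (auto simp: hermite_fun_def algebra_simps)

lemma hermite_fun_deriv:
  "(hermite_fun n has_real_derivative 2 * real n * hermite_fun (n - 1) x - x * hermite_fun n x) (at x)"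
proof (induction n rule: hermite_poly.induct)
  case 1
  show ?case unfolding hermite_fun_def by (auto intro!: derivative_eq_intros)
next
  case 2
  show ?case unfolding hermite_fun_def by (auto intro!: derivative_eq_intros simp: algebra_simps power2_eq_square)
next
  case (3 n)
  have eq: "hermite_fun (Suc (Suc n)) = (\<lambda>x. 2 * x * hermite_fun (Suc n) x - 2 * real (Suc n) * hermite_fun n x)"
    using hermite_fun_Suc[of "Suc n"] by auto
  have "((\<lambda>x. 2 * x * hermite_fun (Suc n) x - 2 * real (Suc n) * hermite_fun n x) has_real_derivative
     (2 * hermite_fun (Suc n) x + 2 * x * (2 * real (Suc n) * hermite_fun n x - x * hermite_fun (Suc n) x)
      - 2 * real (Suc n) * (2 * real n * hermite_fun (n - 1) x - x * hermite_fun n x))) (at x)"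
    using 3 by (auto intro!: derivative_eq_intros)
  moreover have "2 * hermite_fun (Suc n) x + 2 * x * (2 * real (Suc n) * hermite_fun n x - x * hermite_fun (Suc n) x)
      - 2 * real (Suc n) * (2 * real n * hermite_fun (n - 1) x - x * hermite_fun n x)
     = 2 * real (Suc (Suc n)) * hermite_fun (Suc n) x - x * hermite_fun (Suc (Suc n)) x"
  proof -
    have "2 * real n * hermite_fun (n - 1) x = 2 * x * hermite_fun n x - hermite_fun (Suc n) x"
      using hermite_fun_Suc[of n x] by simp
    then show ?thesis unfolding eq by (simp only:) (simp add: algebra_simps power2_eq_square)
  qed
  ultimately show ?case unfolding eq by simp
qed

lemma integrable_poly_gaussian:
  fixes t :: real assumes "t > 0"
  shows "integrable lborel (\<lambda>x. poly p x * exp (- t * x\<^sup>2))"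
  unfolding poly_altdef sum_distrib_right
  using integrable_power_gaussian[OF assms]
  by (intro Bochner_Integration.integrable_sum) (simp add: mult.assoc integrable_mult_right)

section \<open>Hermite functions on Euclidean space\<close>

definition hermite :: "('n::finite \<Rightarrow> nat) \<Rightarrow> real^'n \<Rightarrow> complex" where
  "hermite \<alpha> x = of_real (\<Prod>i\<in>UNIV. hermite_fun (\<alpha> i) (x $ i))"

lemma prod_fun_upd:
  fixes F :: "'n::finite \<Rightarrow> nat \<Rightarrow> real"
  shows "(\<Prod>i\<in>UNIV. F i ((\<alpha>(l := m)) i)) = F l m * (\<Prod>i\<in>UNIV-{l}. F i (\<alpha> i))"
  by (subst prod.remove[of UNIV l]) (auto intro!: prod.cong)

lemma hermite_upd:
  "hermite (\<alpha>(l := m)) x = of_real (hermite_fun m (x $ l) * (\<Prod>i\<in>UNIV-{l}. hermite_fun (\<alpha> i) (x $ i)))"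
  unfolding hermite_def prod_fun_upd[of "\<lambda>i k. hermite_fun k (x $ i)"] ..

text \<open>The value of \<open>\<alpha>(l := \<alpha> l - 1)\<close> is irrelevant if \<open>\<alpha> l = 0\<close>, since its coefficient vanishes then. The same
convention is used in all ladder formulas.\<close>

lemma hermite_coord:
  "of_real (x $ l) * hermite \<alpha> x =
     of_real (real (\<alpha> l)) * hermite (\<alpha>(l := \<alpha> l - 1)) x + 1/2 * hermite (\<alpha>(l := Suc (\<alpha> l))) x"
proof -
  have "of_real (x $ l) * hermite (\<alpha>(l := \<alpha> l)) x =
     of_real (real (\<alpha> l)) * hermite (\<alpha>(l := \<alpha> l - 1)) x + 1/2 * hermite (\<alpha>(l := Suc (\<alpha> l))) x"
    unfolding hermite_upd hermite_fun_Suc[of "\<alpha> l"]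
    by (simp add: algebra_simps del: of_real_of_nat_eq)
  then show ?thesis by simp
qed

lemma hermite_has_partial_deriv:
  "((\<lambda>t. hermite \<alpha> (x + t *\<^sub>R axis l 1)) has_vector_derivative
     of_real (real (\<alpha> l)) * hermite (\<alpha>(l := \<alpha> l - 1)) x - 1/2 * hermite (\<alpha>(l := Suc (\<alpha> l))) x) (at 0)"
proof -
  define R where "R = (\<Prod>i\<in>UNIV-{l}. hermite_fun (\<alpha> i) (x $ i))"
  have "hermite \<alpha> (x + t *\<^sub>R axis l 1) = of_real (hermite_fun (\<alpha> l) (x $ l + t) * R)" for t
  proof -
    have "hermite \<alpha> (x + t *\<^sub>R axis l 1) = hermite (\<alpha>(l := \<alpha> l)) (x + t *\<^sub>R axis l 1)" by simp
    also have "\<dots> = of_real (hermite_fun (\<alpha> l) (x $ l + t) * R)"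
      unfolding hermite_upd R_def by (intro arg_cong[of _ _ of_real] arg_cong2[of _ _ _ _ "(*)"] prod.cong) (auto simp: axis_def)
    finally show ?thesis .
  qed
  then have eq: "(\<lambda>t. hermite \<alpha> (x + t *\<^sub>R axis l 1)) = (\<lambda>t. of_real (hermite_fun (\<alpha> l) (x $ l + t) * R))" by auto
  have "((\<lambda>t. hermite_fun (\<alpha> l) (x $ l + t) * R) has_real_derivative
     (2 * real (\<alpha> l) * hermite_fun (\<alpha> l - 1) (x $ l) - x $ l * hermite_fun (\<alpha> l) (x $ l)) * R) (at 0)"
  proof -
    have "(hermite_fun (\<alpha> l) has_real_derivative
      (2 * real (\<alpha> l) * hermite_fun (\<alpha> l - 1) (x $ l) - x $ l * hermite_fun (\<alpha> l) (x $ l))) (at (x $ l + 0))"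
      using hermite_fun_deriv[of "\<alpha> l" "x $ l"] by simp
    moreover have "((\<lambda>t. x $ l + t) has_real_derivative 1) (at 0)"
      by (auto intro!: derivative_eq_intros)
    ultimately have "((\<lambda>t. hermite_fun (\<alpha> l) (x $ l + t)) has_real_derivative
      (2 * real (\<alpha> l) * hermite_fun (\<alpha> l - 1) (x $ l) - x $ l * hermite_fun (\<alpha> l) (x $ l)) * 1) (at 0)"
      by (rule DERIV_chain2)
    from DERIV_cmult_right[OF this, of R] show ?thesis by simp
  qed
  then have 1: "((\<lambda>t. hermite \<alpha> (x + t *\<^sub>R axis l 1)) has_vector_derivative
     of_real ((2 * real (\<alpha> l) * hermite_fun (\<alpha> l - 1) (x $ l) - x $ l * hermite_fun (\<alpha> l) (x $ l)) * R)) (at 0)"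
    unfolding eq by (intro has_vector_derivative_of_real) (simp add: has_real_derivative_iff_has_vector_derivative)
  moreover have "complex_of_real ((2 * real (\<alpha> l) * hermite_fun (\<alpha> l - 1) (x $ l) - x $ l * hermite_fun (\<alpha> l) (x $ l)) * R)
     = of_real (real (\<alpha> l)) * hermite (\<alpha>(l := \<alpha> l - 1)) x - 1/2 * hermite (\<alpha>(l := Suc (\<alpha> l))) x"
    unfolding hermite_upd R_def[symmetric] hermite_fun_Suc[of "\<alpha> l"]
    by (simp add: algebra_simps)
  ultimately show ?thesis by simp
qed

lemma hermite_partial_deriv:
  "partial_deriv l (hermite \<alpha>) = (\<lambda>x. of_real (real (\<alpha> l)) * hermite (\<alpha>(l := \<alpha> l - 1)) x - 1/2 * hermite (\<alpha>(l := Suc (\<alpha> l))) x)"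
  by (rule ext, rule partial_deriv_eqI, rule hermite_has_partial_deriv)

inductive_set hspan :: "(real^'n::finite \<Rightarrow> complex) set" where
  hspan_base: "hermite \<alpha> \<in> hspan"
| hspan_add: "f \<in> hspan \<Longrightarrow> g \<in> hspan \<Longrightarrow> (\<lambda>x. f x + g x) \<in> hspan"
| hspan_cmult: "f \<in> hspan \<Longrightarrow> (\<lambda>x. c * f x) \<in> hspan"

lemma hspan_zero: "(\<lambda>x. 0) \<in> hspan"
  using hspan_cmult[OF hspan_base, of 0] by simp

lemma hspan_diff: "f \<in> hspan \<Longrightarrow> g \<in> hspan \<Longrightarrow> (\<lambda>x. f x - g x) \<in> hspan"
  using hspan_add[OF _ hspan_cmult, of f g "-1"] by simp

lemma continuous_hermite: "continuous_on UNIV (hermite \<alpha>)"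
proof -
  have c: "continuous_on UNIV (hermite_fun n)" for n
    by (intro continuous_at_imp_continuous_on ballI DERIV_isCont[OF hermite_fun_deriv])
  show ?thesis unfolding hermite_def[abs_def]
    by (intro continuous_on_of_real continuous_on_prod continuous_on_compose2[OF c] continuous_on_component continuous_on_id) auto
qed

lemma hspan_derivatives:
  assumes "f \<in> hspan"
  shows "continuous_on UNIV f \<and> partial_deriv i f \<in> hspan \<and>
     (\<forall>x. ((\<lambda>t. f (x + t *\<^sub>R axis i 1)) has_vector_derivative partial_deriv i f x) (at 0))"
  using assms
proof induction
  case (hspan_base \<alpha>)
  have "partial_deriv i (hermite \<alpha>) \<in> hspan" unfolding hermite_partial_deriv
    by (intro hspan_diff hspan_cmult hspan.hspan_base)
  then show ?case using hermite_has_partial_deriv[of \<alpha> _ i] continuous_hermite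
    by (auto simp: hermite_partial_deriv)
next
  case (hspan_add f g)
  then have D: "((\<lambda>t. f (x + t *\<^sub>R axis i 1) + g (x + t *\<^sub>R axis i 1)) has_vector_derivative
       partial_deriv i f x + partial_deriv i g x) (at 0)" for x
    by (intro has_vector_derivative_add) auto
  then have "partial_deriv i (\<lambda>x. f x + g x) = (\<lambda>x. partial_deriv i f x + partial_deriv i g x)"
    by (intro ext partial_deriv_eqI)
  with D show ?case using hspan_add by (auto intro: hspan.hspan_add continuous_on_add)
next
  case (hspan_cmult f c)
  then have D: "((\<lambda>t. c * f (x + t *\<^sub>R axis i 1)) has_vector_derivative
       c * partial_deriv i f x) (at 0)" for x
    by (intro has_vector_derivative_mult_right) auto
  then have "partial_deriv i (\<lambda>x. c * f x) = (\<lambda>x. c * partial_deriv i f x)"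
    by (intro ext partial_deriv_eqI)
  with D show ?case using hspan_cmult by (auto intro: hspan.hspan_cmult intro!: continuous_intros)
qed

lemma hspan_smooth: "f \<in> hspan \<Longrightarrow> f \<in> smooth_functions"
  using hspan_derivatives
  by (intro smooth_functionsI[where C=hspan]) (auto intro!: differentiableI_vector)

lemma hspan_partial_deriv: "f \<in> hspan \<Longrightarrow> partial_deriv i f \<in> hspan"
  using hspan_derivatives by blast

lemma hspan_coord: "f \<in> hspan \<Longrightarrow> (\<lambda>x. of_real (x $ l) * f x) \<in> hspan"
proof (induction rule: hspan.induct)
  case (hspan_base \<alpha>)
  show ?case unfolding hermite_coord by (intro hspan_add hspan_cmult hspan.hspan_base)
next
  case (hspan_add f g)
  then show ?case using hspan.hspan_add[OF hspan_add.IH] by (simp add: ring_distribs)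
next
  case (hspan_cmult f c)
  then show ?case using hspan.hspan_cmult[OF hspan_cmult.IH, of c] by (simp add: mult.left_commute)
qed

lemma sqint_hermite: "square_integrable (hermite \<alpha>)"
  unfolding square_integrable_def
proof
  show "hermite \<alpha> \<in> borel_measurable lborel"
    using borel_measurable_continuous_onI[OF continuous_hermite] by simp
  have "(hermite_fun n x)\<^sup>2 = poly (hermite_poly n * hermite_poly n) x * exp (- 1 * x\<^sup>2)" for n x
    by (simp add: hermite_fun_def power2_eq_square exp_add[symmetric])
  then have "integrable lborel (\<lambda>x. (hermite_fun n x)\<^sup>2)" for n
    using integrable_poly_gaussian[of 1 "hermite_poly n * hermite_poly n"] by simp
  then have "integrable lborel (\<lambda>x::real^'a. \<Prod>i\<in>UNIV. (hermite_fun (\<alpha> i) (x $ i))\<^sup>2)"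
    by (rule integrable_prod_coords)
  then show "integrable lborel (\<lambda>x. (cmod (hermite \<alpha> x))\<^sup>2)"
    unfolding hermite_def norm_of_real power2_abs prod_power_distrib .
qed

lemma hspan_sqint: "f \<in> hspan \<Longrightarrow> square_integrable f"
  by (induction rule: hspan.induct) (auto intro: sqint_hermite sqint_add sqint_cmult)

section \<open>Ladder operators and orthonormality\<close>

definition lowering :: "'n::finite \<Rightarrow> (real^'n \<Rightarrow> complex) \<Rightarrow> real^'n \<Rightarrow> complex" where
  "lowering l f x = of_real (x $ l) * f x + partial_deriv l f x"

definition raising :: "'n::finite \<Rightarrow> (real^'n \<Rightarrow> complex) \<Rightarrow> real^'n \<Rightarrow> complex" where
  "raising l f x = of_real (x $ l) * f x - partial_deriv l f x"

lemma lowering_hermite: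
  "lowering l (hermite \<alpha>) = (\<lambda>x. of_real (2 * real (\<alpha> l)) * hermite (\<alpha>(l := \<alpha> l - 1)) x)"
  by (auto simp: lowering_def[abs_def] hermite_coord hermite_partial_deriv)

lemma raising_hermite: "raising l (hermite \<alpha>) = hermite (\<alpha>(l := Suc (\<alpha> l)))"
  by (auto simp: raising_def[abs_def] hermite_coord hermite_partial_deriv)

lemma ip_coord: "ip (\<lambda>x. of_real (x $ l) * f x) g = ip f (\<lambda>x. of_real (x $ l) * g x)"
  by (simp add: ip_def mult_ac)

text \<open>The lowering and raising operators are adjoint, by integration by parts.\<close>

lemma ip_lowering:
  assumes f: "f \<in> smooth_functions" "square_integrable f"
      "square_integrable (\<lambda>x. of_real (x $ l) * f x)" "square_integrable (partial_deriv l f)"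
    and g: "g \<in> hspan"
  shows "ip (lowering l f) g = ip f (raising l g)"
proof -
  note sg = hspan_sqint[OF g] hspan_sqint[OF hspan_coord[OF g, of l]] hspan_sqint[OF hspan_partial_deriv[OF g, of l]]
  show ?thesis
    unfolding lowering_def[abs_def] raising_def[abs_def]
    using f sg ip_partial_deriv[OF f(1) hspan_smooth[OF g] f(2,4) sg(1,3)]
    by (simp add: ip_add_left ip_diff_right ip_coord)
qed

lemma ip_raising:
  assumes f: "f \<in> hspan" and g: "g \<in> hspan"
  shows "ip (raising l f) g = ip f (lowering l g)"
proof -
  have "ip (lowering l g) f = ip g (raising l f)"
    by (intro ip_lowering hspan_smooth hspan_sqint hspan_coord hspan_partial_deriv f g)
  then show ?thesis by (metis ip_cnj)
qed

text \<open>Moving raising operators from the left to the right as lowering operators annihilates the right-hand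
function once its index in direction \<open>l\<close> has reached \<open>0\<close>, before that of the left-hand one has.\<close>

lemma hermite_orthogonal_if_less:
  "\<beta> l < \<alpha> l \<Longrightarrow> ip (hermite \<alpha>) (hermite \<beta>) = 0"
proof (induction "\<beta> l" arbitrary: \<alpha> \<beta>)
  case (0 \<beta>)
  define \<alpha>' where "\<alpha>' = \<alpha>(l := \<alpha> l - 1)"
  have "hermite \<alpha> = raising l (hermite \<alpha>')"
    using 0 by (simp add: raising_hermite \<alpha>'_def)
  then have "ip (hermite \<alpha>) (hermite \<beta>) = ip (hermite \<alpha>') (lowering l (hermite \<beta>))"
    by (simp add: ip_raising hspan_base)
  then show ?case using 0 by (simp add: lowering_hermite ip_def)
next
  case (Suc k \<beta>)
  define \<alpha>' where "\<alpha>' = \<alpha>(l := \<alpha> l - 1)"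
  have "hermite \<alpha> = raising l (hermite \<alpha>')"
    using Suc.prems by (simp add: raising_hermite \<alpha>'_def)
  then have "ip (hermite \<alpha>) (hermite \<beta>) = ip (hermite \<alpha>') (lowering l (hermite \<beta>))"
    by (simp add: ip_raising hspan_base)
  also have "\<dots> = of_real (2 * real (\<beta> l)) * ip (hermite \<alpha>') (hermite (\<beta>(l := \<beta> l - 1)))"
    by (simp add: lowering_hermite ip_cmult_right)
  also have "ip (hermite \<alpha>') (hermite (\<beta>(l := \<beta> l - 1))) = 0"
    by (rule Suc.hyps(1)) (use Suc in \<open>auto simp: \<alpha>'_def\<close>)
  finally show ?case by simp
qed

lemma hermite_orthogonal:
  assumes "\<alpha> \<noteq> \<beta>" shows "ip (hermite \<alpha>) (hermite \<beta>) = 0"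
proof -
  obtain l where "\<alpha> l \<noteq> \<beta> l" using assms by auto
  then consider "\<beta> l < \<alpha> l" | "\<alpha> l < \<beta> l" by linarith
  then show ?thesis
    by cases (use hermite_orthogonal_if_less[of \<beta> l \<alpha>] hermite_orthogonal_if_less[of \<alpha> l \<beta>]
        ip_cnj[of "hermite \<alpha>" "hermite \<beta>"] in auto)
qed

lemma L2_norm_hermite_Suc:
  "L2_norm (hermite (\<alpha>(l := Suc (\<alpha> l)))) = sqrt (2 * real (Suc (\<alpha> l))) * L2_norm (hermite \<alpha>)"
proof -
  let ?\<beta> = "\<alpha>(l := Suc (\<alpha> l))"
  have "ip (hermite ?\<beta>) (hermite ?\<beta>) = ip (hermite \<alpha>) (lowering l (hermite ?\<beta>))"
    by (subst raising_hermite[symmetric]) (simp add: ip_raising hspan_base)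
  also have "\<dots> = of_real (2 * real (Suc (\<alpha> l))) * ip (hermite \<alpha>) (hermite \<alpha>)"
    by (simp add: lowering_hermite ip_cmult_right del: of_nat_Suc)
  finally have "(L2_norm (hermite ?\<beta>))\<^sup>2 = 2 * real (Suc (\<alpha> l)) * (L2_norm (hermite \<alpha>))\<^sup>2"
    unfolding ip_self of_real_mult[symmetric] of_real_eq_iff .
  also have "\<dots> = (sqrt (2 * real (Suc (\<alpha> l))) * L2_norm (hermite \<alpha>))\<^sup>2"
    by (simp add: power_mult_distrib)
  finally show ?thesis by (rule power2_eq_imp_eq) auto
qed

text \<open>Raising multiplies the norm by a positive factor, so the claim reduces to the Gaussian, which has no zeros.\<close>

lemma L2_norm_hermite_pos: "L2_norm (hermite \<alpha>) > 0"
proof (induction "msize \<alpha>" arbitrary: \<alpha>)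
  case 0
  then have a: "\<alpha> = (\<lambda>_. 0)" by (auto simp: msize_def)
  have pos: "hermite \<alpha> x \<noteq> 0" for x
    by (simp add: hermite_def a hermite_fun_def)
  have "L2_norm (hermite \<alpha>) \<noteq> 0"
  proof
    assume "L2_norm (hermite \<alpha>) = 0"
    then have "AE x in lborel. (cmod (hermite \<alpha> x))\<^sup>2 = 0"
      using integral_nonneg_eq_0_iff_AE[of lborel "\<lambda>x. (cmod (hermite \<alpha> x))\<^sup>2"] sqint_hermite[of \<alpha>]
      by (auto simp: L2_norm_def square_integrable_def)
    then have "AE x::real^'a in lborel. False" using pos by simp
    then have "emeasure lborel (space (lborel :: (real^'a) measure)) = 0"
      by (subst (asm) AE_iff_null) auto
    then show False by simp
  qed
  then show ?case using L2_norm_nonneg[of "hermite \<alpha>"] by linarith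
next
  case (Suc n)
  obtain l where l: "\<alpha> l > 0"
  proof -
    have "\<exists>l. \<alpha> l > 0"
    proof (rule ccontr)
      assume "\<not> (\<exists>l. \<alpha> l > 0)"
      then have "msize \<alpha> = 0" by (auto simp: msize_def)
      then show False using Suc by simp
    qed
    then show thesis using that by auto
  qed
  define \<beta> where "\<beta> = \<alpha>(l := \<alpha> l - 1)"
  have \<alpha>: "\<alpha> = \<beta>(l := Suc (\<beta> l))" using l by (auto simp: \<beta>_def)
  have "msize \<alpha> = Suc (msize \<beta>)"
    unfolding msize_def by (subst \<alpha>, subst (1 2) sum.remove[of UNIV l]) (auto intro!: sum.cong)
  then have "L2_norm (hermite \<beta>) > 0" using Suc by simp
  then show ?case by (subst \<alpha>, subst L2_norm_hermite_Suc) auto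
qed

definition nhermite :: "('n::finite \<Rightarrow> nat) \<Rightarrow> real^'n \<Rightarrow> complex" where
  "nhermite \<alpha> x = of_real (inverse (L2_norm (hermite \<alpha>))) * hermite \<alpha> x"

lemma nhermite_hspan: "nhermite \<alpha> \<in> hspan"
  unfolding nhermite_def[abs_def] by (intro hspan_cmult hspan_base)

lemma hermite_nhermite: "hermite \<alpha> x = of_real (L2_norm (hermite \<alpha>)) * nhermite \<alpha> x"
  using L2_norm_hermite_pos[of \<alpha>] by (simp add: nhermite_def)

lemma nhermite_orthonormal: "ip (nhermite \<alpha>) (nhermite \<beta>) = (if \<alpha> = \<beta> then 1 else 0)"
proof -
  have "inverse c * (inverse c * (c * c)) = 1" if "c \<noteq> 0" for c :: complex
    using that by (simp add: mult.assoc[symmetric])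
  then show ?thesis
    using L2_norm_hermite_pos[of \<alpha>]
    unfolding nhermite_def[abs_def] ip_cmult_left ip_cmult_right
    by (auto simp: hermite_orthogonal ip_self power2_eq_square)
qed

lemma L2_norm_nhermite [simp]: "L2_norm (nhermite \<alpha>) = 1"
  using L2_norm_hermite_pos[of \<alpha>] unfolding nhermite_def[abs_def] L2_norm_cmult by (simp add: norm_inverse)

lemma raising_nhermite:
  "raising l (nhermite \<alpha>) = (\<lambda>x. of_real (sqrt (2 * real (Suc (\<alpha> l)))) * nhermite (\<alpha>(l := Suc (\<alpha> l))) x)"
proof
  fix x
  have "raising l (nhermite \<alpha>) x = of_real (inverse (L2_norm (hermite \<alpha>))) * raising l (hermite \<alpha>) x"
    unfolding raising_def nhermite_def[abs_def]
    unfolding partial_deriv_cmult[OF hspan_smooth[OF hspan_base]]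
    by (simp add: right_diff_distrib mult.left_commute)
  also have "\<dots> = of_real (inverse (L2_norm (hermite \<alpha>))) *
    (of_real (sqrt (2 * real (Suc (\<alpha> l))) * L2_norm (hermite \<alpha>)) * nhermite (\<alpha>(l := Suc (\<alpha> l))) x)"
    unfolding raising_hermite by (subst hermite_nhermite) (simp only: L2_norm_hermite_Suc)
  also have "\<dots> = of_real (sqrt (2 * real (Suc (\<alpha> l)))) * nhermite (\<alpha>(l := Suc (\<alpha> l))) x"
    using L2_norm_hermite_pos[of \<alpha>] by simp
  finally show "raising l (nhermite \<alpha>) x = \<dots>" .
qed

lemma lowering_nhermite:
  "lowering l (nhermite \<alpha>) = (\<lambda>x. of_real (sqrt (2 * real (\<alpha> l))) * nhermite (\<alpha>(l := \<alpha> l - 1)) x)"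
proof
  fix x
  have *: "lowering l (nhermite \<alpha>) x = of_real (inverse (L2_norm (hermite \<alpha>))) * lowering l (hermite \<alpha>) x"
    unfolding lowering_def nhermite_def[abs_def]
    unfolding partial_deriv_cmult[OF hspan_smooth[OF hspan_base]]
    by (simp add: distrib_left mult.left_commute)
  show "lowering l (nhermite \<alpha>) x = of_real (sqrt (2 * real (\<alpha> l))) * nhermite (\<alpha>(l := \<alpha> l - 1)) x"
  proof (cases "\<alpha> l = 0")
    case True
    then show ?thesis unfolding * lowering_hermite by simp
  next
    case False
    define \<beta> where "\<beta> = \<alpha>(l := \<alpha> l - 1)"
    have N: "L2_norm (hermite \<alpha>) = sqrt (2 * real (\<alpha> l)) * L2_norm (hermite \<beta>)"
      using L2_norm_hermite_Suc[of \<beta> l] False by (simp add: \<beta>_def)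
    have p: "L2_norm (hermite \<beta>) > 0" by (rule L2_norm_hermite_pos)
    have "inverse (L2_norm (hermite \<alpha>)) * (2 * real (\<alpha> l)) * L2_norm (hermite \<beta>) = sqrt (2 * real (\<alpha> l))"
    proof -
      define s where "s = sqrt (2 * real (\<alpha> l))"
      have "s > 0" "2 * real (\<alpha> l) = s * s" using False by (simp_all add: s_def)
      then show ?thesis unfolding N s_def[symmetric] using p by (simp add: field_simps)
    qed
    note X = this
    have "lowering l (nhermite \<alpha>) x = of_real (inverse (L2_norm (hermite \<alpha>))) *
       (of_real (2 * real (\<alpha> l)) * hermite \<beta> x)"
      unfolding * lowering_hermite \<beta>_def ..
    also have "hermite \<beta> x = of_real (L2_norm (hermite \<beta>)) * nhermite \<beta> x"
      by (rule hermite_nhermite)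
    also have "of_real (inverse (L2_norm (hermite \<alpha>))) * (of_real (2 * real (\<alpha> l)) *
        (of_real (L2_norm (hermite \<beta>)) * nhermite \<beta> x)) =
      of_real (inverse (L2_norm (hermite \<alpha>)) * (2 * real (\<alpha> l)) * L2_norm (hermite \<beta>)) * nhermite \<beta> x"
      by (simp only: of_real_mult mult.assoc)
    finally show ?thesis unfolding X unfolding \<beta>_def .
  qed
qed

lemma nhermite_coord:
  "of_real (x $ l) * nhermite \<alpha> x =
     of_real (sqrt (real (\<alpha> l) / 2)) * nhermite (\<alpha>(l := \<alpha> l - 1)) x
     + of_real (sqrt (real (Suc (\<alpha> l)) / 2)) * nhermite (\<alpha>(l := Suc (\<alpha> l))) x" (is ?A)
  and nhermite_partial_deriv:
  "partial_deriv l (nhermite \<alpha>) x =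
     of_real (sqrt (real (\<alpha> l) / 2)) * nhermite (\<alpha>(l := \<alpha> l - 1)) x
     - of_real (sqrt (real (Suc (\<alpha> l)) / 2)) * nhermite (\<alpha>(l := Suc (\<alpha> l))) x" (is ?B)
proof -
  have s: "sqrt (2 * a) / 2 = sqrt (a / 2)" if "a \<ge> 0" for a
  proof -
    have "sqrt (2 * a) / 2 = sqrt (2 * a) / sqrt 4" by simp
    also have "\<dots> = sqrt (a / 2)" by (simp only: real_sqrt_divide[symmetric]) simp
    finally show ?thesis .
  qed
  have s1: "sqrt (real (\<alpha> l) / 2) = sqrt (2 * real (\<alpha> l)) / 2"
    and s2: "sqrt (real (Suc (\<alpha> l)) / 2) = sqrt (2 * real (Suc (\<alpha> l))) / 2"
    by (rule s[symmetric], rule of_nat_0_le_iff)+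
  have "of_real (x $ l) * nhermite \<alpha> x = (lowering l (nhermite \<alpha>) x + raising l (nhermite \<alpha>) x) / 2"
    by (simp add: lowering_def raising_def)
  then show ?A unfolding lowering_nhermite raising_nhermite s1 s2
    by (simp add: add_divide_distrib del: of_nat_Suc)
  have "partial_deriv l (nhermite \<alpha>) x = (lowering l (nhermite \<alpha>) x - raising l (nhermite \<alpha>) x) / 2"
    by (simp add: lowering_def raising_def)
  then show ?B unfolding lowering_nhermite raising_nhermite s1 s2
    by (simp add: diff_divide_distrib del: of_nat_Suc)
qed

section \<open>Words in coordinates and partial derivatives\<close>

text \<open>Multiplications by coordinates and partial derivatives are treated uniformly as letters, so that an
estimate for all operators of the form \<open>x\<^sup>\<alpha> \<partial>\<^sup>\<beta>\<close> becomes an induction on the length of a word.\<close>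

fun letter :: "bool \<times> 'n::finite \<Rightarrow> (real^'n \<Rightarrow> complex) \<Rightarrow> real^'n \<Rightarrow> complex" where
  "letter (False, l) f = (\<lambda>x. of_real (x $ l) * f x)"
| "letter (True, l) f = partial_deriv l f"

lemma hspan_letter: "f \<in> hspan \<Longrightarrow> letter c f \<in> hspan"
  by (cases "(c, f)" rule: letter.cases) (auto intro: hspan_coord hspan_partial_deriv)

lemma hspan_word: "f \<in> hspan \<Longrightarrow> foldr letter w f \<in> hspan"
  by (induction w) (auto intro: hspan_letter)

lemma smooth_letter: "f \<in> smooth_functions \<Longrightarrow> letter c f \<in> smooth_functions"
  by (cases "(c, f)" rule: letter.cases) (auto intro: smooth_coord smooth_partial_deriv)

lemma smooth_word: "f \<in> smooth_functions \<Longrightarrow> foldr letter w f \<in> smooth_functions"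
  by (induction w) (auto intro: smooth_letter)

lemma letter_add:
  assumes "f \<in> smooth_functions" "g \<in> smooth_functions"
  shows "letter c (\<lambda>x. f x + g x) = (\<lambda>x. letter c f x + letter c g x)"
  by (cases "(c, f)" rule: letter.cases) (use assms in \<open>auto simp: partial_deriv_add ring_distribs\<close>)

lemma letter_cmult:
  assumes "f \<in> smooth_functions"
  shows "letter c (\<lambda>x. a * f x) = (\<lambda>x. a * letter c f x)"
  by (cases "(c, f)" rule: letter.cases) (use assms in \<open>auto simp: partial_deriv_cmult\<close>)

lemma word_add:
  assumes "f \<in> smooth_functions" "g \<in> smooth_functions"
  shows "foldr letter w (\<lambda>x. f x + g x) = (\<lambda>x. foldr letter w f x + foldr letter w g x)"
  by (induction w) (use assms in \<open>auto simp: letter_add smooth_word\<close>)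

lemma word_cmult:
  assumes "f \<in> smooth_functions"
  shows "foldr letter w (\<lambda>x. a * f x) = (\<lambda>x. a * foldr letter w f x)"
  by (induction w) (use assms in \<open>auto simp: letter_cmult smooth_word\<close>)

lemma word_sum:
  assumes "\<And>i. i \<in> I \<Longrightarrow> f i \<in> smooth_functions"
  shows "foldr letter w (\<lambda>x. \<Sum>i\<in>I. f i x) = (\<lambda>x. \<Sum>i\<in>I. foldr letter w (f i) x)"
  using assms
proof (induction I rule: infinite_finite_induct)
  case (insert i I)
  then show ?case by (simp add: word_add smooth_sum)
qed (use word_cmult[OF smooth_zero, of w 0] in auto)

lemma msize_upd_Suc: "msize (\<alpha>(l := Suc (\<alpha> l))) = Suc (msize \<alpha>)"
  unfolding msize_def by (subst (1 2) sum.remove[of UNIV l]) (auto intro!: sum.cong)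

lemma msize_upd_diff: "msize (\<alpha>(l := \<alpha> l - 1)) \<le> msize \<alpha>"
  unfolding msize_def by (intro sum_mono) auto

lemma le_msize: "\<alpha> l \<le> msize \<alpha>"
  unfolding msize_def by (rule member_le_sum) auto

lemma letter_nhermite:
  "\<exists>\<sigma>\<in>{1,-1}. letter c (nhermite \<alpha>) = (\<lambda>x. of_real (sqrt (real (\<alpha> (snd c)) / 2)) * nhermite (\<alpha>(snd c := \<alpha> (snd c) - 1)) x
     + (\<sigma> * of_real (sqrt (real (Suc (\<alpha> (snd c))) / 2))) * nhermite (\<alpha>(snd c := Suc (\<alpha> (snd c)))) x)"
proof (cases "(c, nhermite \<alpha>)" rule: letter.cases)
  case (1 l f)
  then show ?thesis by (intro bexI[of _ 1]) (auto simp: nhermite_coord)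
next
  case (2 l f)
  then show ?thesis by (intro bexI[of _ "-1"]) (auto simp: nhermite_partial_deriv)
qed

text \<open>Peeling off the innermost letter replaces \<open>nhermite \<alpha>\<close> by two neighbours, whose indices have size at most
\<open>msize \<alpha> + 1\<close>; each coefficient is at most half of the factor \<open>sqrt (2 * (msize \<alpha> + length w))\<close>.\<close>

lemma L2_norm_word_nhermite:
  "L2_norm (foldr letter w (nhermite \<alpha>)) \<le> sqrt (2 * real (msize \<alpha> + length w)) ^ length w"
proof (induction w arbitrary: \<alpha> rule: rev_induct)
  case Nil
  then show ?case by simp
next
  case (snoc c w)
  define l where "l = snd c"
  define \<alpha>1 where "\<alpha>1 = \<alpha>(l := \<alpha> l - 1)"
  define \<alpha>2 where "\<alpha>2 = \<alpha>(l := Suc (\<alpha> l))"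
  define N where "N = real (msize \<alpha> + length (w @ [c]))"
  obtain \<sigma> :: complex where \<sigma>: "\<sigma> \<in> {1,-1}" and eq: "letter c (nhermite \<alpha>) = (\<lambda>x. of_real (sqrt (real (\<alpha> l) / 2)) * nhermite \<alpha>1 x
     + (\<sigma> * of_real (sqrt (real (Suc (\<alpha> l)) / 2))) * nhermite \<alpha>2 x)"
    using letter_nhermite[of c \<alpha>] unfolding l_def \<alpha>1_def \<alpha>2_def by blast
  have sm: "nhermite \<gamma> \<in> smooth_functions" for \<gamma> :: "'a \<Rightarrow> nat" by (intro hspan_smooth nhermite_hspan)
  have sq: "square_integrable (\<lambda>x. a * foldr letter w (nhermite \<gamma>) x)" for \<gamma> :: "'a \<Rightarrow> nat" and a
    by (intro sqint_cmult hspan_sqint hspan_word nhermite_hspan)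
  have b: "L2_norm (foldr letter w (nhermite \<gamma>)) \<le> sqrt (2 * N) ^ length w"
    if "msize \<gamma> \<le> Suc (msize \<alpha>)" for \<gamma> :: "'a \<Rightarrow> nat"
  proof -
    have "L2_norm (foldr letter w (nhermite \<gamma>)) \<le> sqrt (2 * real (msize \<gamma> + length w)) ^ length w"
      by (rule snoc)
    also have "\<dots> \<le> sqrt (2 * N) ^ length w"
      using that by (intro power_mono real_sqrt_le_mono) (auto simp: N_def)
    finally show ?thesis .
  qed
  have s: "cmod \<sigma> = 1" using \<sigma> by auto
  have c1: "sqrt (real (\<alpha> l) / 2) \<le> sqrt (2 * N) / 2" and c2: "sqrt (real (Suc (\<alpha> l)) / 2) \<le> sqrt (2 * N) / 2"
  proof -
    have "sqrt (2 * N) / 2 = sqrt (2 * N) / sqrt 4" by simp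
    also have "\<dots> = sqrt (N / 2)" by (simp only: real_sqrt_divide[symmetric]) simp
    finally have e: "sqrt (2 * N) / 2 = sqrt (N / 2)" .
    show "sqrt (real (\<alpha> l) / 2) \<le> sqrt (2 * N) / 2" "sqrt (real (Suc (\<alpha> l)) / 2) \<le> sqrt (2 * N) / 2"
      unfolding e unfolding N_def using le_msize[of \<alpha> l] by (auto intro!: real_sqrt_le_mono)
  qed
  have "foldr letter (w @ [c]) (nhermite \<alpha>) = (\<lambda>x. of_real (sqrt (real (\<alpha> l) / 2)) * foldr letter w (nhermite \<alpha>1) x
     + (\<sigma> * of_real (sqrt (real (Suc (\<alpha> l)) / 2))) * foldr letter w (nhermite \<alpha>2) x)"
    by (simp add: eq word_add word_cmult sm smooth_cmult)
  then have "L2_norm (foldr letter (w @ [c]) (nhermite \<alpha>)) \<le>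
     L2_norm (\<lambda>x. of_real (sqrt (real (\<alpha> l) / 2)) * foldr letter w (nhermite \<alpha>1) x)
     + L2_norm (\<lambda>x. (\<sigma> * of_real (sqrt (real (Suc (\<alpha> l)) / 2))) * foldr letter w (nhermite \<alpha>2) x)"
    using L2_norm_triangle[OF sq sq] by simp
  also have "\<dots> = sqrt (real (\<alpha> l) / 2) * L2_norm (foldr letter w (nhermite \<alpha>1))
    + sqrt (real (Suc (\<alpha> l)) / 2) * L2_norm (foldr letter w (nhermite \<alpha>2))"
    by (simp add: L2_norm_cmult norm_mult s del: of_nat_Suc)
  also have "\<dots> \<le> sqrt (2 * N) / 2 * sqrt (2 * N) ^ length w + sqrt (2 * N) / 2 * sqrt (2 * N) ^ length w"
    using msize_upd_diff[of \<alpha> l] by (intro add_mono mult_mono c1 c2 b)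
       (auto simp: \<alpha>1_def \<alpha>2_def msize_upd_Suc N_def)
  also have "\<dots> = sqrt (2 * N) ^ length (w @ [c])" by simp
  finally show ?case by (simp only: N_def)
qed

definition word_of :: "bool \<Rightarrow> 'n list \<Rightarrow> ('n \<Rightarrow> nat) \<Rightarrow> (bool \<times> 'n) list" where
  "word_of b cs \<alpha> = concat (map (\<lambda>i. replicate (\<alpha> i) (b, i)) cs)"

lemma coords_props: "set (coords :: 'n::finite list) = UNIV" "distinct (coords :: 'n list)"
proof -
  have "\<exists>is. set is = (UNIV :: 'n set) \<and> distinct is"
    using finite_distinct_list[of "UNIV :: 'n set"] by auto
  from someI_ex[OF this] show "set (coords :: 'n list) = UNIV" "distinct (coords :: 'n list)"
    unfolding coords_def by auto
qed

lemma length_word_of: "length (word_of b coords \<alpha>) = msize \<alpha>"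
proof -
  have "length (word_of b coords \<alpha>) = (\<Sum>i\<leftarrow>coords. \<alpha> i)"
    by (simp add: word_of_def length_concat o_def)
  also have "\<dots> = msize \<alpha>"
    using sum_list_distinct_conv_sum_set[OF coords_props(2), of \<alpha>] by (simp add: coords_props msize_def)
  finally show ?thesis .
qed

lemma foldr_replicate: "foldr g (replicate n a) f = (g a ^^ n) f"
  by (induction n) auto

lemma foldr_letter_word_of:
  "foldr letter (word_of b cs \<alpha>) f = foldr (\<lambda>i. letter (b, i) ^^ \<alpha> i) cs f"
  by (induction cs) (auto simp: word_of_def foldr_replicate)

lemma multi_deriv_word: "multi_deriv \<beta> f = foldr letter (word_of True coords \<beta>) f"
proof -
  have "letter (True, i) = partial_deriv i" for i :: 'a by (rule ext) simp
  then show ?thesis unfolding multi_deriv_def foldr_letter_word_of by simp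
qed

lemma monomial_word: "(\<lambda>x. of_real (monomial \<alpha> x) * f x) = foldr letter (word_of False coords \<alpha>) f"
proof -
  have pow: "(letter (False, i) ^^ n) g = (\<lambda>x. of_real (x $ i) ^ n * g x)" for i :: 'a and n g
    by (induction n) (auto simp: mult.assoc)
  have "foldr letter (word_of False cs \<alpha>) f = (\<lambda>x. of_real (\<Prod>i\<leftarrow>cs. (x $ i) ^ \<alpha> i) * f x)" for cs
    unfolding foldr_letter_word_of by (induction cs) (auto simp: pow mult.assoc simp del: letter.simps)
  moreover have "monomial \<alpha> x = (\<Prod>i\<leftarrow>coords. (x $ i) ^ \<alpha> i)" for x
    using prod.distinct_set_conv_list[OF coords_props(2), of "\<lambda>i. (x $ i) ^ \<alpha> i"]
    by (simp add: coords_props monomial_def)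
  ultimately show ?thesis by simp
qed

text \<open>The word of the operator \<open>x\<^sup>\<alpha> \<partial>\<^sup>\<beta>\<close>.\<close>

definition xd_word :: "('n::finite \<Rightarrow> nat) \<Rightarrow> ('n \<Rightarrow> nat) \<Rightarrow> (bool \<times> 'n) list" where
  "xd_word \<alpha> \<beta> = word_of False coords \<alpha> @ word_of True coords \<beta>"

lemma xd_word:
  "(\<lambda>x. of_real (monomial \<alpha> x) * multi_deriv \<beta> f x) = foldr letter (xd_word \<alpha> \<beta>) f"
  by (simp add: xd_word_def monomial_word multi_deriv_word)

lemma length_xd_word: "length (xd_word \<alpha> \<beta>) = msize (\<lambda>i. \<alpha> i + \<beta> i)"
  by (simp add: xd_word_def length_word_of msize_def sum.distrib)

section \<open>Completeness of the Hermite functions\<close>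

definition hclosure :: "(real^'n::finite \<Rightarrow> complex) set" where
  "hclosure = {v. square_integrable v \<and> (\<forall>e>0. \<exists>h\<in>hspan. L2_norm (\<lambda>x. v x - h x) < e)}"

lemma hclosureE:
  assumes "v \<in> hclosure" "e > 0"
  obtains h where "h \<in> hspan" "L2_norm (\<lambda>x. v x - h x) < e"
  using assms unfolding hclosure_def by blast

lemma hclosure_sqint: "v \<in> hclosure \<Longrightarrow> square_integrable v"
  by (simp add: hclosure_def)

lemma hspan_subset_hclosure: "h \<in> hspan \<Longrightarrow> h \<in> hclosure"
  by (auto simp: hclosure_def hspan_sqint intro!: bexI[of _ h])

lemma hclosure_add:
  assumes "f \<in> hclosure" "g \<in> hclosure" shows "(\<lambda>x. f x + g x) \<in> hclosure"
  unfolding hclosure_def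
proof (intro CollectI conjI allI impI)
  show "square_integrable (\<lambda>x. f x + g x)" using assms by (auto simp: hclosure_def intro: sqint_add)
  fix e :: real assume e: "e > 0"
  then have e2: "e / 2 > 0" by simp
  obtain a where a: "a \<in> hspan" "L2_norm (\<lambda>x. f x - a x) < e / 2" using hclosureE[OF assms(1) e2] .
  obtain b where b: "b \<in> hspan" "L2_norm (\<lambda>x. g x - b x) < e / 2" using hclosureE[OF assms(2) e2] .
  have "L2_norm (\<lambda>x. (f x - a x) + (g x - b x)) \<le> L2_norm (\<lambda>x. f x - a x) + L2_norm (\<lambda>x. g x - b x)"
    by (intro L2_norm_triangle sqint_diff hspan_sqint hclosure_sqint assms a b)
  moreover have "(\<lambda>x. (f x - a x) + (g x - b x)) = (\<lambda>x. f x + g x - (a x + b x))" by (auto simp: algebra_simps)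
  ultimately have "L2_norm (\<lambda>x. f x + g x - (a x + b x)) < e" using a b by simp
  then show "\<exists>h\<in>hspan. L2_norm (\<lambda>x. f x + g x - h x) < e"
    by (rule bexI[OF _ hspan_add[OF a(1) b(1)]])
qed

lemma hclosure_cmult:
  assumes "f \<in> hclosure" shows "(\<lambda>x. c * f x) \<in> hclosure"
  unfolding hclosure_def
proof (intro CollectI conjI allI impI)
  show "square_integrable (\<lambda>x. c * f x)" using assms by (auto simp: hclosure_def intro: sqint_cmult)
  fix e :: real assume e: "e > 0"
  have p: "e / (cmod c + 1) > 0" using e by (intro divide_pos_pos add_nonneg_pos) auto
  obtain a where a: "a \<in> hspan" "L2_norm (\<lambda>x. f x - a x) < e / (cmod c + 1)"
    using hclosureE[OF assms p] .
  have "L2_norm (\<lambda>x. c * (f x - a x)) = cmod c * L2_norm (\<lambda>x. f x - a x)" by (rule L2_norm_cmult)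
  also have "\<dots> \<le> cmod c * (e / (cmod c + 1))" using a by (intro mult_left_mono) auto
  also have "\<dots> < (cmod c + 1) * (e / (cmod c + 1))" using p by (intro mult_strict_right_mono) auto
  also have "\<dots> = e" by (simp add: add_nonneg_eq_0_iff)
  finally have "L2_norm (\<lambda>x. c * f x - c * a x) < e" by (simp add: right_diff_distrib)
  then show "\<exists>h\<in>hspan. L2_norm (\<lambda>x. c * f x - h x) < e"
    by (rule bexI[OF _ hspan_cmult[OF a(1)]])
qed

lemma hclosure_sum: "(\<And>i. i \<in> I \<Longrightarrow> f i \<in> hclosure) \<Longrightarrow> (\<lambda>x. \<Sum>i\<in>I. f i x) \<in> hclosure"
  by (induction I rule: infinite_finite_induct)
     (auto intro: hclosure_add hspan_subset_hclosure hspan_zero)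

lemma hclosure_closed:
  assumes v: "square_integrable v" and ex: "\<And>e. e > 0 \<Longrightarrow> \<exists>w\<in>hclosure. L2_norm (\<lambda>x. v x - w x) < e"
  shows "v \<in> hclosure"
  unfolding hclosure_def
proof (intro CollectI conjI allI impI v)
  fix e :: real assume e: "e > 0"
  obtain w where w: "w \<in> hclosure" "L2_norm (\<lambda>x. v x - w x) < e / 2" using ex[of "e / 2"] e by auto
  have e2: "e / 2 > 0" using e by simp
  obtain h where h: "h \<in> hspan" "L2_norm (\<lambda>x. w x - h x) < e / 2" using hclosureE[OF w(1) e2] .
  have "L2_norm (\<lambda>x. (v x - w x) + (w x - h x)) \<le> L2_norm (\<lambda>x. v x - w x) + L2_norm (\<lambda>x. w x - h x)"
    by (intro L2_norm_triangle sqint_diff hspan_sqint hclosure_sqint v w h)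
  then show "\<exists>h\<in>hspan. L2_norm (\<lambda>x. v x - h x) < e" using w h by (intro bexI[of _ h]) auto
qed

text \<open>Dominated pointwise convergence implies \<open>L\<^sup>2\<close> convergence.\<close>

lemma hclosure_dominated:
  fixes v w :: "real^'n::finite \<Rightarrow> complex"
  assumes s: "\<And>n. s n \<in> hclosure" and lim: "\<And>x. (\<lambda>n. s n x) \<longlonglongrightarrow> v x"
    and w: "square_integrable w" and dom: "\<And>n x. cmod (s n x) \<le> cmod (w x)"
  shows "v \<in> hclosure"
proof -
  have ms: "s n \<in> borel_measurable borel" for n
    using s[of n] by (auto simp: hclosure_def square_integrable_def)
  have mv: "v \<in> borel_measurable borel"
    by (rule borel_measurable_LIMSEQ_metric[OF ms lim])
  have vw: "cmod (v x) \<le> cmod (w x)" for x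
    by (rule LIMSEQ_le_const2[OF tendsto_norm[OF lim]]) (use dom in auto)
  have v: "square_integrable v" by (rule L2_norm_mono[OF w mv vw])
  have "(\<lambda>n. LINT x|lborel. (cmod (v x - s n x))\<^sup>2) \<longlonglongrightarrow> (LINT x|(lborel :: (real^'n) measure). (0::real))"
  proof (rule integral_dominated_convergence[where w="\<lambda>x. 4 * (cmod (w x))\<^sup>2"])
    show "(\<lambda>x. (cmod (v x - s n x))\<^sup>2) \<in> borel_measurable lborel" for n
      using ms[of n] mv by auto
    show "integrable lborel (\<lambda>x. 4 * (cmod (w x))\<^sup>2)" using w by (simp add: square_integrable_def)
    show "AE x in lborel. (\<lambda>n. (cmod (v x - s n x))\<^sup>2) \<longlonglongrightarrow> 0"
    proof (rule AE_I2)
      fix x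
      have "(\<lambda>n. (cmod (v x - s n x))\<^sup>2) \<longlonglongrightarrow> (cmod (v x - v x))\<^sup>2"
        by (intro tendsto_intros lim)
      then show "(\<lambda>n. (cmod (v x - s n x))\<^sup>2) \<longlonglongrightarrow> 0" by simp
    qed
    show "AE x in lborel. norm ((cmod (v x - s n x))\<^sup>2) \<le> 4 * (cmod (w x))\<^sup>2" for n
    proof (rule AE_I2)
      fix x
      have "cmod (v x - s n x) \<le> 2 * cmod (w x)"
        using norm_triangle_ineq4[of "v x" "s n x"] vw[of x] dom[of n x] by linarith
      then have "(cmod (v x - s n x))\<^sup>2 \<le> (2 * cmod (w x))\<^sup>2" by (intro power_mono) auto
      then show "norm ((cmod (v x - s n x))\<^sup>2) \<le> 4 * (cmod (w x))\<^sup>2" by (simp add: power_mult_distrib)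
    qed
  qed auto
  then have "(\<lambda>n. sqrt (LINT x|lborel. (cmod (v x - s n x))\<^sup>2)) \<longlonglongrightarrow> sqrt 0"
    by (intro tendsto_real_sqrt) simp
  then have l0: "(\<lambda>n. L2_norm (\<lambda>x. v x - s n x)) \<longlonglongrightarrow> 0" by (simp add: L2_norm_def)
  have "\<exists>w\<in>hclosure. L2_norm (\<lambda>x. v x - w x) < e" if e: "e > 0" for e
  proof -
    obtain n where "L2_norm (\<lambda>x. v x - s n x) < e"
      using eventually_happens'[OF sequentially_bot order_tendstoD(2)[OF l0 e]] by blast
    then show ?thesis by (rule bexI[OF _ s])
  qed
  then show ?thesis by (rule hclosure_closed[OF v])
qed

definition pgauss :: "('n::finite \<Rightarrow> nat) \<Rightarrow> real \<Rightarrow> real^'n \<Rightarrow> complex" where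
  "pgauss \<alpha> t x = of_real (monomial \<alpha> x * exp (- t * (norm x)\<^sup>2))"

lemma monomial_upd: "monomial (\<alpha>(l := \<alpha> l + m)) x = (x $ l) ^ m * monomial \<alpha> x"
  unfolding monomial_def prod_fun_upd[of "\<lambda>i k. (x $ i) ^ k"]
  by (subst prod.remove[of UNIV l]) (auto simp: power_add)

lemma pgauss_half_hspan: "pgauss \<alpha> (1/2) \<in> hspan"
proof -
  have "hermite (\<lambda>_. 0) x = of_real (exp (- (1/2) * (norm x)\<^sup>2))" for x :: "real^'a"
    using monomial_exp_eq[of "\<lambda>_. 0" x "1/2"]
    by (simp add: hermite_def hermite_fun_def monomial_def mult.commute)
  then have "pgauss \<alpha> (1/2) = foldr letter (word_of False coords \<alpha>) (hermite (\<lambda>_. 0))"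
    by (simp add: pgauss_def[abs_def] monomial_word[symmetric])
  then show ?thesis using hspan_word[OF hspan_base] by metis
qed

lemma pgauss_norm_power_hclosure:
  fixes \<alpha> :: "'n::finite \<Rightarrow> nat"
  assumes "\<And>\<alpha>::'n \<Rightarrow> nat. pgauss \<alpha> t \<in> hclosure"
  shows "(\<lambda>x. of_real ((norm x)\<^sup>2) ^ k * pgauss \<alpha> t x) \<in> hclosure"
proof (induction k arbitrary: \<alpha>)
  case 0
  then show ?case using assms by simp
next
  case (Suc k)
  have n: "(norm x)\<^sup>2 = (\<Sum>i\<in>UNIV. (x $ i)\<^sup>2)" for x :: "real^'n"
    unfolding power2_norm_eq_inner inner_vec_def by (simp add: power2_eq_square)
  have "of_real ((norm x)\<^sup>2) * pgauss \<alpha> t x = (\<Sum>i\<in>UNIV. pgauss (\<alpha>(i := \<alpha> i + 2)) t x)" for x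
    unfolding pgauss_def monomial_upd by (simp add: n sum_distrib_right mult.assoc)
  then have "(\<lambda>x. of_real ((norm x)\<^sup>2) ^ Suc k * pgauss \<alpha> t x) =
     (\<lambda>x. \<Sum>i\<in>UNIV. of_real ((norm x)\<^sup>2) ^ k * pgauss (\<alpha>(i := \<alpha> i + 2)) t x)"
    by (simp only: power_Suc2 mult.assoc sum_distrib_left)
  then show ?case using hclosure_sum[OF Suc.IH] by simp
qed

text \<open>Expand \<open>exp (- (t' - t) |x|\<^sup>2)\<close> into its power series and multiply by \<open>exp (- t |x|\<^sup>2)\<close>. The partial sums
are dominated by \<open>exp ((t' - t) |x|\<^sup>2 - t |x|\<^sup>2)\<close>, which decays precisely when \<open>t' < 2 t\<close>.\<close>

lemma pgauss_step:
  fixes \<alpha> :: "'n::finite \<Rightarrow> nat"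
  assumes t: "\<And>\<alpha>::'n \<Rightarrow> nat. pgauss \<alpha> t \<in> hclosure" and tt: "t \<le> t'" "t' < 2 * t"
  shows "pgauss \<alpha> t' \<in> hclosure"
proof (rule hclosure_dominated)
  define s where "s = t' - t"
  let ?S = "\<lambda>n x. \<Sum>k<n. of_real ((- s) ^ k / fact k) * (of_real ((norm x)\<^sup>2) ^ k * pgauss \<alpha> t x)"
  show "?S n \<in> hclosure" for n
    by (intro hclosure_sum hclosure_cmult pgauss_norm_power_hclosure t)
  have eq: "?S n x = of_real (\<Sum>k<n. (- s * (norm x)\<^sup>2) ^ k /\<^sub>R fact k) * pgauss \<alpha> t x" for n x
  proof -
    have tm: "(- s) ^ k / fact k * y ^ k = (- s * y) ^ k /\<^sub>R fact k" for k y
      unfolding power_mult_distrib by (simp add: divide_inverse)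
    show ?thesis
      unfolding of_real_sum sum_distrib_right tm[symmetric] of_real_mult of_real_power[of "(norm x)\<^sup>2"] mult.assoc ..
  qed
  have sm: "(\<lambda>k. y ^ k /\<^sub>R fact k) sums exp y" for y :: real by (rule exp_converges)
  show "(\<lambda>n. ?S n x) \<longlonglongrightarrow> pgauss \<alpha> t' x" for x
  proof -
    have "(\<lambda>n. ?S n x) \<longlonglongrightarrow> of_real (exp (- s * (norm x)\<^sup>2)) * pgauss \<alpha> t x"
      unfolding eq using sm[of "- s * (norm x)\<^sup>2"] unfolding sums_def
      by (intro tendsto_intros)
    moreover have "of_real (exp (- s * (norm x)\<^sup>2)) * pgauss \<alpha> t x = pgauss \<alpha> t' x"
      by (simp add: pgauss_def s_def exp_add[symmetric] algebra_simps flip: of_real_mult exp_diff)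
    ultimately show ?thesis by simp
  qed
  show "square_integrable (pgauss \<alpha> (t - s))"
    unfolding pgauss_def[abs_def] using tt by (intro sqint_monomial_gaussian) (simp add: s_def)
  show "cmod (?S n x) \<le> cmod (pgauss \<alpha> (t - s) x)" for n x
  proof -
    have "\<bar>\<Sum>k<n. (- s * (norm x)\<^sup>2) ^ k /\<^sub>R fact k\<bar> \<le> (\<Sum>k<n. \<bar>(- s * (norm x)\<^sup>2) ^ k /\<^sub>R fact k\<bar>)"
      by (rule sum_abs)
    also have "\<dots> = (\<Sum>k<n. (s * (norm x)\<^sup>2) ^ k /\<^sub>R fact k)"
      using tt by (simp add: abs_mult power_abs s_def)
    also have "\<dots> \<le> exp (s * (norm x)\<^sup>2)"
      unfolding sums_unique[OF sm] using tt
      by (intro sum_le_suminf sums_summable[OF sm]) (auto simp: s_def)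
    finally have b: "\<bar>\<Sum>k<n. (- s * (norm x)\<^sup>2) ^ k /\<^sub>R fact k\<bar> \<le> exp (s * (norm x)\<^sup>2)" .
    have "cmod (?S n x) \<le> exp (s * (norm x)\<^sup>2) * cmod (pgauss \<alpha> t x)"
      unfolding eq norm_mult norm_of_real using b by (intro mult_right_mono) auto
    also have "\<dots> = cmod (pgauss \<alpha> (t - s) x)"
      unfolding pgauss_def norm_of_real by (simp add: abs_mult exp_add[symmetric] algebra_simps mult.left_commute flip: exp_diff)
    finally show ?thesis .
  qed
qed

text \<open>Each application of the preceding lemma gains a factor \<open>3/2 < 2\<close>, so every exponent is reached after
finitely many of them.\<close>

lemma pgauss_hclosure:
  assumes "t \<ge> 1/2" shows "pgauss \<alpha> t \<in> hclosure"
proof -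
  have *: "t \<le> 1/2 * (3/2) ^ n \<Longrightarrow> t \<ge> 1/2 \<Longrightarrow> pgauss \<alpha> t \<in> hclosure" for n t \<alpha>
  proof (induction n arbitrary: t \<alpha>)
    case 0
    then have "t = 1/2" by simp
    then show ?case using pgauss_half_hspan hspan_subset_hclosure by metis
  next
    case (Suc n)
    define u where "u = max (1/2) (2/3 * t)"
    have u: "u \<ge> 1/2" "u \<le> t" "t < 2 * u" "u \<le> 1/2 * (3/2) ^ n"
      using Suc.prems one_le_power[of "3/2::real" n] by (auto simp: u_def max_def)
    show ?case by (rule pgauss_step[OF Suc.IH]) (use u in auto)
  qed
  obtain n where "2 * t < (3/2) ^ n" using real_arch_pow[of "3/2" "2 * t"] by auto
  then show ?thesis using *[of t n] assms by simp
qed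

inductive_set gspan :: "(real^'n::finite \<Rightarrow> complex) set" where
  gspan_base: "t \<ge> 1/2 \<Longrightarrow> pgauss \<alpha> t \<in> gspan"
| gspan_add: "f \<in> gspan \<Longrightarrow> g \<in> gspan \<Longrightarrow> (\<lambda>x. f x + g x) \<in> gspan"
| gspan_cmult: "f \<in> gspan \<Longrightarrow> (\<lambda>x. c * f x) \<in> gspan"

lemma gspan_hclosure: "f \<in> gspan \<Longrightarrow> f \<in> hclosure"
  by (induction rule: gspan.induct) (auto intro: pgauss_hclosure hclosure_add hclosure_cmult)

text \<open>The multipliers of \<^const>\<open>gspan\<close>. Unlike \<open>gspan\<close>, they contain the constants, so they form an algebra to
which induction over polynomials applies.\<close>

definition gmult :: "(real^'n::finite \<Rightarrow> complex) set" where
  "gmult = {q. \<forall>r\<in>gspan. (\<lambda>x. q x * r x) \<in> gspan}"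

lemma gmult_add: "p \<in> gmult \<Longrightarrow> q \<in> gmult \<Longrightarrow> (\<lambda>x. p x + q x) \<in> gmult"
  by (auto simp: gmult_def ring_distribs intro: gspan_add)

lemma gmult_mult: "p \<in> gmult \<Longrightarrow> q \<in> gmult \<Longrightarrow> (\<lambda>x. p x * q x) \<in> gmult"
  by (auto simp: gmult_def mult.assoc)

lemma gmult_const: "(\<lambda>x. c) \<in> gmult"
  by (auto simp: gmult_def intro: gspan_cmult)

lemma gmult_sum: "(\<And>i. i \<in> I \<Longrightarrow> f i \<in> gmult) \<Longrightarrow> (\<lambda>x. \<Sum>i\<in>I. f i x) \<in> gmult"
  by (induction I rule: infinite_finite_induct) (auto intro: gmult_add gmult_const)

lemma gmult_pgauss:
  assumes "t \<ge> 0" shows "pgauss \<beta> t \<in> gmult"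
proof -
  have m: "pgauss \<beta> t x * pgauss \<alpha> s x = pgauss (\<lambda>i. \<beta> i + \<alpha> i) (t + s) x" for \<alpha> s x
    by (simp add: pgauss_def monomial_def power_add prod.distrib exp_add[symmetric] algebra_simps
      flip: of_real_mult exp_diff)
  have "(\<lambda>x. pgauss \<beta> t x * r x) \<in> gspan" if "r \<in> gspan" for r
    using that
  proof induction
    case (gspan_base s \<alpha>)
    then show ?case unfolding m using assms by (intro gspan.gspan_base) simp
  next
    case (gspan_add f g)
    then show ?case using gspan.gspan_add[OF gspan_add.IH] by (simp add: ring_distribs)
  next
    case (gspan_cmult f c)
    then show ?case using gspan.gspan_cmult[OF gspan_cmult.IH, of c] by (simp add: mult.left_commute)
  qed
  then show ?thesis by (simp add: gmult_def)
qed

text \<open>An injective map into a compact set whose components are multipliers of \<^const>\<open>gspan\<close>. Polynomials in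
these components are bounded on the whole space, which makes approximation on the compact image
uniform on the whole space.\<close>

definition gchart :: "real^'n::finite \<Rightarrow> real \<times> (real^'n)" where
  "gchart x = (exp (- (1/2) * (norm x)\<^sup>2), exp (- (1/2) * (norm x)\<^sup>2) *\<^sub>R x)"

lemma gmult_polynomial:
  fixes p :: "real \<times> (real^'n::finite) \<Rightarrow> real"
  assumes "real_polynomial_function p"
  shows "(\<lambda>x. of_real (p (gchart x))) \<in> gmult"
  using assms
proof induction
  case (linear f)
  interpret bounded_linear f by fact
  have "f (gchart x) = f (1, 0) * exp (- (1/2) * (norm x)\<^sup>2) +
     (\<Sum>i\<in>UNIV. f (0, axis i 1) * (x $ i * exp (- (1/2) * (norm x)\<^sup>2)))" for x :: "real^'n"
  proof -
    define E where "E = exp (- (1/2) * (norm x)\<^sup>2)"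
    have x: "x = (\<Sum>i\<in>UNIV. (x $ i) *\<^sub>R axis i 1)"
      using basis_expansion[of x] by (simp add: scalar_mult_eq_scaleR)
    have "gchart x = E *\<^sub>R (1, 0) + E *\<^sub>R (0, x)" by (simp add: gchart_def E_def)
    then have "f (gchart x) = E * f (1, 0) + E * f (0, x)" by (simp only: add scaleR real_scaleR_def)
    also have "(0::real, x) = (\<Sum>i\<in>UNIV. (x $ i) *\<^sub>R (0, axis i 1))"
    proof (rule prod_eqI)
      show "snd (0::real, x) = snd (\<Sum>i\<in>UNIV. (x $ i) *\<^sub>R (0::real, axis i 1))"
        by (subst x) (simp add: snd_sum)
    qed (simp add: fst_sum)
    also have "f (\<Sum>i\<in>UNIV. (x $ i) *\<^sub>R (0, axis i 1)) = (\<Sum>i\<in>UNIV. x $ i * f (0, axis i 1))"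
      by (simp only: sum scaleR real_scaleR_def)
    finally show ?thesis unfolding E_def[symmetric]
      by (simp add: sum_distrib_left mult_ac)
  qed
  moreover have "(\<lambda>x. of_real (f (1, 0)) * pgauss (\<lambda>_. 0) (1/2) x +
     (\<Sum>i\<in>UNIV. of_real (f (0, axis i 1)) * pgauss ((\<lambda>_. 0)(i := 0 + 1)) (1/2) x)) \<in> (gmult :: (real^'n \<Rightarrow> complex) set)"
    by (intro gmult_add gmult_sum gmult_mult gmult_const gmult_pgauss) auto
  moreover have "pgauss ((\<lambda>_. 0)(i := 0 + 1)) (1/2) x = of_real (x $ i * exp (- (1/2) * (norm x)\<^sup>2))" for i and x :: "real^'n"
    unfolding pgauss_def using monomial_upd[of "\<lambda>_. 0" i 1 x] by (simp add: monomial_def)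
  moreover have "pgauss (\<lambda>_. 0) (1/2) x = of_real (exp (- (1/2) * (norm x)\<^sup>2))" for x :: "real^'n"
    unfolding pgauss_def by (simp add: monomial_def)
  ultimately show ?case by simp
next
  case (const c)
  show ?case by (rule gmult_const)
next
  case (add f g)
  then show ?case using gmult_add by fastforce
next
  case (mult f g)
  then show ?case using gmult_mult by fastforce
qed

text \<open>The function \<open>v exp (|x|\<^sup>2/2)\<close> is written as \<open>\<Psi> (gchart x)\<close> with \<open>\<Psi>\<close> continuous. A polynomial \<open>g\<close> that is
uniformly close to \<open>\<Psi>\<close> on a compact set containing the image of \<open>gchart\<close> gives the approximation
\<open>g (gchart x) exp (- |x|\<^sup>2/2)\<close> of \<open>v\<close>, with an error that is a small multiple of the Gaussian.\<close>

lemma hclosure_compact_support: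
  fixes v :: "real^'n::finite \<Rightarrow> complex"
  assumes c: "continuous_on UNIV v" and v: "square_integrable v"
    and R: "\<And>x. norm x \<ge> R \<Longrightarrow> v x = 0"
  shows "v \<in> hclosure"
proof (rule hclosure_closed[OF v])
  fix e :: real assume e: "e > 0"
  define G :: "real^'n \<Rightarrow> complex" where "G = pgauss (\<lambda>_. 0) (1/2)"
  have G: "G x = of_real (exp (- (1/2) * (norm x)\<^sup>2))" for x
    by (simp add: G_def pgauss_def monomial_def)
  have Gsq: "square_integrable G" unfolding G_def pgauss_def[abs_def] by (intro sqint_monomial_gaussian) simp
  \<comment> \<open>The point \<open>x\<close> is recovered from \<open>gchart x = (E, E x)\<close> as \<open>E x / E\<close>. On the support of \<open>v\<close> one has
    \<open>E \<ge> 2 \<eta>\<close>; replacing the divisor by \<open>max E \<eta>\<close> and cutting off below \<open>\<eta>\<close> keeps \<open>\<Psi>\<close> continuous everywhere.\<close>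
  define \<eta> where "\<eta> = exp (- (1/2) * R\<^sup>2) / 2"
  have \<eta>: "\<eta> > 0" by (simp add: \<eta>_def)
  define w where "w x = v x * of_real (exp ((1/2) * (norm x)\<^sup>2))" for x
  define \<Psi> where "\<Psi> u = w ((1 / max (fst u) \<eta>) *\<^sub>R snd u) * of_real (min 1 (max 0 (fst u / \<eta> - 1)))" for u :: "real \<times> (real^'n)"
  have cw: "continuous_on UNIV w" unfolding w_def by (intro continuous_intros c)
  have c\<Psi>: "continuous_on UNIV \<Psi>"
    unfolding \<Psi>_def by (intro continuous_intros continuous_on_compose2[OF cw]) (use \<eta> in auto)
  have \<Psi>: "v x = \<Psi> (gchart x) * G x" for x
  proof -
    define E where "E = exp (- (1/2) * (norm x)\<^sup>2)"
    have E: "E > 0" by (simp add: E_def)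
    have vw: "v x = w x * G x"
      by (simp add: w_def G exp_add[symmetric] flip: of_real_mult)
    have "w x = \<Psi> (E, E *\<^sub>R x)"
    proof (cases "norm x \<ge> R")
      case True
      show ?thesis
      proof (cases "E \<le> \<eta>")
        case True
        then have "E / \<eta> - 1 \<le> 0" using \<eta> by (simp add: divide_simps)
        then show ?thesis using R[OF \<open>norm x \<ge> R\<close>] by (simp add: \<Psi>_def w_def)
      next
        case False
        then have "(1 / max E \<eta>) *\<^sub>R E *\<^sub>R x = x" using E by simp
        then show ?thesis using R[OF \<open>norm x \<ge> R\<close>] by (simp add: \<Psi>_def w_def)
      qed
    next
      case False
      then have "(norm x)\<^sup>2 \<le> R\<^sup>2" by (intro power_mono) auto
      then have "exp (- (1/2) * R\<^sup>2) \<le> E" by (simp add: E_def)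
      then have "2 * \<eta> \<le> E" by (simp add: \<eta>_def)
      then have "E / \<eta> - 1 \<ge> 1" "max E \<eta> = E" using \<eta> by (auto simp: divide_simps)
      then show ?thesis using E by (simp add: \<Psi>_def)
    qed
    then show ?thesis unfolding vw by (simp add: gchart_def E_def)
  qed
  define S :: "(real \<times> (real^'n)) set" where "S = {0..1} \<times> cball 0 1"
  have "compact S" unfolding S_def by (intro compact_Times) auto
  have chart: "gchart x \<in> S" for x
  proof -
    have "norm x \<le> 1 + (1/2) * (norm x)\<^sup>2"
      using zero_le_power2[of "norm x - 1"] by (simp add: power2_diff)
    also have "\<dots> \<le> exp ((1/2) * (norm x)\<^sup>2)" by (rule exp_ge_add_one_self)
    finally have "exp (- (1/2) * (norm x)\<^sup>2) * norm x \<le> exp (- (1/2) * (norm x)\<^sup>2) * exp ((1/2) * (norm x)\<^sup>2)"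
      by (intro mult_left_mono) auto
    also have "\<dots> = 1" by (simp add: exp_add[symmetric])
    finally show ?thesis by (simp add: S_def gchart_def)
  qed
  define d where "d = e / (L2_norm G + 1)"
  have d: "d > 0" using e by (simp add: d_def add_nonneg_pos)
  obtain g where g: "polynomial_function g" "\<And>u. u \<in> S \<Longrightarrow> norm (\<Psi> u - g u) < d"
    using Stone_Weierstrass_polynomial_function[OF \<open>compact S\<close> continuous_on_subset[OF c\<Psi>] d] by auto
  have "real_polynomial_function (Re \<circ> g)" "real_polynomial_function (Im \<circ> g)"
    using g(1) bounded_linear_Re bounded_linear_Im unfolding polynomial_function_def by blast+
  then have "(\<lambda>x. of_real ((Re \<circ> g) (gchart x)) + \<i> * of_real ((Im \<circ> g) (gchart x))) \<in> (gmult :: (real^'n \<Rightarrow> complex) set)"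
    by (intro gmult_add gmult_mult gmult_const gmult_polynomial)
  then have "(\<lambda>x. g (gchart x)) \<in> (gmult :: (real^'n \<Rightarrow> complex) set)"
    by (simp add: complex_eq[symmetric])
  then have h: "(\<lambda>x. g (gchart x) * G x) \<in> gspan"
    using gspan_base[of "1/2" "\<lambda>_. 0"] by (auto simp: gmult_def G_def)
  have hs: "square_integrable (\<lambda>x. g (gchart x) * G x)" using gspan_hclosure[OF h] by (simp add: hclosure_def)
  have "L2_norm (\<lambda>x. v x - g (gchart x) * G x) \<le> L2_norm (\<lambda>x. of_real d * G x)"
  proof (rule L2_norm_mono[OF sqint_cmult[OF Gsq]])
    show "(\<lambda>x. v x - g (gchart x) * G x) \<in> borel_measurable borel"
      using sqint_measurable[OF sqint_diff[OF v hs]] .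
    fix x
    have "v x - g (gchart x) * G x = (\<Psi> (gchart x) - g (gchart x)) * G x"
      by (simp add: \<Psi> left_diff_distrib)
    then show "cmod (v x - g (gchart x) * G x) \<le> cmod (of_real d * G x)"
      using g(2)[OF chart[of x]] d by (simp add: norm_mult mult_right_mono)
  qed
  also have "\<dots> = d * L2_norm G" using d by (simp add: L2_norm_cmult)
  also have "\<dots> < d * (L2_norm G + 1)" using d by simp
  also have "\<dots> = e" using L2_norm_nonneg[of G] by (simp add: d_def add_nonneg_eq_0_iff)
  finally show "\<exists>w\<in>hclosure. L2_norm (\<lambda>x. v x - w x) < e"
    by (rule bexI[OF _ gspan_hclosure[OF h]])
qed

text \<open>Continuous cut-offs reduce this to compact support.\<close>

theorem hermite_complete:
  fixes v :: "real^'n::finite \<Rightarrow> complex"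
  assumes c: "continuous_on UNIV v" and v: "square_integrable v"
  shows "v \<in> hclosure"
proof (rule hclosure_dominated[OF _ _ v])
  let ?s = "\<lambda>n x. of_real (min 1 (max 0 (real n - norm x))) * v x"
  have ct: "continuous_on UNIV (?s n)" for n by (intro continuous_intros c)
  show le: "cmod (?s n x) \<le> cmod (v x)" for n x
    unfolding norm_mult norm_of_real by (intro mult_left_le_one_le) auto
  show "?s n \<in> hclosure" for n
    by (rule hclosure_compact_support[OF ct _, where R="real n"])
       (auto intro!: L2_norm_mono(1)[OF v _ le] borel_measurable_continuous_onI[OF ct])
  show "(\<lambda>n. ?s n x) \<longlonglongrightarrow> v x" for x
  proof (rule tendsto_eventually)
    obtain N where N: "norm x + 1 \<le> real N" using real_arch_simple by blast
    show "\<forall>\<^sub>F n in sequentially. ?s n x = v x"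
      using eventually_ge_at_top[of N]
    proof eventually_elim
      case (elim n)
      then have "real n - norm x \<ge> 1" using N by (smt (verit) of_nat_mono)
      then show ?case by simp
    qed
  qed
qed

section \<open>The seminorms and the lowering operators\<close>

definition hcoeff :: "(real^'n::finite \<Rightarrow> complex) \<Rightarrow> ('n \<Rightarrow> nat) \<Rightarrow> complex" where
  "hcoeff f \<alpha> = ip f (nhermite \<alpha>)"

lemma weighted_term_word:
  "weighted_term M j f (\<alpha>, \<beta>) =
     real j ^ length (xd_word \<alpha> \<beta>) / M (length (xd_word \<alpha> \<beta>)) * L2_norm (foldr letter (xd_word \<alpha> \<beta>) f)"
  by (simp add: weighted_term_def length_xd_word xd_word)

lemma S_space_iff:
  "f \<in> S_space M \<longleftrightarrow> f \<in> smooth_functions \<and>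
     (\<forall>\<alpha> \<beta>. square_integrable (foldr letter (xd_word \<alpha> \<beta>) f)) \<and>
     (\<forall>j\<ge>1. bdd_above (range (weighted_term M j f)))"
  by (simp add: S_space_def xd_word)

lemma S_space_smooth: "f \<in> S_space M \<Longrightarrow> f \<in> smooth_functions"
  by (simp add: S_space_iff)

lemma S_space_sqint_word: "f \<in> S_space M \<Longrightarrow> square_integrable (foldr letter (xd_word \<alpha> \<beta>) f)"
  by (simp add: S_space_iff)

lemma xd_word_0: "xd_word (\<lambda>_. 0) (\<lambda>_. 0) = []"
  by (simp add: xd_word_def word_of_def)

lemma S_space_sqint: "f \<in> S_space M \<Longrightarrow> square_integrable f"
  using S_space_sqint_word[of f M "\<lambda>_. 0" "\<lambda>_. 0"] by (simp add: xd_word_0)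

lemma weighted_term_le_seminorm:
  "f \<in> S_space M \<Longrightarrow> j \<ge> 1 \<Longrightarrow> weighted_term M j f ab \<le> S_seminorm M j f"
  unfolding S_seminorm_def by (rule cSUP_upper) (auto simp: S_space_iff)

lemma S_seminorm_leI: "(\<And>\<alpha> \<beta>. weighted_term M j f (\<alpha>, \<beta>) \<le> c) \<Longrightarrow> S_seminorm M j f \<le> c"
  unfolding S_seminorm_def by (rule cSUP_least) auto

locale positive_sequence =
  fixes M :: "nat \<Rightarrow> real"
  assumes pos: "\<And>p. M p > 0"
begin

lemma weighted_term_nonneg: "weighted_term M j f ab \<ge> 0"
  by (cases ab) (auto simp: weighted_term_def less_imp_le[OF pos])

lemma S_seminorm_nonneg: "f \<in> S_space M \<Longrightarrow> j \<ge> 1 \<Longrightarrow> S_seminorm M j f \<ge> 0"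
  by (rule order_trans[OF weighted_term_nonneg weighted_term_le_seminorm])

text \<open>The seminorm controls precisely the words in which all coordinates stand to the left of all derivatives.\<close>

lemma word_le_seminorm:
  assumes "f \<in> S_space M" "j \<ge> 1"
  shows "L2_norm (foldr letter (xd_word \<alpha> \<beta>) f) \<le>
    M (length (xd_word \<alpha> \<beta>)) / real j ^ length (xd_word \<alpha> \<beta>) * S_seminorm M j f"
proof -
  define m where "m = length (xd_word \<alpha> \<beta>)"
  have "real j ^ m / M m * L2_norm (foldr letter (xd_word \<alpha> \<beta>) f) \<le> S_seminorm M j f"
    using weighted_term_le_seminorm[OF assms, of "(\<alpha>, \<beta>)"] by (simp add: weighted_term_word m_def)
  then show ?thesis using pos[of m] assms(2) unfolding m_def[symmetric] by (simp add: field_simps)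
qed

lemma L2_le_seminorm:
  assumes "f \<in> S_space M" "j \<ge> 1" shows "L2_norm f \<le> M 0 * S_seminorm M j f"
  using word_le_seminorm[OF assms, of "\<lambda>_. 0" "\<lambda>_. 0"] by (simp add: xd_word_0)

lemma weighted_term_add:
  assumes "f \<in> S_space M" "g \<in> S_space M"
  shows "weighted_term M j (\<lambda>x. f x + g x) ab \<le> weighted_term M j f ab + weighted_term M j g ab"
proof (cases ab)
  case (Pair \<alpha> \<beta>)
  show ?thesis unfolding Pair weighted_term_word word_add[OF S_space_smooth[OF assms(1)] S_space_smooth[OF assms(2)]]
      distrib_left[symmetric]
    by (intro mult_left_mono L2_norm_triangle S_space_sqint_word[OF assms(1)] S_space_sqint_word[OF assms(2)])
       (simp add: less_imp_le[OF pos])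
qed

lemma weighted_term_cmult:
  assumes "f \<in> S_space M"
  shows "weighted_term M j (\<lambda>x. c * f x) ab = cmod c * weighted_term M j f ab"
  by (cases ab) (simp add: weighted_term_word word_cmult[OF S_space_smooth[OF assms]] L2_norm_cmult)

lemma S_space_add:
  assumes f: "f \<in> S_space M" and g: "g \<in> S_space M"
  shows "(\<lambda>x. f x + g x) \<in> S_space M"
  unfolding S_space_iff word_add[OF S_space_smooth[OF f] S_space_smooth[OF g]]
proof (intro conjI allI impI)
  fix j :: nat assume j: "1 \<le> j"
  show "bdd_above (range (weighted_term M j (\<lambda>x. f x + g x)))"
  proof (rule bdd_aboveI2)
    fix ab show "weighted_term M j (\<lambda>x. f x + g x) ab \<le> S_seminorm M j f + S_seminorm M j g"
      using weighted_term_add[OF f g, of j ab] weighted_term_le_seminorm[OF f j, of ab]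
        weighted_term_le_seminorm[OF g j, of ab] by linarith
  qed
qed (intro smooth_add S_space_smooth[OF f] S_space_smooth[OF g] sqint_add S_space_sqint_word[OF f] S_space_sqint_word[OF g])+

lemma S_space_cmult:
  assumes f: "f \<in> S_space M" shows "(\<lambda>x. c * f x) \<in> S_space M"
  unfolding S_space_iff word_cmult[OF S_space_smooth[OF f]]
proof (intro conjI allI impI)
  fix j :: nat assume j: "1 \<le> j"
  show "bdd_above (range (weighted_term M j (\<lambda>x. c * f x)))"
  proof (rule bdd_aboveI2)
    fix ab show "weighted_term M j (\<lambda>x. c * f x) ab \<le> cmod c * S_seminorm M j f"
      unfolding weighted_term_cmult[OF f] by (intro mult_left_mono weighted_term_le_seminorm f j) auto
  qed
qed (intro smooth_cmult S_space_smooth[OF f] sqint_cmult S_space_sqint_word[OF f])+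

lemma S_seminorm_add:
  assumes "f \<in> S_space M" "g \<in> S_space M" "j \<ge> 1"
  shows "S_seminorm M j (\<lambda>x. f x + g x) \<le> S_seminorm M j f + S_seminorm M j g"
proof (rule S_seminorm_leI)
  fix \<alpha> \<beta> show "weighted_term M j (\<lambda>x. f x + g x) (\<alpha>, \<beta>) \<le> S_seminorm M j f + S_seminorm M j g"
    using weighted_term_add[OF assms(1,2), of j "(\<alpha>, \<beta>)"] weighted_term_le_seminorm[OF assms(1,3), of "(\<alpha>, \<beta>)"]
      weighted_term_le_seminorm[OF assms(2,3), of "(\<alpha>, \<beta>)"] by linarith
qed

lemma S_seminorm_cmult_le:
  assumes "f \<in> S_space M" "j \<ge> 1"
  shows "S_seminorm M j (\<lambda>x. c * f x) \<le> cmod c * S_seminorm M j f"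
  by (rule S_seminorm_leI, subst weighted_term_cmult[OF assms(1)])
     (intro mult_left_mono weighted_term_le_seminorm assms, auto)

lemma S_seminorm_cmult:
  assumes "f \<in> S_space M" "j \<ge> 1"
  shows "S_seminorm M j (\<lambda>x. c * f x) = cmod c * S_seminorm M j f"
proof (cases "c = 0")
  case True
  have "S_seminorm M j (\<lambda>x. 0 * f x) \<ge> 0" by (intro S_seminorm_nonneg S_space_cmult assms)
  then show ?thesis using S_seminorm_cmult_le[OF assms, of 0] True by simp
next
  case False
  have "S_seminorm M j (\<lambda>x. inverse c * (c * f x)) \<le> cmod (inverse c) * S_seminorm M j (\<lambda>x. c * f x)"
    by (intro S_seminorm_cmult_le S_space_cmult assms)
  then have "cmod c * S_seminorm M j f \<le> S_seminorm M j (\<lambda>x. c * f x)"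
    using False by (simp add: mult.assoc[symmetric] norm_inverse norm_divide field_simps)
  then show ?thesis using S_seminorm_cmult_le[OF assms, of c] by simp
qed

lemma S_space_zero: "(\<lambda>x. 0) \<in> S_space M"
proof -
  have w: "foldr letter w (\<lambda>x. 0) = (\<lambda>x. 0)" for w :: "(bool \<times> 'a) list"
    using word_cmult[OF smooth_zero, of w 0] by simp
  show ?thesis
    unfolding S_space_iff w by (auto simp: smooth_zero sqint_zero intro!: bdd_aboveI2[where M=0])
      (simp add: weighted_term_word w)
qed

lemma S_space_sum: "(\<And>i. i \<in> I \<Longrightarrow> f i \<in> S_space M) \<Longrightarrow> (\<lambda>x. \<Sum>i\<in>I. f i x) \<in> S_space M"
  by (induction I rule: infinite_finite_induct) (auto intro: S_space_add S_space_zero)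

lemma S_space_diff: "f \<in> S_space M \<Longrightarrow> g \<in> S_space M \<Longrightarrow> (\<lambda>x. f x - g x) \<in> S_space M"
  using S_space_add[OF _ S_space_cmult, of f g "-1"] by simp

lemma S_seminorm_zero: "j \<ge> 1 \<Longrightarrow> S_seminorm M j (\<lambda>x. 0) = 0"
  using S_seminorm_cmult[OF S_space_zero, of j 0] by simp

lemma S_seminorm_sum:
  assumes "\<And>i. i \<in> I \<Longrightarrow> f i \<in> S_space M" "j \<ge> 1"
  shows "S_seminorm M j (\<lambda>x. \<Sum>i\<in>I. f i x) \<le> (\<Sum>i\<in>I. S_seminorm M j (f i))"
  using assms(1)
proof (induction I rule: infinite_finite_induct)
  case (insert i I)
  then show ?case
    using S_seminorm_add[of "f i" "\<lambda>x. \<Sum>i\<in>I. f i x" j] assms(2) by (simp add: S_space_sum)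
qed (use assms(2) in \<open>auto simp: S_seminorm_zero\<close>)

lemma S_seminorm_mono:
  assumes "f \<in> S_space M" "1 \<le> j" "j \<le> k"
  shows "S_seminorm M j f \<le> S_seminorm M k f"
proof (rule S_seminorm_leI)
  fix \<alpha> \<beta>
  have "weighted_term M j f (\<alpha>, \<beta>) \<le> weighted_term M k f (\<alpha>, \<beta>)"
    unfolding weighted_term_word using assms
    by (intro mult_right_mono divide_right_mono power_mono) (auto simp: less_imp_le[OF pos])
  also have "\<dots> \<le> S_seminorm M k f" using assms by (intro weighted_term_le_seminorm) auto
  finally show "weighted_term M j f (\<alpha>, \<beta>) \<le> S_seminorm M k f" .
qed

lemma hcoeff_le_seminorm:
  assumes "f \<in> S_space M" "j \<ge> 1"
  shows "cmod (hcoeff f \<alpha>) \<le> M 0 * S_seminorm M j f"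
proof -
  have "cmod (hcoeff f \<alpha>) \<le> L2_norm f * L2_norm (nhermite \<alpha>)"
    unfolding hcoeff_def by (intro ip_Cauchy_Schwarz S_space_sqint[OF assms(1)] hspan_sqint nhermite_hspan)
  then show ?thesis using L2_le_seminorm[OF assms] by simp
qed

end

section \<open>Iterated lowering operators\<close>

text \<open>The span of the functions \<open>x\<^sub>l\<^sup>a \<partial>\<^sub>l\<^sup>b f\<close> for one fixed direction \<open>l\<close>. It is stable under \<open>x\<^sub>l\<close> and
\<open>\<partial>\<^sub>l\<close>, and it consists of square-integrable functions if \<open>f\<close> is in the space, so it supplies the
side conditions of integration by parts.\<close>

inductive_set xd_span :: "'n::finite \<Rightarrow> (real^'n \<Rightarrow> complex) \<Rightarrow> (real^'n \<Rightarrow> complex) set"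
  for l f where
  xd_span_base: "foldr letter (replicate a (False, l) @ replicate b (True, l)) f \<in> xd_span l f"
| xd_span_add: "g \<in> xd_span l f \<Longrightarrow> h \<in> xd_span l f \<Longrightarrow> (\<lambda>x. g x + h x) \<in> xd_span l f"
| xd_span_cmult: "g \<in> xd_span l f \<Longrightarrow> (\<lambda>x. c * g x) \<in> xd_span l f"

lemma word_of_single:
  "distinct cs \<Longrightarrow> l \<in> set cs \<Longrightarrow> word_of b cs ((\<lambda>_. 0)(l := a)) = replicate a (b, l)"
proof (induction cs)
  case (Cons c cs)
  have z: "l \<notin> set cs \<Longrightarrow> word_of b cs ((\<lambda>_. 0)(l := a)) = []"
    by (auto simp: word_of_def)
  show ?case using Cons z by (cases "c = l") (auto simp: word_of_def)
qed auto

lemma xd_word_single: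
  "xd_word ((\<lambda>_. 0)(l := a)) ((\<lambda>_. 0)(l := b)) = replicate a (False, l) @ replicate b (True, l)"
  unfolding xd_word_def by (simp add: word_of_single coords_props)

text \<open>The commutation relation \<open>\<partial> x\<^sup>a = x\<^sup>a \<partial> + a x\<^bsup>a-1\<^esup>\<close>.\<close>

lemma partial_deriv_xd:
  fixes f :: "real^'n::finite \<Rightarrow> complex" and l :: 'n
  assumes f: "f \<in> smooth_functions"
  defines "T \<equiv> \<lambda>a b. foldr letter (replicate a (False, l) @ replicate b (True, l)) f"
  shows "partial_deriv l (T a b) = (\<lambda>x. of_real (real a) * T (a - 1) b x + T a (Suc b) x)"
proof (induction a)
  case 0
  then show ?case by (simp add: T_def)
next
  case (Suc a)
  have S: "T (Suc a) b = (\<lambda>x. of_real (x $ l) * T a b x)" for a b by (simp add: T_def)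
  have sm: "T a b \<in> smooth_functions" unfolding T_def by (rule smooth_word[OF f])
  have "partial_deriv l (T (Suc a) b) = (\<lambda>x. of_real (x $ l) * partial_deriv l (T a b) x + T a b x)"
    unfolding S using partial_deriv_coord[OF sm, of l l] by simp
  also have "\<dots> = (\<lambda>x. of_real (real (Suc a)) * T (Suc a - 1) b x + T (Suc a) (Suc b) x)"
    unfolding Suc S by (cases a) (auto simp: S algebra_simps)
  finally show ?case .
qed

lemma xd_span_smooth:
  assumes "f \<in> smooth_functions" shows "g \<in> xd_span l f \<Longrightarrow> g \<in> smooth_functions"
  by (induction rule: xd_span.induct) (auto intro: smooth_word[OF assms] smooth_add smooth_cmult simp del: foldr_append)

lemma xd_span_coord: "g \<in> xd_span l f \<Longrightarrow> (\<lambda>x. of_real (x $ l) * g x) \<in> xd_span l f"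
proof (induction rule: xd_span.induct)
  case (xd_span_base a b)
  have "(\<lambda>x. of_real (x $ l) * foldr letter (replicate a (False, l) @ replicate b (True, l)) f x) =
     foldr letter (replicate (Suc a) (False, l) @ replicate b (True, l)) f" by simp
  then show ?case using xd_span.xd_span_base by metis
next
  case (xd_span_add g h)
  then show ?case using xd_span.xd_span_add[OF xd_span_add.IH] by (simp add: ring_distribs)
next
  case (xd_span_cmult g c)
  then show ?case using xd_span.xd_span_cmult[OF xd_span_cmult.IH, of c] by (simp add: mult.left_commute)
qed

lemma xd_span_partial_deriv:
  assumes f: "f \<in> smooth_functions"
  shows "g \<in> xd_span l f \<Longrightarrow> partial_deriv l g \<in> xd_span l f"
proof (induction rule: xd_span.induct)
  case (xd_span_base a b)
  show ?case unfolding partial_deriv_xd[OF f] by (intro xd_span.xd_span_add xd_span.xd_span_cmult xd_span.xd_span_base)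
next
  case (xd_span_add g h)
  then show ?case using xd_span_smooth[OF f] by (simp add: partial_deriv_add xd_span.xd_span_add)
next
  case (xd_span_cmult g c)
  then show ?case using xd_span_smooth[OF f] by (simp add: partial_deriv_cmult xd_span.xd_span_cmult)
qed

lemma xd_span_sqint:
  assumes "f \<in> S_space M" shows "g \<in> xd_span l f \<Longrightarrow> square_integrable g"
proof (induction rule: xd_span.induct)
  case (xd_span_base a b)
  show ?case unfolding xd_word_single[symmetric] by (rule S_space_sqint_word[OF assms])
qed (auto intro: sqint_add sqint_cmult)

lemma xd_span_lowering_pow:
  assumes f: "f \<in> smooth_functions" and "g \<in> xd_span l f"
  shows "(lowering l ^^ m) g \<in> xd_span l f"
proof (induction m)
  case 0
  then show ?case using assms by simp
next
  case (Suc m)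
  then show ?case unfolding funpow.simps o_apply lowering_def[abs_def]
    by (intro xd_span.xd_span_add xd_span_coord xd_span_partial_deriv[OF f])
qed

lemma xd_span_self: "f \<in> xd_span l f"
  using xd_span_base[of 0 l 0 f] by simp

lemma lowering_add:
  "f \<in> smooth_functions \<Longrightarrow> g \<in> smooth_functions \<Longrightarrow>
   lowering l (\<lambda>x. f x + g x) = (\<lambda>x. lowering l f x + lowering l g x)"
  by (auto simp: lowering_def[abs_def] partial_deriv_add algebra_simps)

lemma lowering_cmult:
  "f \<in> smooth_functions \<Longrightarrow> lowering l (\<lambda>x. c * f x) = (\<lambda>x. c * lowering l f x)"
  by (auto simp: lowering_def[abs_def] partial_deriv_cmult algebra_simps)

lemma smooth_lowering: "f \<in> smooth_functions \<Longrightarrow> lowering l f \<in> smooth_functions"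
  unfolding lowering_def[abs_def] by (intro smooth_add smooth_coord smooth_partial_deriv)

lemma smooth_lowering_pow: "f \<in> smooth_functions \<Longrightarrow> (lowering l ^^ m) f \<in> smooth_functions"
  by (induction m) (auto intro: smooth_lowering)

lemma lowering_pow_add:
  "f \<in> smooth_functions \<Longrightarrow> g \<in> smooth_functions \<Longrightarrow>
   (lowering l ^^ m) (\<lambda>x. f x + g x) = (\<lambda>x. (lowering l ^^ m) f x + (lowering l ^^ m) g x)"
  by (induction m) (auto simp: lowering_add smooth_lowering_pow)

lemma lowering_pow_cmult:
  "f \<in> smooth_functions \<Longrightarrow> (lowering l ^^ m) (\<lambda>x. c * f x) = (\<lambda>x. c * (lowering l ^^ m) f x)"
  by (induction m) (auto simp: lowering_cmult smooth_lowering_pow)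

text \<open>Each lowering operator on the left becomes a raising operator on the right; the square root collects
the factors with which these act on the normalised Hermite functions.\<close>

lemma ip_lowering_pow:
  assumes f: "f \<in> S_space M"
  shows "m \<le> \<alpha> l \<Longrightarrow> ip ((lowering l ^^ m) f) (nhermite (\<alpha>(l := \<alpha> l - m))) =
     of_real (sqrt (\<Prod>i<m. 2 * real (\<alpha> l - i))) * hcoeff f \<alpha>"
proof (induction m)
  case 0
  then show ?case by (simp add: hcoeff_def)
next
  case (Suc m)
  define \<gamma> where "\<gamma> = \<alpha>(l := \<alpha> l - Suc m)"
  have \<gamma>: "\<gamma>(l := \<alpha> l - m) = \<alpha>(l := \<alpha> l - m)" "Suc (\<gamma> l) = \<alpha> l - m"
    using Suc.prems by (auto simp: \<gamma>_def Suc_diff_Suc)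
  note fs = S_space_smooth[OF f]
  note t = xd_span_lowering_pow[OF fs xd_span_self[of f l], of m]
  have "ip ((lowering l ^^ Suc m) f) (nhermite \<gamma>) = ip ((lowering l ^^ m) f) (raising l (nhermite \<gamma>))"
    unfolding funpow.simps o_apply
    by (intro ip_lowering smooth_lowering_pow fs nhermite_hspan xd_span_sqint[OF f t]
        xd_span_sqint[OF f xd_span_coord[OF t]] xd_span_sqint[OF f xd_span_partial_deriv[OF fs t]])
  also have "\<dots> = of_real (sqrt (2 * real (\<alpha> l - m))) * ip ((lowering l ^^ m) f) (nhermite (\<alpha>(l := \<alpha> l - m)))"
    unfolding raising_nhermite ip_cmult_right \<gamma> by simp
  also have "\<dots> = of_real (sqrt (\<Prod>i<Suc m. 2 * real (\<alpha> l - i))) * hcoeff f \<alpha>"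
    unfolding Suc.IH[OF Suc_leD[OF Suc.prems]] by (simp add: real_sqrt_mult mult_ac del: of_nat_diff)
  finally show ?case unfolding \<gamma>_def .
qed

text \<open>As \<open>i < m \<le> n/2\<close>, each of the \<open>m\<close> factors \<open>2 (\<alpha> l - i)\<close> is at least \<open>n\<close>, and the shift \<open>\<alpha> l \<mapsto> \<alpha> l - m\<close> is
injective on \<open>F\<close>, so Bessel's inequality applies to \<open>A\<^sup>m f\<close>.\<close>

lemma hcoeff_lowering_Bessel:
  assumes f: "f \<in> S_space M" and F: "finite F" "\<And>\<alpha>. \<alpha> \<in> F \<Longrightarrow> n \<le> \<alpha> l" and m: "2 * m \<le> n"
  shows "sqrt (\<Sum>\<alpha>\<in>F. (cmod (hcoeff f \<alpha>))\<^sup>2) * sqrt (real n) ^ m \<le> L2_norm ((lowering l ^^ m) f)"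
proof -
  have inj: "\<alpha> = \<beta>" if "\<alpha> \<in> F" "\<beta> \<in> F" "\<alpha>(l := \<alpha> l - m) = \<beta>(l := \<beta> l - m)" for \<alpha> \<beta>
  proof
    fix i
    have "(\<alpha>(l := \<alpha> l - m)) i = (\<beta>(l := \<beta> l - m)) i" using that by simp
    then show "\<alpha> i = \<beta> i" using F(2)[OF that(1)] F(2)[OF that(2)] m by (cases "i = l") auto
  qed
  have "(\<Sum>\<alpha>\<in>F. (cmod (hcoeff f \<alpha>))\<^sup>2) * real n ^ m =
     (\<Sum>\<alpha>\<in>F. real n ^ m * (cmod (hcoeff f \<alpha>))\<^sup>2)"
    by (simp add: sum_distrib_left mult.commute)
  also have "\<dots> \<le> (\<Sum>\<alpha>\<in>F. (cmod (ip ((lowering l ^^ m) f) (nhermite (\<alpha>(l := \<alpha> l - m)))))\<^sup>2)"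
  proof (rule sum_mono)
    fix \<alpha> assume \<alpha>: "\<alpha> \<in> F"
    have "real n ^ m = (\<Prod>i<m. real n)" by simp
    also have "\<dots> \<le> (\<Prod>i<m. 2 * real (\<alpha> l - i))"
    proof (rule prod_mono)
      fix i assume "i \<in> {..<m}"
      then have "n \<le> 2 * (\<alpha> l - i)" using F(2)[OF \<alpha>] m by auto
      then show "0 \<le> real n \<and> real n \<le> 2 * real (\<alpha> l - i)" by linarith
    qed
    finally have le: "real n ^ m \<le> (\<Prod>i<m. 2 * real (\<alpha> l - i))" .
    have "m \<le> \<alpha> l" using F(2)[OF \<alpha>] m by simp
    then have "(cmod (ip ((lowering l ^^ m) f) (nhermite (\<alpha>(l := \<alpha> l - m)))))\<^sup>2 =
       (\<Prod>i<m. 2 * real (\<alpha> l - i)) * (cmod (hcoeff f \<alpha>))\<^sup>2"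
      by (simp add: ip_lowering_pow[OF f] norm_mult power_mult_distrib prod_nonneg del: of_nat_diff)
    then show "real n ^ m * (cmod (hcoeff f \<alpha>))\<^sup>2 \<le> (cmod (ip ((lowering l ^^ m) f) (nhermite (\<alpha>(l := \<alpha> l - m)))))\<^sup>2"
      using le by (simp add: mult_right_mono)
  qed
  also have "\<dots> \<le> (L2_norm ((lowering l ^^ m) f))\<^sup>2"
    by (rule Bessel_inequality)
       (use inj F in \<open>auto simp: nhermite_orthonormal intro: hspan_sqint nhermite_hspan
        xd_span_sqint[OF f xd_span_lowering_pow[OF S_space_smooth[OF f] xd_span_self]]\<close>)
  finally have "sqrt ((\<Sum>\<alpha>\<in>F. (cmod (hcoeff f \<alpha>))\<^sup>2) * real n ^ m) \<le> sqrt ((L2_norm ((lowering l ^^ m) f))\<^sup>2)"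
    by (rule real_sqrt_le_mono)
  then show ?thesis by (simp add: real_sqrt_mult real_sqrt_power)
qed

lemma hcoeff_Bessel:
  assumes f: "square_integrable f" and F: "finite F"
  shows "sqrt (\<Sum>\<alpha>\<in>F. (cmod (hcoeff f \<alpha>))\<^sup>2) \<le> L2_norm f"
proof -
  have "(\<Sum>\<alpha>\<in>F. (cmod (hcoeff f \<alpha>))\<^sup>2) \<le> (L2_norm f)\<^sup>2"
    unfolding hcoeff_def
    by (rule Bessel_inequality[OF f _ _ F]) (auto simp: nhermite_orthonormal hspan_sqint nhermite_hspan)
  from real_sqrt_le_mono[OF this] show ?thesis by simp
qed

text \<open>A lowering operator turns \<open>x\<^sup>a \<partial>\<^sup>b f\<close> into two terms of order \<open>a + b + 1\<close> and a commutator term of order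
\<open>a + b - 1\<close> with coefficient \<open>a\<close>. The number \<open>i\<close> counts commutators already taken: each lowers the
order by two, and its coefficient is at most \<open>m + a + b + 2 i\<close>, a total that is unchanged along the
recursion. Hence the power \<open>i\<close> of this total on the left pays for the coefficients.\<close>

lemma (in positive_sequence) L2_lowering_pow_weighted:
  fixes f :: "real^'n::finite \<Rightarrow> complex" and U :: "nat \<Rightarrow> real" and l :: 'n
  assumes f: "f \<in> S_space M" and j: "j \<ge> 1"
    and U: "\<And>r i. real (r + 2 * i) ^ i * (M r / real j ^ r) \<le> U (r + 2 * i)"
  defines "T \<equiv> \<lambda>a b. foldr letter (replicate a (False, l) @ replicate b (True, l)) f"
  shows "real (m + a + b + 2 * i) ^ i * L2_norm ((lowering l ^^ m) (T a b)) \<le>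
     3 ^ m * S_seminorm M j f * U (m + a + b + 2 * i)"
proof (induction m arbitrary: a b i)
  case 0
  have "L2_norm (T a b) \<le> M (a + b) / real j ^ (a + b) * S_seminorm M j f"
    using word_le_seminorm[OF f j, of "(\<lambda>_. 0)(l := a)" "(\<lambda>_. 0)(l := b)"]
    unfolding xd_word_single T_def by simp
  then have "real (a + b + 2 * i) ^ i * L2_norm (T a b) \<le>
     real (a + b + 2 * i) ^ i * (M (a + b) / real j ^ (a + b) * S_seminorm M j f)"
    by (intro mult_left_mono) auto
  also have "\<dots> = (real (a + b + 2 * i) ^ i * (M (a + b) / real j ^ (a + b))) * S_seminorm M j f"
    by (simp only: mult.assoc)
  also have "\<dots> \<le> U (a + b + 2 * i) * S_seminorm M j f"
    by (intro mult_right_mono U S_seminorm_nonneg f j)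
  finally show ?case by (simp add: mult.commute)
next
  case (Suc m)
  define P where "P = S_seminorm M j f"
  define N where "N = Suc m + a + b + 2 * i"
  define A where "A = (\<lambda>a b. (lowering l ^^ m) (T a b))"
  have sm: "T a b \<in> smooth_functions" for a b unfolding T_def by (rule smooth_word[OF S_space_smooth[OF f]])
  have sqA: "square_integrable (A a b)" for a b
    unfolding A_def T_def
    by (rule xd_span_sqint[OF f xd_span_lowering_pow[OF S_space_smooth[OF f] xd_span_base]])
  have low: "lowering l (T a b) = (\<lambda>x. T (Suc a) b x + (of_real (real a) * T (a - 1) b x + T a (Suc b) x))"
  proof -
    have "T (Suc a) b = (\<lambda>x. of_real (x $ l) * T a b x)" by (simp add: T_def)
    moreover have "partial_deriv l (T a b) = (\<lambda>x. of_real (real a) * T (a - 1) b x + T a (Suc b) x)"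
      unfolding T_def by (rule partial_deriv_xd[OF S_space_smooth[OF f]])
    ultimately show ?thesis by (simp add: lowering_def[abs_def])
  qed
  have "(lowering l ^^ Suc m) (T a b) = (lowering l ^^ m) (lowering l (T a b))"
    by (simp only: funpow_Suc_right o_apply)
  also have "\<dots> = (\<lambda>x. A (Suc a) b x + (of_real (real a) * A (a - 1) b x + A a (Suc b) x))"
    unfolding low A_def by (simp only: lowering_pow_add lowering_pow_cmult sm smooth_add smooth_cmult)
  finally have "L2_norm ((lowering l ^^ Suc m) (T a b)) \<le>
     L2_norm (A (Suc a) b) + L2_norm (\<lambda>x. of_real (real a) * A (a - 1) b x + A a (Suc b) x)"
    by (simp only: L2_norm_triangle[OF sqA sqint_add[OF sqint_cmult[OF sqA] sqA]])
  also have "\<dots> \<le> L2_norm (A (Suc a) b) + (L2_norm (\<lambda>x. of_real (real a) * A (a - 1) b x) + L2_norm (A a (Suc b)))"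
    by (intro add_left_mono L2_norm_triangle sqint_cmult sqA)
  also have "L2_norm (\<lambda>x. of_real (real a) * A (a - 1) b x) = real a * L2_norm (A (a - 1) b)"
    by (simp add: L2_norm_cmult)
  finally have "real N ^ i * L2_norm ((lowering l ^^ Suc m) (T a b)) \<le>
     real N ^ i * (L2_norm (A (Suc a) b) + (real a * L2_norm (A (a - 1) b) + L2_norm (A a (Suc b))))"
    by (intro mult_left_mono) auto
  also have "\<dots> = real N ^ i * L2_norm (A (Suc a) b) + real N ^ i * real a * L2_norm (A (a - 1) b) + real N ^ i * L2_norm (A a (Suc b))"
    by (simp add: algebra_simps)
  also have "\<dots> \<le> 3 ^ m * P * U N + 3 ^ m * P * U N + 3 ^ m * P * U N"
  proof (intro add_mono)
    have "m + Suc a + b + 2 * i = N" "m + a + Suc b + 2 * i = N" by (auto simp: N_def)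
    then show "real N ^ i * L2_norm (A (Suc a) b) \<le> 3 ^ m * P * U N"
      "real N ^ i * L2_norm (A a (Suc b)) \<le> 3 ^ m * P * U N"
      using Suc.IH[of "Suc a" b i] Suc.IH[of a "Suc b" i] by (simp_all add: A_def P_def)
    have P0: "P \<ge> 0" unfolding P_def by (rule S_seminorm_nonneg[OF f j])
    have U0: "U N \<ge> 0"
    proof -
      have "0 \<le> real (N + 2 * 0) ^ 0 * (M N / real j ^ N)" by (simp add: less_imp_le[OF pos])
      also have "\<dots> \<le> U (N + 2 * 0)" by (rule U)
      finally show ?thesis by simp
    qed
    show "real N ^ i * real a * L2_norm (A (a - 1) b) \<le> 3 ^ m * P * U N"
    proof (cases a)
      case 0
      then show ?thesis using P0 U0 by simp
    next
      case (Suc a')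
      have "real N ^ i * real a * L2_norm (A (a - 1) b) \<le> real N ^ i * real N * L2_norm (A (a - 1) b)"
        by (intro mult_right_mono mult_left_mono) (auto simp: N_def)
      also have "\<dots> = real N ^ Suc i * L2_norm (A (a - 1) b)" by simp
      also have "\<dots> \<le> 3 ^ m * P * U N"
      proof -
        have "m + (a - 1) + b + 2 * Suc i = N" using Suc by (simp add: N_def)
        then show ?thesis using Suc.IH[of "a - 1" b "Suc i"] by (simp only: A_def P_def)
      qed
      finally show ?thesis .
    qed
  qed
  also have "\<dots> = 3 ^ Suc m * P * U N" by simp
  finally show ?case unfolding N_def P_def .
qed

section \<open>Size of Hermite functions and decay of Hermite coefficients\<close>

text \<open>The constant \<open>H\<close> of the weight condition is fixed, since the rate in the decay
estimate for Hermite coefficients depends on it alone.\<close>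

locale weight_sequence = positive_sequence +
  fixes H :: real
  assumes H_pos: "H > 0"
    and weight: "\<And>C. C > 0 \<Longrightarrow> \<exists>B>0. \<forall>s p. sqrt (real s) ^ s * M p \<le> B * C ^ s * H ^ (s + p) * M (s + p)"
begin

text \<open>The weight condition with \<open>p = 0\<close>: the numbers \<open>m\<^bsup>m/2\<^esup>\<close> are smaller than \<open>M m\<close> by any exponential factor.\<close>

lemma sqrt_power_bound:
  assumes "c \<ge> 0"
  obtains B where "B > 0" "\<And>m. (c * sqrt (real m)) ^ m / M m \<le> B"
proof -
  \<comment> \<open>chosen such that \<open>c C H \<le> 1\<close>, also for \<open>c = 0\<close>\<close>
  define C where "C = 1 / ((c + 1) * H)"
  have C: "C > 0" using assms H_pos by (simp add: C_def)
  obtain B where B: "B > 0" "\<And>s p. sqrt (real s) ^ s * M p \<le> B * C ^ s * H ^ (s + p) * M (s + p)"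
    using weight[OF C] by blast
  have CH: "c * (C * H) \<le> 1" "0 \<le> c * (C * H)" using assms H_pos by (auto simp: C_def)
  have "(c * sqrt (real m)) ^ m / M m \<le> B / M 0" for m
  proof -
    have "sqrt (real m) ^ m * M 0 \<le> B * (C * H) ^ m * M m"
      using B(2)[of m 0] by (simp add: power_mult_distrib mult.assoc)
    then have "c ^ m * (sqrt (real m) ^ m * M 0) \<le> c ^ m * (B * (C * H) ^ m * M m)"
      using assms by (intro mult_left_mono) auto
    also have "\<dots> = B * (c * (C * H)) ^ m * M m" by (simp add: power_mult_distrib mult_ac)
    also have "\<dots> \<le> B * 1 * M m"
      using CH B(1) pos[of m] by (intro mult_right_mono mult_left_mono power_le_one) auto
    finally show ?thesis using pos[of m] pos[of 0] by (simp add: power_mult_distrib field_simps)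
  qed
  then show thesis using that[of "B / M 0"] B(1) pos[of 0] by simp
qed

text \<open>Up to an additive constant, the logarithm of this function is the associated function of the sequence \<open>M\<close>.\<close>

definition assoc_fun :: "real \<Rightarrow> real" where
  "assoc_fun t = (SUP m. t ^ m / M m)"

lemma assoc_fun_bdd:
  assumes "t \<ge> 0" shows "bdd_above (range (\<lambda>m. t ^ m / M m))"
proof -
  obtain B where B: "\<And>m. (t * sqrt (real m)) ^ m / M m \<le> B" using sqrt_power_bound[OF assms] by blast
  show ?thesis
  proof (rule bdd_aboveI2)
    fix m
    have "t ^ m \<le> (t * sqrt (real m)) ^ m"
    proof (cases "m = 0")
      case False
      then have "t * 1 \<le> t * sqrt (real m)" using assms by (intro mult_left_mono) auto
      then show ?thesis using assms by (intro power_mono) auto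
    qed simp
    then have "t ^ m / M m \<le> (t * sqrt (real m)) ^ m / M m"
      by (intro divide_right_mono) (auto simp: less_imp_le[OF pos])
    then show "t ^ m / M m \<le> B" using B[of m] by linarith
  qed
qed

lemma assoc_fun_ge: "t \<ge> 0 \<Longrightarrow> t ^ m / M m \<le> assoc_fun t"
  unfolding assoc_fun_def by (rule cSUP_upper[OF _ assoc_fun_bdd]) auto

lemma assoc_fun_leI: "(\<And>m. t ^ m / M m \<le> c) \<Longrightarrow> assoc_fun t \<le> c"
  unfolding assoc_fun_def by (rule cSUP_least) auto

lemma assoc_fun_ge0: "t \<ge> 0 \<Longrightarrow> 1 / M 0 \<le> assoc_fun t"
  using assoc_fun_ge[of t 0] by simp

lemma assoc_fun_pos: "t \<ge> 0 \<Longrightarrow> assoc_fun t > 0"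
  using assoc_fun_ge0[of t] pos[of 0] by (meson divide_pos_pos less_le_trans zero_less_one)

lemma assoc_fun_mono: "0 \<le> s \<Longrightarrow> s \<le> t \<Longrightarrow> assoc_fun s \<le> assoc_fun t"
  by (rule assoc_fun_leI, rule order_trans[OF _ assoc_fun_ge])
     (auto intro!: divide_right_mono power_mono less_imp_le[OF pos])

text \<open>For \<open>m \<le> msize \<alpha>\<close> the bound for words gives a term of the supremum defining \<open>assoc_fun\<close>; the terms with
\<open>m > msize \<alpha>\<close> are bounded uniformly by \<open>sqrt_power_bound\<close>, and \<open>assoc_fun\<close> is bounded below.\<close>

lemma weighted_term_nhermite:
  obtains B where "B > 0" "\<And>(\<alpha> :: 'n::finite \<Rightarrow> nat) ab. weighted_term M k (nhermite \<alpha>) ab \<le> B * assoc_fun (2 * real k * sqrt (real (msize \<alpha>)))"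
proof -
  obtain B where B: "B > 0" "\<And>m. ((2 * real k) * sqrt (real m)) ^ m / M m \<le> B"
    using sqrt_power_bound[of "2 * real k"] by auto
  show thesis
  proof (rule that[of "1 + B * M 0"])
    show "1 + B * M 0 > 0" using B(1) pos[of 0] by (simp add: add_pos_pos)
    fix \<alpha> :: "'n \<Rightarrow> nat" and ab :: "('n \<Rightarrow> nat) \<times> ('n \<Rightarrow> nat)"
    obtain a b where ab: "ab = (a, b)" by (cases ab)
    define m where "m = length (xd_word a b)"
    define n where "n = msize \<alpha>"
    define t where "t = 2 * real k * sqrt (real n)"
    have t: "t \<ge> 0" by (simp add: t_def)
    have E: "assoc_fun t > 0" by (rule assoc_fun_pos[OF t])
    have "weighted_term M k (nhermite \<alpha>) ab \<le> real k ^ m / M m * sqrt (2 * real (n + m)) ^ m"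
      unfolding ab weighted_term_word m_def n_def
      by (intro mult_left_mono L2_norm_word_nhermite) (simp add: less_imp_le[OF pos])
    also have "\<dots> = (real k * sqrt (2 * real (n + m))) ^ m / M m" by (simp add: power_mult_distrib)
    also have "\<dots> \<le> (1 + B * M 0) * assoc_fun t"
    proof (cases "m \<le> n")
      case True
      have "sqrt (2 * real (n + m)) \<le> sqrt (4 * real n)" using True by (intro real_sqrt_le_mono) auto
      then have "sqrt (2 * real (n + m)) \<le> 2 * sqrt (real n)" by (simp add: real_sqrt_mult)
      then have "real k * sqrt (2 * real (n + m)) \<le> real k * (2 * sqrt (real n))" by (rule mult_left_mono) simp
      then have "real k * sqrt (2 * real (n + m)) \<le> t" by (simp add: t_def mult_ac)
      then have "(real k * sqrt (2 * real (n + m))) ^ m / M m \<le> t ^ m / M m"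
        by (intro divide_right_mono power_mono) (auto simp: less_imp_le[OF pos])
      also have "\<dots> \<le> assoc_fun t" by (rule assoc_fun_ge[OF t])
      also have "\<dots> \<le> (1 + B * M 0) * assoc_fun t" using B(1) pos[of 0] E by (simp add: distrib_right)
      finally show ?thesis .
    next
      case False
      have "sqrt (2 * real (n + m)) \<le> sqrt (4 * real m)" using False by (intro real_sqrt_le_mono) auto
      then have "sqrt (2 * real (n + m)) \<le> 2 * sqrt (real m)" by (simp add: real_sqrt_mult)
      then have "real k * sqrt (2 * real (n + m)) \<le> real k * (2 * sqrt (real m))" by (rule mult_left_mono) simp
      then have "(real k * sqrt (2 * real (n + m))) ^ m / M m \<le> (2 * real k * sqrt (real m)) ^ m / M m"
        by (intro divide_right_mono power_mono) (auto simp: less_imp_le[OF pos] mult_ac)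
      also have "\<dots> \<le> B" by (rule B)
      also have "B = B * M 0 * (1 / M 0)" using pos[of 0] by simp
      also have "\<dots> \<le> B * M 0 * assoc_fun t"
        using B(1) pos[of 0] by (intro mult_left_mono assoc_fun_ge0 t) auto
      also have "\<dots> \<le> (1 + B * M 0) * assoc_fun t" using E by (simp add: distrib_right)
      finally show ?thesis .
    qed
    finally show "weighted_term M k (nhermite \<alpha>) ab \<le> (1 + B * M 0) * assoc_fun (2 * real k * sqrt (real (msize \<alpha>)))"
      unfolding t_def n_def .
  qed
qed

lemma nhermite_S_space: "nhermite \<alpha> \<in> S_space M"
  unfolding S_space_iff
proof (intro conjI allI impI)
  show "nhermite \<alpha> \<in> smooth_functions" by (intro hspan_smooth nhermite_hspan)
  show "square_integrable (foldr letter (xd_word a b) (nhermite \<alpha>))" for a b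
    by (intro hspan_sqint hspan_word nhermite_hspan)
  fix j
  obtain B where "\<And>(\<alpha> :: 'a \<Rightarrow> nat) ab. weighted_term M j (nhermite \<alpha>) ab \<le> B * assoc_fun (2 * real j * sqrt (real (msize \<alpha>)))"
    using weighted_term_nhermite[of j] by blast
  then show "bdd_above (range (weighted_term M j (nhermite \<alpha>)))" by (intro bdd_aboveI2)
qed

lemma S_seminorm_nhermite:
  obtains B where "B > 0" "\<And>\<alpha> :: 'n::finite \<Rightarrow> nat. S_seminorm M k (nhermite \<alpha>) \<le> B * assoc_fun (2 * real k * sqrt (real (msize \<alpha>)))"
proof -
  obtain B where "B > 0" "\<And>(\<alpha> :: 'n \<Rightarrow> nat) ab. weighted_term M k (nhermite \<alpha>) ab \<le> B * assoc_fun (2 * real k * sqrt (real (msize \<alpha>)))"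
    using weighted_term_nhermite[of k] by blast
  then show thesis by (intro that[of B] S_seminorm_leI)
qed

text \<open>This is \<open>(N/s)\<^sup>s \<le> N choose s \<le> 2\<^sup>N\<close> for \<open>s = 2 i\<close>, after taking square roots. It replaces the power of \<open>N\<close>
that counts commutators by the power of \<open>s\<close> that occurs in the weight condition.\<close>

lemma power_le_sqrt_power:
  assumes "2 * i \<le> N"
  shows "real N ^ i \<le> sqrt 2 ^ N * sqrt (real (2 * i)) ^ (2 * i)"
proof (cases "i = 0")
  case False
  define s where "s = 2 * i"
  have "(real N / real s) ^ s \<le> real (N choose s)"
    using binomial_ge_n_over_k_pow_k[of s N] assms by (simp add: s_def)
  also have "\<dots> \<le> real (2 ^ N)" using binomial_le_pow2[of N s] by (simp only: of_nat_le_iff)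
  finally have "real N ^ s \<le> 2 ^ N * real s ^ s"
    using False by (simp add: power_divide s_def divide_le_eq)
  then have "sqrt (real N ^ s) \<le> sqrt (2 ^ N * real s ^ s)" by (rule real_sqrt_le_mono)
  moreover have "sqrt (real N ^ s) = real N ^ i"
    by (simp add: s_def real_sqrt_power power_mult)
  ultimately show ?thesis by (simp add: real_sqrt_mult real_sqrt_power s_def[symmetric])
qed simp

text \<open>The weight condition is used with \<open>C = 1/j\<close>, so that the terms that have lost factors to commutators
obey the same bound as the leading ones.\<close>

lemma L2_lowering_pow:
  assumes j: "j \<ge> 1"
  obtains B where "B > 0"
    "\<And>(f :: real^'n::finite \<Rightarrow> complex) l m. f \<in> S_space M \<Longrightarrow>
       L2_norm ((lowering l ^^ m) f) \<le> B * (3 * sqrt 2 * H / real j) ^ m * M m * S_seminorm M j f"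
proof -
  have "1 / real j > 0" using j by simp
  then obtain B where B: "B > 0" "\<And>s p. sqrt (real s) ^ s * M p \<le> B * (1 / real j) ^ s * H ^ (s + p) * M (s + p)"
    using weight by blast
  define U where "U N = B * (sqrt 2 * H / real j) ^ N * M N" for N
  have U: "real (r + 2 * i) ^ i * (M r / real j ^ r) \<le> U (r + 2 * i)" for r i
  proof -
    define N where "N = r + 2 * i"
    have "real N ^ i * (M r / real j ^ r) \<le> (sqrt 2 ^ N * sqrt (real (2 * i)) ^ (2 * i)) * (M r / real j ^ r)"
      by (intro mult_right_mono power_le_sqrt_power) (auto simp: N_def less_imp_le[OF pos])
    also have "\<dots> = sqrt 2 ^ N / real j ^ r * (sqrt (real (2 * i)) ^ (2 * i) * M r)" by simp
    also have "\<dots> \<le> sqrt 2 ^ N / real j ^ r * (B * (1 / real j) ^ (2 * i) * H ^ (2 * i + r) * M (2 * i + r))"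
      by (intro mult_left_mono B) auto
    also have "\<dots> = U N"
      using j by (simp add: U_def N_def power_add power_divide power_mult_distrib add.commute field_simps)
    finally show ?thesis unfolding N_def .
  qed
  show thesis
  proof (rule that[OF B(1)])
    fix f :: "real^'n \<Rightarrow> complex" and l m assume f: "f \<in> S_space M"
    have "L2_norm ((lowering l ^^ m) f) \<le> 3 ^ m * S_seminorm M j f * U m"
      using L2_lowering_pow_weighted[OF f j U, of m 0 0 0 l] by simp
    also have "\<dots> = B * (3 * sqrt 2 * H / real j) ^ m * M m * S_seminorm M j f"
      by (simp add: U_def power_mult_distrib power_divide)
    finally show "L2_norm ((lowering l ^^ m) f) \<le> B * (3 * sqrt 2 * H / real j) ^ m * M m * S_seminorm M j f" .
  qed
qed

definition decay_rate :: real where "decay_rate = 1 / (3 * sqrt 2 * H)"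

lemma decay_rate_pos: "decay_rate > 0" using H_pos by (simp add: decay_rate_def)

text \<open>Each term of the supremum \<open>assoc_fun\<close> is treated separately: for \<open>2 m \<le> n\<close> by lowering \<open>m\<close> times, and for
\<open>2 m > n\<close> by \<open>sqrt_power_bound\<close> together with Bessel's inequality for \<open>f\<close> itself.\<close>

lemma hcoeff_decay:
  assumes j: "j \<ge> 1"
  obtains B where "B > 0"
    "\<And>(f :: real^'n::finite \<Rightarrow> complex) l n F. f \<in> S_space M \<Longrightarrow> finite F \<Longrightarrow> (\<And>\<alpha>. \<alpha> \<in> F \<Longrightarrow> n \<le> \<alpha> l) \<Longrightarrow>
       sqrt (\<Sum>\<alpha>\<in>F. (cmod (hcoeff f \<alpha>))\<^sup>2) * assoc_fun (decay_rate * real j * sqrt (real n)) \<le> B * S_seminorm M j f"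
proof -
  obtain B1 where B1: "B1 > 0" "\<And>(f :: real^'n \<Rightarrow> complex) l m. f \<in> S_space M \<Longrightarrow>
       L2_norm ((lowering l ^^ m) f) \<le> B1 * (3 * sqrt 2 * H / real j) ^ m * M m * S_seminorm M j f"
    using L2_lowering_pow[OF j] by blast
  have "decay_rate * real j * sqrt 2 \<ge> 0" using decay_rate_pos by simp
  then obtain B2 where B2: "B2 > 0" "\<And>m. (decay_rate * real j * sqrt 2 * sqrt (real m)) ^ m / M m \<le> B2"
    using sqrt_power_bound by blast
  define B where "B = B1 + M 0 * B2"
  show thesis
  proof (rule that[of B])
    show "B > 0" using B1 B2 pos[of 0] by (simp add: B_def add_pos_pos)
    fix f :: "real^'n \<Rightarrow> complex" and l :: 'n and n :: nat and F :: "('n \<Rightarrow> nat) set"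
    assume f: "f \<in> S_space M" and F: "finite F" "\<And>\<alpha>. \<alpha> \<in> F \<Longrightarrow> n \<le> \<alpha> l"
    define Q where "Q = sqrt (\<Sum>\<alpha>\<in>F. (cmod (hcoeff f \<alpha>))\<^sup>2)"
    define P where "P = S_seminorm M j f"
    define t where "t = decay_rate * real j * sqrt (real n)"
    have Q0: "Q \<ge> 0" unfolding Q_def by (intro real_sqrt_ge_zero sum_nonneg) auto
    have P0: "P \<ge> 0" unfolding P_def by (rule S_seminorm_nonneg[OF f j])
    have t0: "t \<ge> 0" using decay_rate_pos by (simp add: t_def)
    have main: "Q * (t ^ m / M m) \<le> B * P" for m
    proof (cases "2 * m \<le> n")
      case True
      have "Q * sqrt (real n) ^ m \<le> L2_norm ((lowering l ^^ m) f)"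
        unfolding Q_def by (rule hcoeff_lowering_Bessel[OF f F True])
      also have "\<dots> \<le> B1 * (3 * sqrt 2 * H / real j) ^ m * M m * P"
        unfolding P_def by (rule B1(2)[OF f])
      finally have le: "Q * sqrt (real n) ^ m \<le> B1 * (3 * sqrt 2 * H / real j) ^ m * M m * P" .
      have one: "(decay_rate * real j) * (3 * sqrt 2 * H / real j) = 1"
        using j H_pos by (simp add: decay_rate_def)
      have "Q * (t ^ m / M m) = (decay_rate * real j) ^ m / M m * (Q * sqrt (real n) ^ m)"
        by (simp add: t_def power_mult_distrib)
      also have "\<dots> \<le> (decay_rate * real j) ^ m / M m * (B1 * (3 * sqrt 2 * H / real j) ^ m * M m * P)"
        using decay_rate_pos by (intro mult_left_mono le) (auto simp: less_imp_le[OF pos])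
      also have "\<dots> = ((decay_rate * real j) * (3 * sqrt 2 * H / real j)) ^ m * (B1 * P)"
        using pos[of m] unfolding power_mult_distrib by (simp add: less_imp_neq[THEN not_sym])
      also have "\<dots> = B1 * P" unfolding one by simp
      also have "\<dots> \<le> B * P" using P0 B2(1) pos[of 0] by (simp add: B_def distrib_right)
      finally show ?thesis .
    next
      case False
      have "sqrt (real n) \<le> sqrt (2 * real m)" using False by (intro real_sqrt_le_mono) auto
      then have "decay_rate * real j * sqrt (real n) \<le> decay_rate * real j * (sqrt 2 * sqrt (real m))"
        using decay_rate_pos by (intro mult_left_mono) (auto simp: real_sqrt_mult)
      then have "t ^ m / M m \<le> (decay_rate * real j * sqrt 2 * sqrt (real m)) ^ m / M m"
        using t0 by (intro divide_right_mono power_mono) (auto simp: t_def mult.assoc less_imp_le[OF pos])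
      also have "\<dots> \<le> B2" by (rule B2)
      finally have "Q * (t ^ m / M m) \<le> Q * B2" using Q0 by (intro mult_left_mono)
      also have "Q \<le> M 0 * P"
        using hcoeff_Bessel[OF S_space_sqint[OF f] F(1)] L2_le_seminorm[OF f j] by (simp add: Q_def P_def)
      then have "Q * B2 \<le> M 0 * P * B2" using B2(1) by (intro mult_right_mono) auto
      also have "\<dots> \<le> B * P" using P0 B1(1) by (simp add: B_def distrib_right)
      finally show ?thesis .
    qed
    show "Q * assoc_fun t \<le> B * P"
    proof (cases "Q = 0")
      case True
      then show ?thesis using main[of 0] by simp
    next
      case False
      then have Q: "Q > 0" using Q0 by simp
      have "assoc_fun t \<le> B * P / Q"
        by (rule assoc_fun_leI) (use main Q in \<open>simp add: pos_le_divide_eq mult.commute\<close>)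
      then show ?thesis using Q by (simp add: pos_le_divide_eq mult.commute)
    qed
  qed
qed

end

section \<open>The topology and its continuous seminorms\<close>

context positive_sequence
begin

lemma topspace_S_topology: "topspace (S_topology M :: (real^'n::finite \<Rightarrow> complex) topology) = S_space M"
proof -
  define G where "G = {{g \<in> S_space M. p (\<lambda>x. g x - f x) < e} | (p :: (real^'n \<Rightarrow> complex) \<Rightarrow> real) f e.
     p \<in> S_seminorm M ` {1..} \<and> f \<in> S_space M \<and> e > 0}"
  have "f \<in> \<Union>G" if f: "f \<in> S_space M" for f
  proof (rule UnionI)
    show "{g \<in> S_space M. S_seminorm M 1 (\<lambda>x. g x - f x) < 1} \<in> G"
      unfolding G_def using f zero_less_one by blast
    show "f \<in> {g \<in> S_space M. S_seminorm M 1 (\<lambda>x. g x - f x) < 1}"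
      using f by (simp add: S_seminorm_zero)
  qed
  moreover have "\<Union>G \<subseteq> S_space M" by (auto simp: G_def)
  ultimately show ?thesis
    unfolding S_topology_def seminorm_topology_def topology_generated_by_topspace G_def[symmetric] by blast
qed

lemma openin_S_ball:
  assumes "f \<in> S_space M" "j \<ge> 1" "e > 0"
  shows "openin (S_topology M) {g \<in> S_space M. S_seminorm M j (\<lambda>x. g x - f x) < e}"
  unfolding S_topology_def seminorm_topology_def
  by (rule topology_generated_by_Basis) (use assms in blast)

lemma S_seminorm_diff_commute:
  assumes "f \<in> S_space M" "g \<in> S_space M" "j \<ge> 1"
  shows "S_seminorm M j (\<lambda>x. f x - g x) = S_seminorm M j (\<lambda>x. g x - f x)"
  using S_seminorm_cmult[OF S_space_diff[OF assms(2,1)] assms(3), of "-1"] by simp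

lemma S_seminorm_triangle_diff:
  assumes "f \<in> S_space M" "g \<in> S_space M" "j \<ge> 1"
  shows "S_seminorm M j g \<le> S_seminorm M j f + S_seminorm M j (\<lambda>x. g x - f x)"
  using S_seminorm_add[OF assms(1) S_space_diff[OF assms(2,1)] assms(3)] by simp

lemma continuous_map_S_seminorm:
  assumes j: "j \<ge> 1"
  shows "continuous_map (S_topology M) euclideanreal (S_seminorm M j)"
  unfolding continuous_map_def
proof (intro conjI allI impI)
  show "S_seminorm M j \<in> topspace (S_topology M) \<rightarrow> topspace euclideanreal" by simp
  fix U :: "real set" assume "openin euclideanreal U"
  then have U: "open U" by simp
  show "openin (S_topology M) {f \<in> topspace (S_topology M). S_seminorm M j f \<in> U}"
  proof (subst openin_subopen, intro ballI)
    fix f assume "f \<in> {f \<in> topspace (S_topology M). S_seminorm M j f \<in> U}"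
    then have f: "f \<in> S_space M" "S_seminorm M j f \<in> U" by (auto simp: topspace_S_topology)
    obtain e where e: "e > 0" "\<And>y. dist y (S_seminorm M j f) < e \<Longrightarrow> y \<in> U"
      using U f(2) unfolding open_dist by blast
    show "\<exists>V. openin (S_topology M) V \<and> f \<in> V \<and> V \<subseteq> {f \<in> topspace (S_topology M). S_seminorm M j f \<in> U}"
    proof (intro exI conjI subsetI)
      show "openin (S_topology M) {g \<in> S_space M. S_seminorm M j (\<lambda>x. g x - f x) < e}"
        by (rule openin_S_ball[OF f(1) j e(1)])
      show "f \<in> {g \<in> S_space M. S_seminorm M j (\<lambda>x. g x - f x) < e}"
        using f e j by (simp add: S_seminorm_zero)
      fix g assume "g \<in> {g \<in> S_space M. S_seminorm M j (\<lambda>x. g x - f x) < e}"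
      then have g: "g \<in> S_space M" "S_seminorm M j (\<lambda>x. g x - f x) < e" by auto
      have "\<bar>S_seminorm M j g - S_seminorm M j f\<bar> < e"
        using S_seminorm_triangle_diff[OF f(1) g(1) j] S_seminorm_triangle_diff[OF g(1) f(1) j] g(2)
          S_seminorm_diff_commute[OF f(1) g(1) j] by linarith
      then show "g \<in> {f \<in> topspace (S_topology M). S_seminorm M j f \<in> U}"
        using g e(2) by (simp add: topspace_S_topology dist_real_def)
    qed
  qed
qed

lemma continuous_seminorm_S_seminorm:
  assumes j: "j \<ge> 1" and C: "C \<ge> 0"
  shows "continuous_seminorm (S_space M) (S_topology M) (\<lambda>f. C * S_seminorm M j f)"
  unfolding continuous_seminorm_def seminorm_on_def
proof (intro conjI ballI allI)
  show "continuous_map (S_topology M) euclideanreal (\<lambda>f. C * S_seminorm M j f)"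
    by (intro continuous_map_real_mult_left continuous_map_S_seminorm j)
  show "0 \<le> C * S_seminorm M j f" if "f \<in> S_space M" for f
    using C S_seminorm_nonneg[OF that j] by simp
  show "C * S_seminorm M j (\<lambda>x. f x + g x) \<le> C * S_seminorm M j f + C * S_seminorm M j g"
    if "f \<in> S_space M" "g \<in> S_space M" for f g
    using mult_left_mono[OF S_seminorm_add[OF that j] C] by (simp add: distrib_left)
  show "C * S_seminorm M j (\<lambda>x. c * f x) = cmod c * (C * S_seminorm M j f)" if "f \<in> S_space M" for c f
    by (simp add: S_seminorm_cmult[OF that j])
qed

text \<open>The topology is generated by balls around arbitrary centres as a subbasis; a ball containing \<open>0\<close> contains
a smaller ball centred at \<open>0\<close>, and finite intersections are handled by monotonicity in \<open>j\<close>.\<close>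

lemma generated_neighbourhood_0:
  assumes "generate_topology_on {{g \<in> S_space M. p (\<lambda>x. g x - f x) < e} | p f e.
      p \<in> S_seminorm M ` {1..} \<and> f \<in> S_space M \<and> e > 0} (U :: (real^'n::finite \<Rightarrow> complex) set)"
    and "(\<lambda>x. 0) \<in> U"
  shows "\<exists>j\<ge>1. \<exists>d>0. {g \<in> S_space M. S_seminorm M j g < d} \<subseteq> U"
  using assms
proof induction
  case Empty
  then show ?case by simp
next
  case (Int a b)
  then obtain i d j e where i: "i \<ge> 1" "d > 0" "{g \<in> S_space M. S_seminorm M i g < d} \<subseteq> a"
    and j: "j \<ge> 1" "e > 0" "{g \<in> S_space M. S_seminorm M j g < e} \<subseteq> b" by auto
  have "{g \<in> S_space M. S_seminorm M (max i j) g < min d e} \<subseteq> a \<inter> b"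
  proof
    fix g :: "real^'n \<Rightarrow> complex" assume "g \<in> {g \<in> S_space M. S_seminorm M (max i j) g < min d e}"
    then have g: "g \<in> S_space M" "S_seminorm M (max i j) g < d" "S_seminorm M (max i j) g < e" by auto
    have "S_seminorm M i g \<le> S_seminorm M (max i j) g" "S_seminorm M j g \<le> S_seminorm M (max i j) g"
      using S_seminorm_mono[OF g(1) i(1)] S_seminorm_mono[OF g(1) j(1)] by auto
    then show "g \<in> a \<inter> b" using g i(3) j(3) by auto
  qed
  then show ?case using i j by (intro exI[of _ "max i j"] conjI exI[of _ "min d e"]) auto
next
  case (UN K)
  then obtain k where k: "k \<in> K" "(\<lambda>x. 0) \<in> k" by auto
  then show ?case using UN.IH[OF k] by blast
next
  case (Basis s)
  then obtain j f e where s: "s = {g \<in> S_space M. S_seminorm M j (\<lambda>x. g x - f x) < e}" "j \<ge> 1" "f \<in> S_space M" "e > 0"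
    by auto
  define d where "d = e - S_seminorm M j f"
  have "S_seminorm M j f = S_seminorm M j (\<lambda>x. 0 - f x)"
    using S_seminorm_diff_commute[OF S_space_zero s(3,2)] by simp
  then have d: "d > 0" using Basis(2) s by (simp add: d_def)
  have "{g \<in> S_space M. S_seminorm M j g < d} \<subseteq> s"
  proof
    fix g :: "real^'n \<Rightarrow> complex" assume "g \<in> {g \<in> S_space M. S_seminorm M j g < d}"
    then have g: "g \<in> S_space M" "S_seminorm M j g < d" by auto
    have "S_seminorm M j (\<lambda>x. g x + (-1) * f x) \<le> S_seminorm M j g + S_seminorm M j (\<lambda>x. (-1) * f x)"
      by (intro S_seminorm_add S_space_cmult g s)
    also have "S_seminorm M j (\<lambda>x. (-1) * f x) = S_seminorm M j f"
      using S_seminorm_cmult[OF s(3,2), of "-1"] by simp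
    finally show "g \<in> s" using g by (simp add: s d_def)
  qed
  then show ?case using d s(2) by blast
qed

text \<open>Scaling: the set where \<open>p\<close> is less than \<open>1\<close> is a neighbourhood of \<open>0\<close>.\<close>

lemma continuous_seminorm_bound:
  fixes p :: "(real^'n::finite \<Rightarrow> complex) \<Rightarrow> real"
  assumes p: "continuous_seminorm (S_space M) (S_topology M) p"
  obtains j C where "j \<ge> 1" "C > 0" "\<And>f. f \<in> S_space M \<Longrightarrow> p f \<le> C * S_seminorm M j f"
proof -
  have hom: "p (\<lambda>x. c * f x) = cmod c * p f" if "f \<in> S_space M" for c f
    using p that by (auto simp: continuous_seminorm_def seminorm_on_def)
  have nn: "p f \<ge> 0" if "f \<in> S_space M" for f
    using p that by (auto simp: continuous_seminorm_def seminorm_on_def)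
  have cm: "continuous_map (S_topology M) euclideanreal p"
    using p by (simp add: continuous_seminorm_def)
  define U where "U = {f \<in> topspace (S_topology M). p f \<in> {..<1}}"
  have "openin (S_topology M) U" unfolding U_def
    by (rule openin_continuous_map_preimage[OF cm]) auto
  then have gen: "generate_topology_on {{g \<in> S_space M. p (\<lambda>x. g x - f x) < e} | p f e.
      p \<in> S_seminorm M ` {1..} \<and> f \<in> S_space M \<and> e > 0} U"
    unfolding S_topology_def seminorm_topology_def openin_topology_generated_by_iff .
  have "(\<lambda>x. 0) \<in> U"
    using hom[OF S_space_zero, of 0] by (simp add: U_def topspace_S_topology S_space_zero)
  from generated_neighbourhood_0[OF gen this]
  obtain j d where j: "j \<ge> 1" "d > 0" "{g \<in> S_space M. S_seminorm M j g < d} \<subseteq> U" by blast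
  have "p f \<le> (2 / d) * S_seminorm M j f" if f: "f \<in> S_space M" for f
  proof (rule ccontr)
    assume "\<not> p f \<le> (2 / d) * S_seminorm M j f"
    then have lt: "(2 / d) * S_seminorm M j f < p f" by simp
    have "0 \<le> (2 / d) * S_seminorm M j f" using j S_seminorm_nonneg[OF f j(1)] by simp
    then have pf: "p f > 0" using lt by linarith
    define c where "c = complex_of_real (1 / p f)"
    have cn: "cmod c = 1 / p f" using pf by (simp add: c_def norm_divide)
    have "S_seminorm M j (\<lambda>x. c * f x) = S_seminorm M j f / p f"
      using S_seminorm_cmult[OF f j(1), of c] cn by simp
    also have "\<dots> < d" using lt pf j(2) S_seminorm_nonneg[OF f j(1)] by (simp add: field_simps)
    finally have "(\<lambda>x. c * f x) \<in> U" using j(3) S_space_cmult[OF f] by blast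
    then have "p (\<lambda>x. c * f x) < 1" by (simp add: U_def)
    then show False using hom[OF f, of c] cn pf by simp
  qed
  then show thesis using that[of j "2 / d"] j by auto
qed

lemma linear_functional_sum:
  assumes \<phi>: "linear_functional_on (S_space M) \<phi>" and g: "\<And>i. i \<in> I \<Longrightarrow> g i \<in> S_space M"
  shows "\<phi> (\<lambda>x. \<Sum>i\<in>I. a i * g i x) = (\<Sum>i\<in>I. a i * \<phi> (g i))"
proof -
  have z: "\<phi> (\<lambda>x. 0) = 0"
  proof -
    have "\<forall>f\<in>S_space M. \<phi> (\<lambda>x. 0 * f x) = 0 * \<phi> f"
      using \<phi> unfolding linear_functional_on_def by blast
    from bspec[OF this S_space_zero] show ?thesis by simp
  qed
  have A: "\<phi> (\<lambda>x. f x + g x) = \<phi> f + \<phi> g" if "f \<in> S_space M" "g \<in> S_space M" for f g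
    using \<phi> that unfolding linear_functional_on_def by blast
  show ?thesis using g
  proof (induction I rule: infinite_finite_induct)
    case (insert i I)
    have 1: "\<phi> (\<lambda>x. a i * g i x + (\<Sum>i\<in>I. a i * g i x)) = \<phi> (\<lambda>x. a i * g i x) + \<phi> (\<lambda>x. \<Sum>i\<in>I. a i * g i x)"
    proof (rule A)
      show "(\<lambda>x. a i * g i x) \<in> S_space M" using insert.prems by (intro S_space_cmult) auto
      show "(\<lambda>x. \<Sum>i\<in>I. a i * g i x) \<in> S_space M"
        using insert.prems by (intro S_space_sum S_space_cmult) auto
    qed
    have 2: "\<phi> (\<lambda>x. a i * g i x) = a i * \<phi> (g i)"
      using \<phi> insert.prems unfolding linear_functional_on_def by auto
    show ?case using insert 1 2 by simp
  qed (use z in auto)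
qed

end

section \<open>Duality between words and Hermite sums\<close>

text \<open>The outermost derivative is the one in the first direction with a non-zero order; it does not depend
on \<open>f\<close>.\<close>

lemma foldr_partial_deriv_split:
  assumes "distinct cs" "i0 \<in> set cs" "\<beta> i0 > 0"
  shows "\<exists>i. \<beta> i > 0 \<and> (\<forall>f. foldr (\<lambda>i. partial_deriv i ^^ \<beta> i) cs f =
     partial_deriv i (foldr (\<lambda>k. partial_deriv k ^^ ((\<beta>(i := \<beta> i - 1)) k)) cs f))"
  using assms
proof (induction cs)
  case (Cons c cs)
  show ?case
  proof (cases "\<beta> c > 0")
    case True
    have "foldr (\<lambda>i. partial_deriv i ^^ \<beta> i) cs f = foldr (\<lambda>k. partial_deriv k ^^ ((\<beta>(c := \<beta> c - 1)) k)) cs f" for f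
      using Cons.prems(1) by (intro foldr_cong) auto
    moreover obtain m where "\<beta> c = Suc m" using True gr0_implies_Suc by blast
    ultimately show ?thesis by (intro exI[of _ c]) (simp add: fun_upd_def)
  next
    case False
    then have "i0 \<in> set cs" using Cons.prems by auto
    then obtain i where i: "\<beta> i > 0" "\<And>f. foldr (\<lambda>i. partial_deriv i ^^ \<beta> i) cs f =
     partial_deriv i (foldr (\<lambda>k. partial_deriv k ^^ ((\<beta>(i := \<beta> i - 1)) k)) cs f)"
      using Cons by auto
    have "c \<noteq> i" using False i(1) by auto
    then have "(\<beta>(i := \<beta> i - 1)) c = 0" using False by simp
    then show ?thesis using i False by (intro exI[of _ i]) (simp del: fun_upd_apply)
  qed
qed simp

lemma multi_deriv_split:
  assumes "msize \<beta> > 0"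
  shows "\<exists>i. \<beta> i > 0 \<and> (\<forall>f. multi_deriv \<beta> f = partial_deriv i (multi_deriv (\<beta>(i := \<beta> i - 1)) f))"
proof -
  have "\<exists>i. \<beta> i > 0"
  proof (rule ccontr)
    assume "\<not> (\<exists>i. \<beta> i > 0)"
    then have "msize \<beta> = 0" by (auto simp: msize_def)
    then show False using assms by simp
  qed
  then show ?thesis unfolding multi_deriv_def
    using foldr_partial_deriv_split[OF coords_props(2), of _ \<beta>] coords_props(1) by blast
qed

lemma word_of_zero: "word_of b cs (\<lambda>_. 0) = []"
  by (simp add: word_of_def)

lemma S_space_sqint_multi_deriv:
  assumes "f \<in> S_space M" shows "square_integrable (multi_deriv \<beta> f)"
  using S_space_sqint_word[OF assms, of "\<lambda>_. 0" \<beta>]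
  by (simp add: xd_word_def multi_deriv_word word_of_zero)

text \<open>The derivatives are moved to the other side one at a time from the outside, so that all intermediate
functions are again of the form \<open>\<partial>\<^sup>\<gamma> u\<close> and hence square-integrable.\<close>

lemma multi_deriv_adjoint:
  "h \<in> hspan \<Longrightarrow> \<exists>g\<in>hspan. \<forall>u\<in>S_space M. ip (multi_deriv \<beta> u) h = ip u g"
proof (induction "msize \<beta>" arbitrary: \<beta> h)
  case 0
  then have "\<beta> = (\<lambda>_. 0)" by (auto simp: msize_def)
  then have "multi_deriv \<beta> u = u" for u :: "real^'a \<Rightarrow> complex"
    by (simp add: multi_deriv_word word_of_zero)
  then show ?case using 0 by auto
next
  case (Suc n)
  obtain i where i: "\<beta> i > 0" and eq: "\<And>f. multi_deriv \<beta> f = partial_deriv i (multi_deriv (\<beta>(i := \<beta> i - 1)) f)"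
    using multi_deriv_split[of \<beta>] Suc by auto
  define \<gamma> where "\<gamma> = \<beta>(i := \<beta> i - 1)"
  have "\<gamma>(i := Suc (\<gamma> i)) = \<beta>" using i by (simp add: \<gamma>_def)
  then have "n = msize \<gamma>" using msize_upd_Suc[of \<gamma> i] Suc.hyps(2) by simp
  moreover have "(\<lambda>x. (-1) * partial_deriv i h x) \<in> hspan"
    by (intro hspan_cmult hspan_partial_deriv Suc.prems)
  ultimately obtain g where g: "g \<in> hspan"
    "\<And>u. u \<in> S_space M \<Longrightarrow> ip (multi_deriv \<gamma> u) (\<lambda>x. (-1) * partial_deriv i h x) = ip u g"
    using Suc.hyps(1) by blast
  have "ip (multi_deriv \<beta> u) h = ip u g" if u: "u \<in> S_space M" for u
  proof -
    have "multi_deriv \<gamma> u \<in> smooth_functions"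
      unfolding multi_deriv_word by (intro smooth_word S_space_smooth[OF u])
    then have "ip (partial_deriv i (multi_deriv \<gamma> u)) h = - ip (multi_deriv \<gamma> u) (partial_deriv i h)"
      using S_space_sqint_multi_deriv[OF u, of \<gamma>] S_space_sqint_multi_deriv[OF u, of \<beta>]
      by (intro ip_partial_deriv hspan_smooth[OF Suc.prems] hspan_sqint[OF Suc.prems]
          hspan_sqint[OF hspan_partial_deriv[OF Suc.prems]]) (auto simp: eq \<gamma>_def)
    then show ?thesis using g(2)[OF u] unfolding ip_cmult_right by (simp add: eq \<gamma>_def)
  qed
  then show ?case using g(1) by blast
qed

lemma xd_word_adjoint:
  assumes "h \<in> hspan"
  shows "\<exists>g\<in>hspan. \<forall>u\<in>S_space M. ip (foldr letter (xd_word \<alpha> \<beta>) u) h = ip u g"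
proof -
  have "(\<lambda>x. of_real (monomial \<alpha> x) * h x) \<in> hspan"
    unfolding monomial_word by (rule hspan_word[OF assms])
  then obtain g where g: "g \<in> hspan"
    "\<And>u. u \<in> S_space M \<Longrightarrow> ip (multi_deriv \<beta> u) (\<lambda>x. of_real (monomial \<alpha> x) * h x) = ip u g"
    using multi_deriv_adjoint by blast
  have "ip (foldr letter (xd_word \<alpha> \<beta>) u) h = ip (multi_deriv \<beta> u) (\<lambda>x. of_real (monomial \<alpha> x) * h x)" for u
    unfolding xd_word[symmetric] by (simp add: ip_def mult_ac)
  then show ?thesis using g by metis
qed

lemma hspan_finitely_many_coeffs:
  "g \<in> hspan \<Longrightarrow> \<exists>F. finite F \<and> (\<forall>u. square_integrable u \<longrightarrow> (\<forall>\<alpha>\<in>F. hcoeff u \<alpha> = 0) \<longrightarrow> ip u g = 0)"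
proof (induction rule: hspan.induct)
  case (hspan_base \<alpha>)
  have "ip u (hermite \<alpha>) = 0" if "hcoeff u \<alpha> = 0" for u
  proof -
    have "hermite \<alpha> = (\<lambda>x. of_real (L2_norm (hermite \<alpha>)) * nhermite \<alpha> x)"
      using hermite_nhermite by blast
    then have "ip u (hermite \<alpha>) = cnj (of_real (L2_norm (hermite \<alpha>))) * ip u (nhermite \<alpha>)"
      by (metis ip_cmult_right)
    then show ?thesis using that by (simp add: hcoeff_def)
  qed
  then show ?case by (intro exI[of _ "{\<alpha>}"]) auto
next
  case (hspan_add f g)
  then obtain F G where F: "finite F" "\<And>u. square_integrable u \<Longrightarrow> (\<forall>\<alpha>\<in>F. hcoeff u \<alpha> = 0) \<Longrightarrow> ip u f = 0"
    and G: "finite G" "\<And>u. square_integrable u \<Longrightarrow> (\<forall>\<alpha>\<in>G. hcoeff u \<alpha> = 0) \<Longrightarrow> ip u g = 0" by blast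
  have "ip u (\<lambda>x. f x + g x) = 0" if "square_integrable u" "\<forall>\<alpha>\<in>F \<union> G. hcoeff u \<alpha> = 0" for u
    using that F(2)[of u] G(2)[of u] hspan_add.hyps by (simp add: ip_add_right hspan_sqint)
  then show ?case using F(1) G(1) by (intro exI[of _ "F \<union> G"]) auto
next
  case (hspan_cmult f c)
  then show ?case by (auto simp: ip_cmult_right)
qed

section \<open>Convergence of Hermite expansions\<close>

text \<open>By completeness, \<open>v\<close> itself can be approximated by the test functions \<open>h\<close>.\<close>

lemma L2_norm_le_by_duality:
  assumes c: "continuous_on UNIV v" and v: "square_integrable v" and t: "\<tau> \<ge> 0"
    and le: "\<And>h. h \<in> hspan \<Longrightarrow> cmod (ip v h) \<le> \<tau> * L2_norm h"
  shows "L2_norm v \<le> \<tau>"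
proof (rule ccontr)
  define V where "V = L2_norm v"
  assume "\<not> L2_norm v \<le> \<tau>"
  then have V: "V > \<tau>" by (simp add: V_def)
  then have V0: "V > 0" using t by simp
  \<comment> \<open>small enough that the total error \<open>(V + \<tau>) e\<close> is half of \<open>V\<^sup>2 - V \<tau>\<close>\<close>
  define e where "e = V * (V - \<tau>) / (2 * (V + \<tau>))"
  have e: "e > 0" using V V0 t by (simp add: e_def)
  obtain h where h: "h \<in> hspan" "L2_norm (\<lambda>x. v x - h x) < e"
    using hclosureE[OF hermite_complete[OF c v] e] .
  note hs = hspan_sqint[OF h(1)]
  note ds = sqint_diff[OF v hs]
  have "L2_norm (\<lambda>x. v x + (-1) * (v x - h x)) \<le> L2_norm v + L2_norm (\<lambda>x. (-1) * (v x - h x))"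
    by (intro L2_norm_triangle v sqint_cmult ds)
  then have hn: "L2_norm h \<le> V + e" using h(2) by (simp only: L2_norm_cmult) (simp add: V_def)
  have "complex_of_real (V\<^sup>2) = ip v (\<lambda>x. v x - h x) + ip v h"
    unfolding V_def ip_self[symmetric] by (simp add: ip_diff_right v hs)
  then have "V\<^sup>2 = cmod (ip v (\<lambda>x. v x - h x) + ip v h)"
    by (metis abs_power2 norm_of_real)
  also have "\<dots> \<le> cmod (ip v (\<lambda>x. v x - h x)) + cmod (ip v h)" by (rule norm_triangle_ineq)
  also have "\<dots> \<le> V * L2_norm (\<lambda>x. v x - h x) + \<tau> * L2_norm h"
    unfolding V_def by (intro add_mono ip_Cauchy_Schwarz le h v ds)
  also have "\<dots> \<le> V * e + \<tau> * (V + e)"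
    using h(2) hn V0 t by (intro add_mono mult_left_mono) auto
  finally have "V\<^sup>2 \<le> V * \<tau> + (V + \<tau>) * e" by (simp add: algebra_simps)
  also have "(V + \<tau>) * e = V * (V - \<tau>) / 2" using V0 t by (simp add: e_def field_simps)
  finally have "V\<^sup>2 \<le> V * \<tau> + V * (V - \<tau>) / 2" .
  moreover have "V * (V - \<tau>) = V\<^sup>2 - V * \<tau>" by (simp add: power2_eq_square right_diff_distrib)
  ultimately have "V * (V - \<tau>) \<le> V * (V - \<tau>) / 2" by linarith
  moreover have "V * (V - \<tau>) > 0" using V V0 by simp
  ultimately show False by simp
qed

definition hermite_sum :: "(nat \<Rightarrow> 'n::finite \<Rightarrow> nat) \<Rightarrow> (real^'n \<Rightarrow> complex) \<Rightarrow> nat \<Rightarrow> real^'n \<Rightarrow> complex" where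
  "hermite_sum e f n x = (\<Sum>i<n. hcoeff f (e i) * nhermite (e i) x)"

lemma hcoeff_hermite_sum:
  assumes "inj e"
  shows "hcoeff (hermite_sum e f n) (e k) = (if k < n then hcoeff f (e k) else 0)"
proof -
  have "hcoeff (hermite_sum e f n) (e k) = (\<Sum>i<n. hcoeff f (e i) * ip (nhermite (e i)) (nhermite (e k)))"
    unfolding hermite_sum_def[abs_def] hcoeff_def[of "\<lambda>x. _ x"]
    by (subst ip_sum_left) (auto simp: ip_cmult_left hspan_sqint nhermite_hspan sqint_cmult)
  also have "\<dots> = (\<Sum>i<n. if i = k then hcoeff f (e k) else 0)"
    using assms by (intro sum.cong) (auto simp: nhermite_orthonormal inj_eq)
  finally show ?thesis by simp
qed

context weight_sequence
begin

lemma hermite_sum_S_space: "hermite_sum e f n \<in> S_space M"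
  unfolding hermite_sum_def[abs_def] by (intro S_space_sum S_space_cmult nhermite_S_space)

text \<open>A fixed test function \<open>h\<close> sees only finitely many Hermite coefficients of the remainder, so it cannot
distinguish \<open>f\<close> from a sufficiently long partial sum. Thus the remainder may be replaced by the finite
sum over \<open>n \<le> i < N\<close>, for which the triangle inequality suffices.\<close>

lemma L2_norm_word_remainder:
  fixes f :: "real^'n::finite \<Rightarrow> complex"
  assumes e: "bij e" and f: "f \<in> S_space M" and t: "\<tau> \<ge> 0"
    and le: "\<And>N. (\<Sum>i\<in>{n..<N}. cmod (hcoeff f (e i)) * L2_norm (foldr letter (xd_word a b) (nhermite (e i)))) \<le> \<tau>"
  shows "L2_norm (foldr letter (xd_word a b) (\<lambda>x. f x - hermite_sum e f n x)) \<le> \<tau>"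
proof (rule L2_norm_le_by_duality[OF _ _ t])
  let ?w = "foldr letter (xd_word a b)"
  have r: "(\<lambda>x. f x - hermite_sum e f N x) \<in> S_space M" for N
    by (intro S_space_diff f hermite_sum_S_space)
  show "continuous_on UNIV (?w (\<lambda>x. f x - hermite_sum e f n x))"
    by (intro smooth_continuous smooth_word S_space_smooth[OF r])
  show "square_integrable (?w (\<lambda>x. f x - hermite_sum e f n x))"
    by (rule S_space_sqint_word[OF r])
  fix h :: "real^'n \<Rightarrow> complex" assume h: "h \<in> hspan"
  note hs = hspan_sqint[OF h]
  obtain g where g: "g \<in> hspan" "\<And>u. u \<in> S_space M \<Longrightarrow> ip (?w u) h = ip u g"
    using xd_word_adjoint[OF h] by blast
  obtain F where F: "finite F" "\<And>u. square_integrable u \<Longrightarrow> \<forall>\<alpha>\<in>F. hcoeff u \<alpha> = 0 \<Longrightarrow> ip u g = 0"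
    using hspan_finitely_many_coeffs[OF g(1)] by blast
  have "finite (inv e ` F)" using F(1) by simp
  then obtain N0 where N0: "inv e ` F \<subseteq> {..<N0}" using finite_nat_iff_bounded by blast
  define N where "N = max n N0"
  have N: "n \<le> N" "\<And>\<alpha>. \<alpha> \<in> F \<Longrightarrow> inv e \<alpha> < N" using N0 by (auto simp: N_def)
  define u where "u = (\<lambda>x. f x - hermite_sum e f N x)"
  have u: "u \<in> S_space M" unfolding u_def by (rule r)
  have "hcoeff u \<alpha> = 0" if mem: "\<alpha> \<in> F" for \<alpha>
  proof -
    have "\<alpha> = e (inv e \<alpha>)" using e by (simp add: bij_is_surj surj_f_inv_f)
    then obtain k where k: "\<alpha> = e k" "k < N" using N(2)[OF mem] by metis
    have "hcoeff u \<alpha> = hcoeff f \<alpha> - hcoeff (hermite_sum e f N) \<alpha>"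
      unfolding u_def hcoeff_def
      by (intro ip_diff_left S_space_sqint[OF f] S_space_sqint[OF hermite_sum_S_space] hspan_sqint nhermite_hspan)
    then show ?thesis using k hcoeff_hermite_sum[OF bij_is_inj[OF e], of f N k] by simp
  qed
  then have "ip u g = 0" using F(2) S_space_sqint[OF u] by blast
  then have z: "ip (?w u) h = 0" using g(2)[OF u] by simp
  have split: "(\<lambda>x. f x - hermite_sum e f n x) = (\<lambda>x. u x + (\<Sum>i\<in>{n..<N}. hcoeff f (e i) * nhermite (e i) x))"
  proof
    fix x
    have "hermite_sum e f N x = hermite_sum e f n x + (\<Sum>i\<in>{n..<N}. hcoeff f (e i) * nhermite (e i) x)"
      unfolding hermite_sum_def lessThan_atLeast0 by (rule sum.atLeastLessThan_concat[symmetric]) (use N in auto)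
    then show "f x - hermite_sum e f n x = u x + (\<Sum>i\<in>{n..<N}. hcoeff f (e i) * nhermite (e i) x)"
      by (simp add: u_def)
  qed
  have sm: "(\<lambda>x. c * nhermite \<alpha> x) \<in> smooth_functions" for c and \<alpha> :: "'n \<Rightarrow> nat"
    by (intro smooth_cmult hspan_smooth nhermite_hspan)
  have sq: "square_integrable (\<lambda>x. c * ?w (nhermite \<alpha>) x)" for c and \<alpha> :: "'n \<Rightarrow> nat"
    by (intro sqint_cmult hspan_sqint hspan_word nhermite_hspan)
  have W: "?w (\<lambda>x. f x - hermite_sum e f n x) = (\<lambda>x. ?w u x + (\<Sum>i\<in>{n..<N}. hcoeff f (e i) * ?w (nhermite (e i)) x))"
    unfolding split
    by (simp add: word_add[OF S_space_smooth[OF u] smooth_sum[OF sm]] word_sum[OF sm]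
        word_cmult[OF hspan_smooth[OF nhermite_hspan]])
  have "ip (?w (\<lambda>x. f x - hermite_sum e f n x)) h = (\<Sum>i\<in>{n..<N}. hcoeff f (e i) * ip (?w (nhermite (e i))) h)"
    unfolding W by (subst ip_add_left[OF S_space_sqint_word[OF u] sqint_sum[OF sq] hs])
      (simp add: z ip_sum_left[OF sq hs] ip_cmult_left)
  then have "cmod (ip (?w (\<lambda>x. f x - hermite_sum e f n x)) h) \<le>
     (\<Sum>i\<in>{n..<N}. cmod (hcoeff f (e i) * ip (?w (nhermite (e i))) h))"
    by (simp only: norm_sum)
  also have "\<dots> \<le> (\<Sum>i\<in>{n..<N}. cmod (hcoeff f (e i)) * (L2_norm (?w (nhermite (e i))) * L2_norm h))"
    unfolding norm_mult
    by (intro sum_mono mult_left_mono ip_Cauchy_Schwarz hs hspan_sqint hspan_word nhermite_hspan) auto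
  also have "\<dots> = (\<Sum>i\<in>{n..<N}. cmod (hcoeff f (e i)) * L2_norm (?w (nhermite (e i)))) * L2_norm h"
    by (simp add: sum_distrib_right mult.assoc)
  also have "\<dots> \<le> \<tau> * L2_norm h" by (intro mult_right_mono le) auto
  finally show "cmod (ip (?w (\<lambda>x. f x - hermite_sum e f n x)) h) \<le> \<tau> * L2_norm h" .
qed

lemma hermite_expansion_converges:
  fixes f :: "real^'n::finite \<Rightarrow> complex"
  assumes e: "bij e" and f: "f \<in> S_space M" and k: "k \<ge> 1"
    and sm: "summable (\<lambda>i. cmod (hcoeff f (e i)) * S_seminorm M k (nhermite (e i)))"
  shows "(\<lambda>n. S_seminorm M k (\<lambda>x. f x - hermite_sum e f n x)) \<longlonglongrightarrow> 0"
proof -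
  define D where "D i = cmod (hcoeff f (e i)) * S_seminorm M k (nhermite (e i))" for i
  have D0: "D i \<ge> 0" for i
    unfolding D_def by (intro mult_nonneg_nonneg S_seminorm_nonneg nhermite_S_space k) auto
  have smD: "summable D" using sm by (simp add: D_def[abs_def])
  have le: "S_seminorm M k (\<lambda>x. f x - hermite_sum e f n x) \<le> (\<Sum>i. D (i + n))" for n
  proof (rule S_seminorm_leI)
    fix a b :: "'n \<Rightarrow> nat"
    define \<kappa> where "\<kappa> = real k ^ length (xd_word a b) / M (length (xd_word a b))"
    have \<kappa>: "\<kappa> > 0" using k pos by (simp add: \<kappa>_def)
    have S0: "(\<Sum>i. D (i + n)) \<ge> 0" by (intro suminf_nonneg summable_ignore_initial_segment smD D0)
    have "L2_norm (foldr letter (xd_word a b) (\<lambda>x. f x - hermite_sum e f n x)) \<le> (\<Sum>i. D (i + n)) / \<kappa>"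
    proof (rule L2_norm_word_remainder[OF e f])
      show "0 \<le> (\<Sum>i. D (i + n)) / \<kappa>" using S0 \<kappa> by simp
      fix N
      have "\<kappa> * L2_norm (foldr letter (xd_word a b) (nhermite (e i))) \<le> S_seminorm M k (nhermite (e i))" for i
        using weighted_term_le_seminorm[OF nhermite_S_space k, of "e i" "(a, b)"]
        by (simp add: weighted_term_word \<kappa>_def)
      then have "cmod (hcoeff f (e i)) * (\<kappa> * L2_norm (foldr letter (xd_word a b) (nhermite (e i)))) \<le> D i" for i
        unfolding D_def by (rule mult_left_mono) simp
      then have "cmod (hcoeff f (e i)) * L2_norm (foldr letter (xd_word a b) (nhermite (e i))) \<le> D i / \<kappa>" for i
        using \<kappa> by (simp add: pos_le_divide_eq mult_ac)
      then have "(\<Sum>i\<in>{n..<N}. cmod (hcoeff f (e i)) * L2_norm (foldr letter (xd_word a b) (nhermite (e i))))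
         \<le> (\<Sum>i\<in>{n..<N}. D i / \<kappa>)" by (intro sum_mono)
      also have "\<dots> = (\<Sum>i\<in>{n..<N}. D i) / \<kappa>" by (simp add: sum_divide_distrib)
      also have "(\<Sum>i\<in>{n..<N}. D i) \<le> (\<Sum>i. D (i + n))"
      proof (cases "n \<le> N")
        case True
        then have "(\<Sum>i\<in>{n..<N}. D i) = (\<Sum>i<N - n. D (i + n))"
          using sum.shift_bounds_nat_ivl[of D 0 n "N - n"] by (simp add: lessThan_atLeast0)
        also have "\<dots> \<le> (\<Sum>i. D (i + n))"
          by (intro sum_le_suminf summable_ignore_initial_segment smD) (auto simp: D0)
        finally show ?thesis .
      qed (use S0 in simp)
      then have "(\<Sum>i\<in>{n..<N}. D i) / \<kappa> \<le> (\<Sum>i. D (i + n)) / \<kappa>" using \<kappa> by (intro divide_right_mono) auto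
      finally show "(\<Sum>i\<in>{n..<N}. cmod (hcoeff f (e i)) * L2_norm (foldr letter (xd_word a b) (nhermite (e i))))
         \<le> (\<Sum>i. D (i + n)) / \<kappa>" .
    qed
    then show "weighted_term M k (\<lambda>x. f x - hermite_sum e f n x) (a, b) \<le> (\<Sum>i. D (i + n))"
      using \<kappa> unfolding weighted_term_word \<kappa>_def[symmetric] by (simp add: pos_le_divide_eq mult.commute)
  qed
  have lim: "(\<lambda>n. \<Sum>i. D (i + n)) \<longlonglongrightarrow> 0"
  proof -
    have "(\<lambda>n. suminf D - sum D {..<n}) \<longlonglongrightarrow> suminf D - suminf D"
      by (intro tendsto_diff tendsto_const summable_LIMSEQ smD)
    then show ?thesis using suminf_minus_initial_segment[OF smD] by simp
  qed
  show ?thesis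
    by (rule tendsto_sandwich[OF _ _ tendsto_const lim])
       (auto intro!: always_eventually S_seminorm_nonneg S_space_diff f hermite_sum_S_space k le)
qed

section \<open>Consequences of the growth condition for the associated function\<close>

text \<open>The case \<open>r = 1\<close> follows by comparing the term of order \<open>m\<close> on the left with that of order \<open>m + 1\<close> on the right.\<close>

lemma assoc_fun_shift:
  assumes M2: "\<And>p. M (p + 1) \<le> A * h ^ p * M p" and A: "A > 0" and h: "h \<ge> 1" and t: "t \<ge> 0"
  shows "t ^ r * assoc_fun t \<le> A ^ r * assoc_fun (h ^ r * t)"
proof (induction r)
  case 0
  then show ?case by simp
next
  case (Suc r)
  have one: "s * assoc_fun s \<le> A * assoc_fun (h * s)" if s: "s \<ge> 0" for s
  proof (cases "s = 0")
    case True
    then show ?thesis using A assoc_fun_pos[of 0] by simp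
  next
    case False
    then have s0: "s > 0" using s by simp
    have "assoc_fun s \<le> A * assoc_fun (h * s) / s"
    proof (rule assoc_fun_leI)
      fix m
      have "M (Suc m) \<le> A * h ^ m * M m" using M2[of m] by simp
      then have "1 / M m \<le> A * h ^ m / M (Suc m)" using pos[of m] pos[of "Suc m"] by (simp add: field_simps)
      then have "s ^ m * s * (1 / M m) \<le> s ^ m * s * (A * h ^ m / M (Suc m))"
        using s0 by (intro mult_left_mono) auto
      then have "s ^ m / M m * s \<le> A * (h ^ m * s ^ Suc m / M (Suc m))" by (simp add: mult_ac)
      also have "\<dots> \<le> A * ((h * s) ^ Suc m / M (Suc m))"
      proof -
        have "h ^ m * s ^ Suc m \<le> h ^ Suc m * s ^ Suc m"
          using h s0 by (intro mult_right_mono power_increasing) auto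
        then have "h ^ m * s ^ Suc m \<le> (h * s) ^ Suc m" unfolding power_mult_distrib .
        then show ?thesis using A pos[of "Suc m"]
          by (intro mult_left_mono divide_right_mono) auto
      qed
      also have "\<dots> \<le> A * assoc_fun (h * s)"
        using A h s0 by (intro mult_left_mono assoc_fun_ge) auto
      finally show "s ^ m / M m \<le> A * assoc_fun (h * s) / s" using s0 by (simp add: pos_le_divide_eq)
    qed
    then show ?thesis using s0 by (simp add: pos_le_divide_eq mult.commute)
  qed
  have ht: "h ^ r * t \<ge> 0" "t \<le> h ^ r * t"
    using h t one_le_power[OF h, of r] by (auto simp: mult_right_le_one_le intro: mult_le_cancel_right1[THEN iffD2])
  have "t ^ Suc r * assoc_fun t = t * (t ^ r * assoc_fun t)" by simp
  also have "\<dots> \<le> t * (A ^ r * assoc_fun (h ^ r * t))" by (intro mult_left_mono Suc.IH t)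
  also have "\<dots> \<le> (h ^ r * t) * (A ^ r * assoc_fun (h ^ r * t))"
    using A assoc_fun_pos[OF ht(1)] by (intro mult_right_mono ht) auto
  also have "\<dots> = A ^ r * ((h ^ r * t) * assoc_fun (h ^ r * t))" by simp
  also have "\<dots> \<le> A ^ r * (A * assoc_fun (h * (h ^ r * t)))"
    using A by (intro mult_left_mono one ht) auto
  finally show ?case by (simp add: mult_ac)
qed

end

lemma summable_on_multiindices:
  "(\<lambda>\<alpha> :: 'n::finite \<Rightarrow> nat. \<Prod>i\<in>UNIV. 1 / (1 + real (\<alpha> i))\<^sup>2) summable_on UNIV"
proof (rule nonneg_bdd_above_summable_on)
  show "0 \<le> (\<Prod>i\<in>UNIV. 1 / (1 + real (\<alpha> i))\<^sup>2)" for \<alpha> :: "'n \<Rightarrow> nat" by (intro prod_nonneg) auto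
  define f where "f n = 1 / (1 + real n)\<^sup>2" for n
  have sf: "summable f"
    using inverse_power_summable[of 2, where ?'a=real, THEN summable_ignore_initial_segment, of 1]
    by (simp add: f_def[abs_def] inverse_eq_divide add.commute)
  show "bdd_above (sum (\<lambda>\<alpha> :: 'n \<Rightarrow> nat. \<Prod>i\<in>UNIV. 1 / (1 + real (\<alpha> i))\<^sup>2) ` {F. F \<subseteq> UNIV \<and> finite F})"
  proof (rule bdd_aboveI2)
    fix F :: "('n \<Rightarrow> nat) set" assume "F \<in> {F. F \<subseteq> UNIV \<and> finite F}"
    then have F: "finite F" by simp
    define N where "N = Suc (\<Sum>\<alpha>\<in>F. msize \<alpha>)"
    have "F \<subseteq> Pi\<^sub>E UNIV (\<lambda>_. {..<N})"
    proof
      fix \<alpha> assume \<alpha>: "\<alpha> \<in> F"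
      have "\<alpha> i < N" for i
        using le_msize[of \<alpha> i] member_le_sum[OF \<alpha>, of msize] F by (simp add: N_def)
      then show "\<alpha> \<in> Pi\<^sub>E UNIV (\<lambda>_. {..<N})" by auto
    qed
    then have "(\<Sum>\<alpha>\<in>F. \<Prod>i\<in>UNIV. f (\<alpha> i)) \<le> (\<Sum>\<alpha>\<in>Pi\<^sub>E (UNIV::'n set) (\<lambda>_. {..<N}). \<Prod>i\<in>UNIV. f (\<alpha> i))"
      by (rule sum_mono2[rotated]) (auto intro!: prod_nonneg finite_PiE simp: f_def)
    also have "\<dots> = (\<Prod>i\<in>(UNIV::'n set). \<Sum>n<N. f n)"
      by (subst prod_sum_PiE) auto
    also have "\<dots> \<le> (\<Prod>i\<in>(UNIV::'n set). suminf f)"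
      by (intro prod_mono conjI sum_nonneg sum_le_suminf sf) (auto simp: f_def)
    finally show "(\<Sum>\<alpha>\<in>F. \<Prod>i\<in>UNIV. 1 / (1 + real (\<alpha> i))\<^sup>2) \<le> (\<Prod>i\<in>(UNIV::'n set). suminf f)"
      by (simp add: f_def)
  qed
qed

lemma multiindex_enumeration:
  obtains e :: "nat \<Rightarrow> 'n::finite \<Rightarrow> nat" where "bij e"
proof -
  have inf: "infinite (UNIV :: ('n \<Rightarrow> nat) set)"
  proof
    assume fin: "finite (UNIV :: ('n \<Rightarrow> nat) set)"
    have "inj (\<lambda>n::nat. (\<lambda>_::'n. n))" by (auto simp: inj_on_def fun_eq_iff)
    then have "finite (UNIV :: nat set)" using finite_subset[OF subset_UNIV fin] finite_imageD by blast
    then show False by simp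
  qed
  have "bij_betw (from_nat_into (UNIV :: ('n \<Rightarrow> nat) set)) UNIV UNIV"
    by (rule bij_betw_from_nat_into[OF countableI_type inf])
  then show thesis by (rule that)
qed

section \<open>Sufficiency of the growth condition\<close>

context weight_sequence
begin

text \<open>The number \<open>c \<alpha>\<close> bounds the norm of the coefficient functional with respect to the \<open>j\<close>-th seminorm.\<close>

lemma hermite_coefficients_nuclear:
  assumes M2: "\<And>p. M (p + 1) \<le> A * h ^ p * M p" and A: "A > 0" and h: "h \<ge> 1" and k: "k \<ge> 1"
  obtains j c where "k \<le> j"
    "\<And>\<alpha> :: 'n::finite \<Rightarrow> nat. c \<alpha> \<ge> 0"
    "\<And>(f :: real^'n \<Rightarrow> complex) \<alpha>. f \<in> S_space M \<Longrightarrow> cmod (hcoeff f \<alpha>) \<le> c \<alpha> * S_seminorm M j f"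
    "(\<lambda>\<alpha>. c \<alpha> * S_seminorm M k (nhermite \<alpha> :: real^'n \<Rightarrow> complex)) summable_on UNIV"
proof -
  define d where "d = CARD('n)"
  \<comment> \<open>The factor \<open>t\<^sup>r\<close> with \<open>t\<^sup>2 \<ge> 1 + msize \<alpha>\<close> gives \<open>(1 + msize \<alpha>)\<^bsup>2d\<^esup>\<close>, which dominates the product of
    all \<open>(1 + \<alpha> i)\<^sup>2\<close>.\<close>
  define r where "r = 4 * d"
  define t where "t \<alpha> = 2 * real k * sqrt (real (msize \<alpha>))" for \<alpha> :: "'n \<Rightarrow> nat"
  have t0: "t \<alpha> \<ge> 0" for \<alpha> by (simp add: t_def)
  have hr: "h ^ r \<ge> 1" using h by (rule one_le_power)
  \<comment> \<open>The largest coordinate \<open>n\<close> of \<open>\<alpha>\<close> satisfies \<open>msize \<alpha> \<le> d n\<close>; this choice of \<open>j\<close> makes the argument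
    \<open>decay_rate * j * sqrt n\<close> of the decay estimate at least \<open>h\<^sup>r t \<alpha>\<close>.\<close>
  obtain j0 :: nat where j0: "2 * real k * h ^ r * sqrt (real d) / decay_rate \<le> real j0" using real_arch_simple by blast
  define j where "j = max k j0"
  have j1: "j \<ge> 1" "k \<le> j" using k by (auto simp: j_def)
  have "2 * real k * h ^ r * sqrt (real d) / decay_rate \<le> real j" using j0 by (simp add: j_def)
  then have jt: "2 * real k * h ^ r * sqrt (real d) \<le> decay_rate * real j"
    using decay_rate_pos by (simp add: pos_divide_le_eq mult.commute)
  obtain B1 where B1: "B1 > 0"
    "\<And>(f :: real^'n \<Rightarrow> complex) l n F. f \<in> S_space M \<Longrightarrow> finite F \<Longrightarrow> (\<And>\<alpha>. \<alpha> \<in> F \<Longrightarrow> n \<le> \<alpha> l) \<Longrightarrow>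
       sqrt (\<Sum>\<alpha>\<in>F. (cmod (hcoeff f \<alpha>))\<^sup>2) * assoc_fun (decay_rate * real j * sqrt (real n)) \<le> B1 * S_seminorm M j f"
    using hcoeff_decay[OF j1(1)] by blast
  obtain B2 where B2: "B2 > 0" "\<And>\<alpha> :: 'n \<Rightarrow> nat. S_seminorm M k (nhermite \<alpha>) \<le> B2 * assoc_fun (t \<alpha>)"
    using S_seminorm_nhermite[of k] unfolding t_def by blast
  define c where "c \<alpha> = B1 / assoc_fun (h ^ r * t \<alpha>)" for \<alpha>
  have ht0: "h ^ r * t \<alpha> \<ge> 0" for \<alpha> using h t0[of \<alpha>] by simp
  have Epos: "assoc_fun (h ^ r * t \<alpha>) > 0" for \<alpha> by (rule assoc_fun_pos[OF ht0])
  show thesis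
  proof (rule that[OF j1(2), of c])
    show c0: "c \<alpha> \<ge> 0" for \<alpha> using B1(1) Epos[of \<alpha>] by (simp add: c_def)
    show "cmod (hcoeff f \<alpha>) \<le> c \<alpha> * S_seminorm M j f" if f: "f \<in> S_space M" for f :: "real^'n \<Rightarrow> complex" and \<alpha>
    proof -
      define n where "n = Max (range \<alpha>)"
      have "n \<in> range \<alpha>" unfolding n_def by (rule Max_in) auto
      then obtain l where l: "\<alpha> l = n" by auto
      have "\<alpha> i \<le> n" for i unfolding n_def by (rule Max_ge) auto
      then have "msize \<alpha> \<le> (\<Sum>i\<in>(UNIV::'n set). n)" unfolding msize_def by (intro sum_mono)
      then have "msize \<alpha> \<le> d * n" by (simp add: d_def)
      then have "real (msize \<alpha>) \<le> real d * real n" by (metis of_nat_le_iff of_nat_mult)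
      then have "sqrt (real (msize \<alpha>)) \<le> sqrt (real d) * sqrt (real n)"
        by (simp add: real_sqrt_mult[symmetric])
      then have "h ^ r * t \<alpha> \<le> h ^ r * (2 * real k * (sqrt (real d) * sqrt (real n)))"
        unfolding t_def using h by (intro mult_left_mono) auto
      also have "\<dots> = (2 * real k * h ^ r * sqrt (real d)) * sqrt (real n)" by simp
      also have "\<dots> \<le> (decay_rate * real j) * sqrt (real n)" by (intro mult_right_mono jt) auto
      finally have "assoc_fun (h ^ r * t \<alpha>) \<le> assoc_fun (decay_rate * real j * sqrt (real n))"
        by (intro assoc_fun_mono ht0)
      then have "cmod (hcoeff f \<alpha>) * assoc_fun (h ^ r * t \<alpha>) \<le> cmod (hcoeff f \<alpha>) * assoc_fun (decay_rate * real j * sqrt (real n))"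
        by (intro mult_left_mono) auto
      also have "\<dots> \<le> B1 * S_seminorm M j f"
        using B1(2)[OF f, of "{\<alpha>}" n l] l by simp
      finally show ?thesis using Epos[of \<alpha>] by (simp add: c_def pos_le_divide_eq)
    qed
    show "(\<lambda>\<alpha>. c \<alpha> * S_seminorm M k (nhermite \<alpha> :: real^'n \<Rightarrow> complex)) summable_on UNIV"
    proof (rule summable_on_comparison_test[OF summable_on_cmult_right[OF summable_on_multiindices, of "B1 * B2 * (A ^ r + 1)"]])
      fix \<alpha> :: "'n \<Rightarrow> nat"
      define R where "R = assoc_fun (t \<alpha>) / assoc_fun (h ^ r * t \<alpha>)"
      show "0 \<le> c \<alpha> * S_seminorm M k (nhermite \<alpha>)"
        by (intro mult_nonneg_nonneg c0 S_seminorm_nonneg nhermite_S_space k)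
      have "c \<alpha> * S_seminorm M k (nhermite \<alpha>) \<le> c \<alpha> * (B2 * assoc_fun (t \<alpha>))"
        by (intro mult_left_mono B2 c0)
      also have "\<dots> = B1 * B2 * R" by (simp add: c_def R_def)
      also have "R \<le> (A ^ r + 1) * (\<Prod>i\<in>UNIV. 1 / (1 + real (\<alpha> i))\<^sup>2)"
      proof (cases "msize \<alpha> = 0")
        case True
        then have "\<alpha> i = 0" for i using le_msize[of \<alpha> i] by simp
        moreover have "t \<alpha> = 0" using True by (simp add: t_def)
        then have "R = 1" using assoc_fun_pos[of 0] by (simp add: R_def)
        ultimately show ?thesis using A by simp
      next
        case False
        have R: "(t \<alpha>) ^ r * R \<le> A ^ r"
          using assoc_fun_shift[OF M2 A h t0[of \<alpha>], of r] Epos[of \<alpha>]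
          by (simp add: R_def pos_divide_le_eq)
        have t2: "1 + real (msize \<alpha>) \<le> (t \<alpha>)\<^sup>2"
        proof -
          have "1 * real (msize \<alpha>) \<le> (real k)\<^sup>2 * real (msize \<alpha>)"
            using k by (intro mult_right_mono) (auto simp: one_le_power)
          moreover have "real (msize \<alpha>) \<ge> 1" using False by simp
          moreover have "(t \<alpha>)\<^sup>2 = 4 * ((real k)\<^sup>2 * real (msize \<alpha>))"
            by (simp add: t_def power_mult_distrib)
          ultimately show ?thesis by linarith
        qed
        have "(\<Prod>i\<in>UNIV. (1 + real (\<alpha> i))\<^sup>2) \<le> (\<Prod>i\<in>(UNIV::'n set). (1 + real (msize \<alpha>))\<^sup>2)"
          by (intro prod_mono conjI power_mono) (auto simp: le_msize)
        also have "\<dots> = (1 + real (msize \<alpha>)) ^ (2 * d)" by (simp add: d_def power_mult)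
        also have "\<dots> \<le> ((t \<alpha>)\<^sup>2) ^ (2 * d)" by (intro power_mono t2) auto
        also have "\<dots> = (t \<alpha>) ^ r" by (simp add: r_def power_mult[symmetric])
        finally have p: "(\<Prod>i\<in>UNIV. (1 + real (\<alpha> i))\<^sup>2) \<le> (t \<alpha>) ^ r" .
        have R0: "R \<ge> 0" using assoc_fun_pos[OF t0[of \<alpha>]] Epos[of \<alpha>] by (simp add: R_def)
        have "(\<Prod>i\<in>UNIV. (1 + real (\<alpha> i))\<^sup>2) * R \<le> (t \<alpha>) ^ r * R" by (intro mult_right_mono p R0)
        also have "\<dots> \<le> A ^ r + 1" using R by simp
        finally have "(\<Prod>i\<in>UNIV. (1 + real (\<alpha> i))\<^sup>2) * R \<le> A ^ r + 1" .
        moreover have "(\<Prod>i\<in>UNIV. (1 + real (\<alpha> i))\<^sup>2) > 0" by (intro prod_pos) auto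
        ultimately show ?thesis by (simp add: prod_dividef pos_le_divide_eq mult.commute)
      qed
      then have "B1 * B2 * R \<le> B1 * B2 * ((A ^ r + 1) * (\<Prod>i\<in>UNIV. 1 / (1 + real (\<alpha> i))\<^sup>2))"
        using B1(1) B2(1) by (intro mult_left_mono) auto
      finally show "c \<alpha> * S_seminorm M k (nhermite \<alpha>) \<le> B1 * B2 * (A ^ r + 1) * (\<Prod>i\<in>UNIV. 1 / (1 + real (\<alpha> i))\<^sup>2)"
        by (simp only: mult.assoc)
    qed
  qed
qed

text \<open>The Hermite expansion is the nuclear representation.\<close>

theorem nuclear_if_derivation_closed:
  assumes M2: "\<And>p. M (p + 1) \<le> A * h ^ p * M p" and A: "A > 0" and h: "h > 0"
  shows "nuclear_space (S_space M :: (real^'n::finite \<Rightarrow> complex) set) (S_topology M)"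
  unfolding nuclear_space_def
proof (intro allI impI)
  fix p :: "(real^'n \<Rightarrow> complex) \<Rightarrow> real"
  assume p: "continuous_seminorm (S_space M) (S_topology M) p"
  obtain k C where k: "k \<ge> 1" and C: "C > 0" and pk: "\<And>f. f \<in> S_space M \<Longrightarrow> p f \<le> C * S_seminorm M k f"
    using continuous_seminorm_bound[OF p] by blast
  have M2': "M (p + 1) \<le> A * (max 1 h) ^ p * M p" for p
  proof -
    have "A * h ^ p * M p \<le> A * (max 1 h) ^ p * M p"
      using A h pos[of p] by (intro mult_right_mono mult_left_mono power_mono) auto
    then show ?thesis using M2[of p] by simp
  qed
  obtain j and c :: "('n \<Rightarrow> nat) \<Rightarrow> real" where j: "k \<le> j" and c0: "\<And>\<alpha>. c \<alpha> \<ge> 0"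
    and cb: "\<And>(f :: real^'n \<Rightarrow> complex) \<alpha>. f \<in> S_space M \<Longrightarrow> cmod (hcoeff f \<alpha>) \<le> c \<alpha> * S_seminorm M j f"
    and sm: "(\<lambda>\<alpha>. c \<alpha> * S_seminorm M k (nhermite \<alpha> :: real^'n \<Rightarrow> complex)) summable_on UNIV"
    using hermite_coefficients_nuclear[OF M2' A max.cobounded1 k] by blast
  have j1: "j \<ge> 1" using j k by simp
  obtain e :: "nat \<Rightarrow> 'n \<Rightarrow> nat" where e: "bij e" using multiindex_enumeration .
  have smk: "summable (\<lambda>i. c (e i) * S_seminorm M k (nhermite (e i) :: real^'n \<Rightarrow> complex))"
    using summable_on_imp_summable sm summable_on_reindex_bij_betw[OF e, of "\<lambda>\<alpha>. c \<alpha> * S_seminorm M k (nhermite \<alpha> :: real^'n \<Rightarrow> complex)"]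
    by simp
  define q where "q = (\<lambda>f :: real^'n \<Rightarrow> complex. C * S_seminorm M j f)"
  have q: "continuous_seminorm (S_space M) (S_topology M) q"
    unfolding q_def using C by (intro continuous_seminorm_S_seminorm j1) auto
  have pq: "p f \<le> q f" if "f \<in> S_space M" for f
    unfolding q_def using order_trans[OF pk[OF that] mult_left_mono[OF S_seminorm_mono[OF that k j]]] C by simp
  have p0: "p f \<ge> 0" if "f \<in> S_space M" for f
    using p that by (auto simp: continuous_seminorm_def seminorm_on_def)
  have nuc: "nuclear_canonical_map (S_space M) q p"
    unfolding nuclear_canonical_map_def
  proof (intro exI conjI allI ballI)
    show "linear_functional_on (S_space M) (\<lambda>f. hcoeff f (e i))" for i
      unfolding linear_functional_on_def hcoeff_def
      by (auto simp: ip_cmult_left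
          ip_add_left[OF S_space_sqint[where M=M] S_space_sqint[where M=M] hspan_sqint[OF nhermite_hspan]])
    show "nhermite (e i) \<in> S_space M" for i by (rule nhermite_S_space)
    show "0 \<le> c (e i) / C" for i using c0 C by simp
    show "cmod (hcoeff f (e i)) \<le> c (e i) / C * q f" if "f \<in> S_space M" for i f
      using cb[OF that, of "e i"] C by (simp add: q_def)
    show "summable (\<lambda>i. c (e i) / C * p (nhermite (e i)))"
    proof (rule summable_comparison_test'[OF smk])
      fix i
      have "c (e i) / C * p (nhermite (e i)) \<le> c (e i) / C * (C * S_seminorm M k (nhermite (e i)))"
        using c0 C by (intro mult_left_mono pk nhermite_S_space) auto
      then show "norm (c (e i) / C * p (nhermite (e i))) \<le> c (e i) * S_seminorm M k (nhermite (e i))"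
        using C c0[of "e i"] p0[OF nhermite_S_space] by simp
    qed
    fix f :: "real^'n \<Rightarrow> complex" assume f: "f \<in> S_space M"
    have "summable (\<lambda>i. cmod (hcoeff f (e i)) * S_seminorm M k (nhermite (e i)))"
    proof (rule summable_comparison_test'[OF summable_mult[OF smk, of "S_seminorm M j f"]])
      fix i
      have "cmod (hcoeff f (e i)) * S_seminorm M k (nhermite (e i)) \<le>
         c (e i) * S_seminorm M j f * S_seminorm M k (nhermite (e i))"
        by (intro mult_right_mono cb f S_seminorm_nonneg nhermite_S_space k)
      then show "norm (cmod (hcoeff f (e i)) * S_seminorm M k (nhermite (e i))) \<le>
         S_seminorm M j f * (c (e i) * S_seminorm M k (nhermite (e i)))"
        using S_seminorm_nonneg[OF nhermite_S_space[of "e i"] k] by (simp add: mult_ac)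
    qed
    then have "(\<lambda>n. C * S_seminorm M k (\<lambda>x. f x - hermite_sum e f n x)) \<longlonglongrightarrow> C * 0"
      by (intro tendsto_mult_left hermite_expansion_converges[OF e f k])
    then have lim: "(\<lambda>n. C * S_seminorm M k (\<lambda>x. f x - hermite_sum e f n x)) \<longlonglongrightarrow> 0" by simp
    have S: "(\<lambda>x. f x - hermite_sum e f n x) \<in> S_space M" for n
      by (intro S_space_diff f hermite_sum_S_space)
    have "(\<lambda>n. p (\<lambda>x. f x - hermite_sum e f n x)) \<longlonglongrightarrow> 0"
      by (rule tendsto_sandwich[OF _ _ tendsto_const lim])
         (auto intro!: always_eventually p0 pk S)
    then show "(\<lambda>n. p (\<lambda>x. f x - (\<Sum>i<n. hcoeff f (e i) * nhermite (e i) x))) \<longlonglongrightarrow> 0"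
      by (simp add: hermite_sum_def)
  qed
  show "\<exists>q. continuous_seminorm (S_space M) (S_topology M) q \<and> (\<forall>f\<in>S_space M. p f \<le> q f) \<and>
      nuclear_canonical_map (S_space M) q p"
    using q pq nuc by blast
qed

section \<open>Necessity of the growth condition\<close>

lemma hcoeff_sum:
  assumes "\<And>i. i \<in> I \<Longrightarrow> square_integrable (g i)"
  shows "hcoeff (\<lambda>x. \<Sum>i\<in>I. a i * g i x) \<alpha> = (\<Sum>i\<in>I. a i * hcoeff (g i) \<alpha>)"
  unfolding hcoeff_def using assms
  by (subst ip_sum_left) (auto simp: ip_cmult_left sqint_cmult hspan_sqint nhermite_hspan)

text \<open>The left-hand side is the trace of the projection onto the Hermite functions with index in \<open>F\<close>. Computed
from the nuclear representation of the canonical map, it is \<open>\<Sum>\<^sub>k \<phi>\<^sub>k (R (y k))\<close> for this projection \<open>R\<close>,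
where \<open>L\<close> bounds the norm of \<open>R\<close>.\<close>

lemma nuclear_trace_bound:
  fixes F :: "('n::finite \<Rightarrow> nat) set"
  assumes j: "j \<ge> 1" and q: "seminorm_on (S_space M) q" and F: "finite F"
    and \<phi>: "\<And>k. linear_functional_on (S_space M) (\<phi> k)" and y: "\<And>k. y k \<in> S_space M"
    and c: "\<And>k. 0 \<le> c k" "\<And>k f. f \<in> S_space M \<Longrightarrow> cmod (\<phi> k f) \<le> c k * q f"
    and sm: "summable (\<lambda>k. c k * S_seminorm M j (y k))"
    and lim: "\<And>f. f \<in> S_space M \<Longrightarrow>
       (\<lambda>n. S_seminorm M j (\<lambda>x. f x - (\<Sum>k<n. \<phi> k f * y k x))) \<longlonglongrightarrow> 0"
    and L: "L \<ge> 0" "\<And>g. g \<in> S_space M \<Longrightarrow>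
       q (\<lambda>x. \<Sum>\<alpha>\<in>F. hcoeff g \<alpha> * nhermite \<alpha> x) \<le> L * S_seminorm M j g"
  shows "real (card F) \<le> L * (\<Sum>k. c k * S_seminorm M j (y k))"
proof -
  let ?S = "\<Sum>k. c k * S_seminorm M j (y k)"
  define tr where "tr N = (\<Sum>\<alpha>\<in>F. \<Sum>k<N. \<phi> k (nhermite \<alpha>) * hcoeff (y k) \<alpha>)" for N
  have bound: "cmod (tr N) \<le> L * ?S" for N
  proof -
    have "tr N = (\<Sum>k<N. \<phi> k (\<lambda>x. \<Sum>\<alpha>\<in>F. hcoeff (y k) \<alpha> * nhermite \<alpha> x))"
      unfolding tr_def mult.commute[of "\<phi> k (nhermite \<alpha>)" for k \<alpha>]
      by (subst sum.swap) (simp add: linear_functional_sum[OF \<phi> nhermite_S_space])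
    then have "cmod (tr N) \<le> (\<Sum>k<N. cmod (\<phi> k (\<lambda>x. \<Sum>\<alpha>\<in>F. hcoeff (y k) \<alpha> * nhermite \<alpha> x)))"
      by (simp only: norm_sum)
    also have "\<dots> \<le> (\<Sum>k<N. c k * (L * S_seminorm M j (y k)))"
    proof (rule sum_mono)
      fix k
      have "cmod (\<phi> k (\<lambda>x. \<Sum>\<alpha>\<in>F. hcoeff (y k) \<alpha> * nhermite \<alpha> x)) \<le> c k * q (\<lambda>x. \<Sum>\<alpha>\<in>F. hcoeff (y k) \<alpha> * nhermite \<alpha> x)"
        by (intro c S_space_sum S_space_cmult nhermite_S_space)
      also have "\<dots> \<le> c k * (L * S_seminorm M j (y k))" by (intro mult_left_mono L y c)
      finally show "cmod (\<phi> k (\<lambda>x. \<Sum>\<alpha>\<in>F. hcoeff (y k) \<alpha> * nhermite \<alpha> x)) \<le> c k * (L * S_seminorm M j (y k))" .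
    qed
    also have "\<dots> = L * (\<Sum>k<N. c k * S_seminorm M j (y k))" by (simp add: sum_distrib_left mult_ac)
    also have "\<dots> \<le> L * ?S"
      by (intro mult_left_mono sum_le_suminf sm L) (auto intro!: mult_nonneg_nonneg c S_seminorm_nonneg y j)
    finally show ?thesis .
  qed
  have "(\<lambda>N. \<Sum>k<N. \<phi> k (nhermite \<alpha>) * hcoeff (y k) \<alpha>) \<longlonglongrightarrow> 1" for \<alpha> :: "'n \<Rightarrow> nat"
  proof -
    let ?r = "\<lambda>N x. nhermite \<alpha> x - (\<Sum>k<N. \<phi> k (nhermite \<alpha>) * y k x)"
    have rS: "?r N \<in> S_space M" for N by (intro S_space_diff S_space_sum S_space_cmult nhermite_S_space y)
    have eq: "(\<Sum>k<N. \<phi> k (nhermite \<alpha>) * hcoeff (y k) \<alpha>) = 1 - hcoeff (?r N) \<alpha>" for N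
    proof -
      have "hcoeff (?r N) \<alpha> = hcoeff (nhermite \<alpha>) \<alpha> - hcoeff (\<lambda>x. \<Sum>k<N. \<phi> k (nhermite \<alpha>) * y k x) \<alpha>"
        unfolding hcoeff_def
        by (intro ip_diff_left hspan_sqint nhermite_hspan sqint_sum sqint_cmult S_space_sqint[OF y])
      then show ?thesis by (simp add: hcoeff_sum S_space_sqint[OF y] hcoeff_def[of "nhermite \<alpha>"] nhermite_orthonormal)
    qed
    have "(\<lambda>N. hcoeff (?r N) \<alpha>) \<longlonglongrightarrow> 0"
    proof (rule Lim_null_comparison)
      show "\<forall>\<^sub>F N in sequentially. norm (hcoeff (?r N) \<alpha>) \<le> M 0 * S_seminorm M j (?r N)"
        by (intro always_eventually allI hcoeff_le_seminorm rS j)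
      show "(\<lambda>N. M 0 * S_seminorm M j (?r N)) \<longlonglongrightarrow> 0"
        using tendsto_mult_left[OF lim[OF nhermite_S_space[of \<alpha>]], of "M 0"] by simp
    qed
    then have "(\<lambda>N. 1 - hcoeff (?r N) \<alpha>) \<longlonglongrightarrow> 1 - 0" by (intro tendsto_diff tendsto_const)
    then show ?thesis by (simp only: eq diff_zero)
  qed
  then have "tr \<longlonglongrightarrow> (\<Sum>\<alpha>\<in>F. 1)" unfolding tr_def[abs_def] by (intro tendsto_sum)
  then have "(\<lambda>N. cmod (tr N)) \<longlonglongrightarrow> cmod (\<Sum>\<alpha>\<in>F. 1)" by (rule tendsto_norm)
  then have "cmod (\<Sum>\<alpha>\<in>F. 1) \<le> L * ?S"
    by (rule LIMSEQ_le_const2) (use bound in auto)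
  then show ?thesis by simp
qed

text \<open>The trace of the projection onto \<open>n + 1\<close> Hermite functions is \<open>n + 1\<close>, while its norm carries only the factor
\<open>sqrt (n + 1)\<close> from the Cauchy-Schwarz inequality, so a factor \<open>sqrt n\<close> is gained. Taking all
indices between \<open>n\<close> and \<open>2 n\<close> keeps the arguments of \<open>assoc_fun\<close> comparable to \<open>sqrt n\<close>.\<close>

lemma nuclear_imp_assoc_fun_growth:
  assumes nuc: "nuclear_space (S_space M :: (real^'n::finite \<Rightarrow> complex) set) (S_topology M)"
  obtains K \<kappa> where "K > 0" "\<kappa> > 0" "\<And>t. t \<ge> 0 \<Longrightarrow> t * assoc_fun t \<le> K * assoc_fun (\<kappa> * t)"
proof -
  obtain j0 :: nat where j0: "2 / decay_rate \<le> real j0" using real_arch_simple by blast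
  define j where "j = max 1 j0"
  have j: "j \<ge> 1" by (simp add: j_def)
  have "2 / decay_rate \<le> real j" using j0 by (simp add: j_def)
  then have jt: "2 \<le> decay_rate * real j" using decay_rate_pos by (simp add: pos_divide_le_eq mult.commute)
  have "continuous_seminorm (S_space M) (S_topology M) (S_seminorm M j :: (real^'n \<Rightarrow> complex) \<Rightarrow> real)"
    using continuous_seminorm_S_seminorm[OF j, of 1] by simp
  then obtain q where q: "continuous_seminorm (S_space M) (S_topology M) (q :: (real^'n \<Rightarrow> complex) \<Rightarrow> real)"
    and ncm: "nuclear_canonical_map (S_space M) q (S_seminorm M j)"
    using nuc unfolding nuclear_space_def by blast
  obtain k C where k: "k \<ge> 1" and C: "C > 0" and qk: "\<And>f. f \<in> S_space M \<Longrightarrow> q f \<le> C * S_seminorm M k f"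
    using continuous_seminorm_bound[OF q] by blast
  obtain \<phi> :: "nat \<Rightarrow> (real^'n \<Rightarrow> complex) \<Rightarrow> complex" and y :: "nat \<Rightarrow> real^'n \<Rightarrow> complex" and c :: "nat \<Rightarrow> real"
    where \<phi>: "\<And>k. linear_functional_on (S_space M) (\<phi> k)" and y: "\<And>k. y k \<in> S_space M"
    and c: "\<And>k. 0 \<le> c k" "\<And>k f. f \<in> S_space M \<Longrightarrow> cmod (\<phi> k f) \<le> c k * q f"
    and sm: "summable (\<lambda>k. c k * S_seminorm M j (y k))"
    and lim: "\<And>f. f \<in> S_space M \<Longrightarrow>
       (\<lambda>n. S_seminorm M j (\<lambda>x. f x - (\<Sum>k<n. \<phi> k f * y k x))) \<longlonglongrightarrow> 0"
    using ncm unfolding nuclear_canonical_map_def by blast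
  define S where "S = (\<Sum>k. c k * S_seminorm M j (y k))"
  have S0: "S \<ge> 0" unfolding S_def
    by (intro suminf_nonneg sm mult_nonneg_nonneg c S_seminorm_nonneg y j)
  obtain B1 where B1: "B1 > 0"
    "\<And>(f :: real^'n \<Rightarrow> complex) l n F. f \<in> S_space M \<Longrightarrow> finite F \<Longrightarrow> (\<And>\<alpha>. \<alpha> \<in> F \<Longrightarrow> n \<le> \<alpha> l) \<Longrightarrow>
       sqrt (\<Sum>\<alpha>\<in>F. (cmod (hcoeff f \<alpha>))\<^sup>2) * assoc_fun (decay_rate * real j * sqrt (real n)) \<le> B1 * S_seminorm M j f"
    using hcoeff_decay[OF j] by blast
  obtain B2 where B2: "B2 > 0" "\<And>\<alpha> :: 'n \<Rightarrow> nat. S_seminorm M k (nhermite \<alpha>) \<le> B2 * assoc_fun (2 * real k * sqrt (real (msize \<alpha>)))"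
    using S_seminorm_nhermite[of k] by blast
  define K0 where "K0 = C * B1 * B2 * S + 1"
  have K0: "K0 > 0" using C B1 B2 S0 by (simp add: K0_def add_nonneg_pos)
  define \<kappa> where "\<kappa> = 3 * real k"
  have \<kappa>: "\<kappa> > 0" using k by (simp add: \<kappa>_def)
  have main: "sqrt (real (n + 1)) * assoc_fun (2 * sqrt (real n)) \<le> K0 * assoc_fun (\<kappa> * sqrt (real n))" for n
  proof -
    \<comment> \<open>an arbitrary coordinate\<close>
    define l :: 'n where "l = undefined"
    define F where "F = (\<lambda>\<nu>. (\<lambda>_. 0)(l := \<nu>)) ` {n..2 * n}"
    have inj: "inj_on (\<lambda>\<nu>::nat. (\<lambda>_. 0)(l := \<nu>)) {n..2 * n}"
      by (rule inj_onI) (metis fun_upd_same)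
    have cardF: "card F = n + 1" unfolding F_def by (subst card_image[OF inj]) simp
    have finF: "finite F" by (simp add: F_def)
    have F1: "n \<le> \<alpha> l" if "\<alpha> \<in> F" for \<alpha> using that by (auto simp: F_def)
    have F2: "msize \<alpha> \<le> 2 * n" if "\<alpha> \<in> F" for \<alpha>
      using that by (auto simp: F_def msize_def)
    define E1 where "E1 = assoc_fun (2 * sqrt (real n))"
    define E2 where "E2 = assoc_fun (\<kappa> * sqrt (real n))"
    have E1: "E1 > 0" and E2: "E2 > 0" using \<kappa> by (auto simp: E1_def E2_def intro!: assoc_fun_pos)
    have nh: "S_seminorm M k (nhermite \<alpha>) \<le> B2 * E2" if \<alpha>: "\<alpha> \<in> F" for \<alpha>
    proof -
      \<comment> \<open>\<open>9/4\<close> is a square above \<open>2\<close>\<close>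
      have "sqrt (real (msize \<alpha>)) \<le> sqrt (9/4 * real n)"
        using F2[OF \<alpha>] by (intro real_sqrt_le_mono) linarith
      also have "\<dots> = 3/2 * sqrt (real n)"
      proof -
        have "sqrt (9/4) = (3/2::real)" by (rule real_sqrt_unique) (auto simp: power2_eq_square)
        then show ?thesis by (simp only: real_sqrt_mult)
      qed
      finally have "2 * real k * sqrt (real (msize \<alpha>)) \<le> 2 * real k * (3/2 * sqrt (real n))"
        by (intro mult_left_mono) auto
      then have "2 * real k * sqrt (real (msize \<alpha>)) \<le> \<kappa> * sqrt (real n)" by (simp add: \<kappa>_def)
      then have "assoc_fun (2 * real k * sqrt (real (msize \<alpha>))) \<le> E2"
        unfolding E2_def by (intro assoc_fun_mono) auto
      then have "B2 * assoc_fun (2 * real k * sqrt (real (msize \<alpha>))) \<le> B2 * E2"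
        using B2(1) by (intro mult_left_mono) auto
      then show ?thesis using B2(2)[of \<alpha>] by linarith
    qed
    define L where "L = C * (B2 * E2) * (sqrt (real (n + 1)) * (B1 / E1))"
    have "real (card F) \<le> L * S" unfolding S_def
    proof (rule nuclear_trace_bound[OF j _ finF \<phi> y c sm lim])
      show "seminorm_on (S_space M) q" using q by (simp add: continuous_seminorm_def)
      show "L \<ge> 0" unfolding L_def using C B1 B2 E1 E2 by (auto intro!: mult_nonneg_nonneg divide_nonneg_nonneg)
      fix g :: "real^'n \<Rightarrow> complex" assume g: "g \<in> S_space M"
      define Q where "Q = sqrt (\<Sum>\<alpha>\<in>F. (cmod (hcoeff g \<alpha>))\<^sup>2)"
      have "E1 \<le> assoc_fun (decay_rate * real j * sqrt (real n))"
        unfolding E1_def using jt by (intro assoc_fun_mono mult_right_mono) auto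
      then have "Q * E1 \<le> Q * assoc_fun (decay_rate * real j * sqrt (real n))"
        unfolding Q_def by (intro mult_left_mono real_sqrt_ge_zero sum_nonneg) auto
      also have "\<dots> \<le> B1 * S_seminorm M j g" unfolding Q_def by (rule B1(2)[OF g finF F1])
      finally have Q: "Q \<le> B1 / E1 * S_seminorm M j g" using E1 by (simp add: pos_le_divide_eq)
      have sumQ: "(\<Sum>\<alpha>\<in>F. cmod (hcoeff g \<alpha>)) \<le> sqrt (real (n + 1)) * Q"
      proof -
        have "(\<Sum>\<alpha>\<in>F. 1 * cmod (hcoeff g \<alpha>))\<^sup>2 \<le> (\<Sum>\<alpha>\<in>F. 1\<^sup>2) * (\<Sum>\<alpha>\<in>F. (cmod (hcoeff g \<alpha>))\<^sup>2)"
          by (rule Cauchy_Schwarz_ineq_sum)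
        also have "(\<Sum>\<alpha>\<in>F. (1::real)\<^sup>2) = real (n + 1)" by (simp add: cardF)
        finally have "\<bar>\<Sum>\<alpha>\<in>F. cmod (hcoeff g \<alpha>)\<bar> \<le> sqrt (real (n + 1) * (\<Sum>\<alpha>\<in>F. (cmod (hcoeff g \<alpha>))\<^sup>2))"
          by (intro real_le_rsqrt) simp
        then show ?thesis unfolding Q_def real_sqrt_mult[symmetric] by linarith
      qed
      have S1: "(\<lambda>x. hcoeff g \<alpha> * nhermite \<alpha> x) \<in> S_space M" for \<alpha> by (intro S_space_cmult nhermite_S_space)
      have "q (\<lambda>x. \<Sum>\<alpha>\<in>F. hcoeff g \<alpha> * nhermite \<alpha> x) \<le> C * S_seminorm M k (\<lambda>x. \<Sum>\<alpha>\<in>F. hcoeff g \<alpha> * nhermite \<alpha> x)"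
        by (intro qk S_space_sum S1)
      also have "\<dots> \<le> C * (\<Sum>\<alpha>\<in>F. S_seminorm M k (\<lambda>x. hcoeff g \<alpha> * nhermite \<alpha> x))"
        using C by (intro mult_left_mono S_seminorm_sum S1 k) auto
      also have "\<dots> \<le> C * (\<Sum>\<alpha>\<in>F. cmod (hcoeff g \<alpha>) * (B2 * E2))"
      proof -
        have "S_seminorm M k (\<lambda>x. hcoeff g \<alpha> * nhermite \<alpha> x) \<le> cmod (hcoeff g \<alpha>) * (B2 * E2)" if "\<alpha> \<in> F" for \<alpha>
          unfolding S_seminorm_cmult[OF nhermite_S_space k] by (intro mult_left_mono nh that) auto
        then show ?thesis using C by (intro mult_left_mono sum_mono) auto
      qed
      also have "\<dots> = C * (B2 * E2) * (\<Sum>\<alpha>\<in>F. cmod (hcoeff g \<alpha>))"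
        unfolding sum_distrib_right[symmetric] by (simp add: mult_ac)
      also have "\<dots> \<le> C * (B2 * E2) * (sqrt (real (n + 1)) * (B1 / E1 * S_seminorm M j g))"
      proof (rule mult_left_mono)
        show "0 \<le> C * (B2 * E2)" using C B2 E2 by auto
        have "sqrt (real (n + 1)) * Q \<le> sqrt (real (n + 1)) * (B1 / E1 * S_seminorm M j g)"
          by (intro mult_left_mono Q) auto
        then show "(\<Sum>\<alpha>\<in>F. cmod (hcoeff g \<alpha>)) \<le> sqrt (real (n + 1)) * (B1 / E1 * S_seminorm M j g)"
          using sumQ by linarith
      qed
      also have "\<dots> = L * S_seminorm M j g" by (simp add: L_def)
      finally show "q (\<lambda>x. \<Sum>\<alpha>\<in>F. hcoeff g \<alpha> * nhermite \<alpha> x) \<le> L * S_seminorm M j g" .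
    qed
    then have "real (n + 1) \<le> L * S" by (simp only: cardF)
    then have "sqrt (real (n + 1)) * sqrt (real (n + 1)) \<le> sqrt (real (n + 1)) * (C * B1 * B2 * S * E2 / E1)"
      by (simp add: L_def mult_ac)
    then have "sqrt (real (n + 1)) \<le> C * B1 * B2 * S * E2 / E1"
      by (rule mult_left_le_imp_le) simp
    then have "sqrt (real (n + 1)) * E1 \<le> C * B1 * B2 * S * E2" using E1 by (simp add: pos_le_divide_eq)
    also have "\<dots> \<le> K0 * E2" using E2 by (simp add: K0_def distrib_right)
    finally show ?thesis by (simp only: E1_def E2_def)
  qed
  show thesis
  proof (rule that[of "K0 + assoc_fun 1 * M 0" \<kappa>])
    show "K0 + assoc_fun 1 * M 0 > 0" using K0 assoc_fun_pos[of 1] pos[of 0] by (intro add_pos_pos mult_pos_pos) auto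
    show "\<kappa> > 0" by (rule \<kappa>)
    fix t :: real assume t: "t \<ge> 0"
    have kt: "\<kappa> * t \<ge> 0" using \<kappa> t by simp
    note Ek = assoc_fun_pos[OF kt]
    show "t * assoc_fun t \<le> (K0 + assoc_fun 1 * M 0) * assoc_fun (\<kappa> * t)"
    proof (cases "t < 1")
      case True
      have "t * assoc_fun t \<le> 1 * assoc_fun 1"
        using True t assoc_fun_pos[of t] by (intro mult_mono assoc_fun_mono) auto
      also have "\<dots> = assoc_fun 1 * M 0 * (1 / M 0)" using pos[of 0] by simp
      also have "\<dots> \<le> assoc_fun 1 * M 0 * assoc_fun (\<kappa> * t)"
        using assoc_fun_pos[of 1] pos[of 0] by (intro mult_left_mono assoc_fun_ge0 kt) auto
      also have "\<dots> \<le> (K0 + assoc_fun 1 * M 0) * assoc_fun (\<kappa> * t)"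
        using K0 Ek by (intro mult_right_mono) auto
      finally show ?thesis .
    next
      case False
      define n where "n = nat \<lfloor>t\<^sup>2\<rfloor>"
      have t2: "t\<^sup>2 \<ge> 1" using False by (simp add: one_le_power)
      have n: "real n \<le> t\<^sup>2" "t\<^sup>2 \<le> real n + 1" "real n \<ge> 1"
        using t2 by (auto simp: n_def le_nat_floor intro: order_trans)
      have s1: "t \<le> sqrt (real (n + 1))" using n(2) t by (intro real_le_rsqrt) simp
      have s2: "sqrt (real n) \<le> t" using n(1) t by (intro real_le_lsqrt) auto
      have s3: "sqrt (real (n + 1)) \<le> 2 * sqrt (real n)"
      proof -
        have "sqrt (real (n + 1)) \<le> sqrt (4 * real n)" using n(3) by (intro real_sqrt_le_mono) auto
        then show ?thesis by (simp add: real_sqrt_mult)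
      qed
      have "t * assoc_fun t \<le> sqrt (real (n + 1)) * assoc_fun (2 * sqrt (real n))"
        using s1 s3 t assoc_fun_pos[OF t] by (intro mult_mono assoc_fun_mono) auto
      also have "\<dots> \<le> K0 * assoc_fun (\<kappa> * sqrt (real n))" by (rule main)
      also have "\<dots> \<le> K0 * assoc_fun (\<kappa> * t)"
        using K0 \<kappa> s2 by (intro mult_left_mono assoc_fun_mono) auto
      also have "\<dots> \<le> (K0 + assoc_fun 1 * M 0) * assoc_fun (\<kappa> * t)"
        using Ek assoc_fun_pos[of 1] pos[of 0] by (intro mult_right_mono) auto
      finally show ?thesis .
    qed
  qed
qed

text \<open>By log-convexity the quotients \<open>M (m + 1) / M m\<close> increase with \<open>m\<close>. Hence at \<open>t = M (p + 1) / M p\<close> the terms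
\<open>t\<^sup>m / M m\<close> increase up to \<open>m = p\<close> and do not increase afterwards.\<close>

lemma assoc_fun_at_quotient:
  assumes lc: "\<And>p. p \<ge> 1 \<Longrightarrow> (M p)\<^sup>2 \<le> M (p - 1) * M (p + 1)"
  shows "assoc_fun (M (p + 1) / M p) \<le> (M (p + 1) / M p) ^ p / M p"
proof (rule assoc_fun_leI)
  define \<mu> where "\<mu> n = M (Suc n) / M n" for n
  have \<mu>0: "\<mu> n > 0" for n using pos by (simp add: \<mu>_def)
  have "\<mu> n \<le> \<mu> (Suc n)" for n
    using lc[of "Suc n"] pos[of n] pos[of "Suc n"] by (simp add: \<mu>_def field_simps power2_eq_square)
  then have mono: "\<mu> m \<le> \<mu> n" if "m \<le> n" for m n using that by (rule lift_Suc_mono_le)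
  have step: "M (Suc n) = M n * \<mu> n" for n using pos[of n] by (simp add: \<mu>_def)
  have up: "M p * \<mu> p ^ i \<le> M (p + i)" for i
  proof (induction i)
    case (Suc i)
    have "M p * \<mu> p ^ Suc i = (M p * \<mu> p ^ i) * \<mu> p" by simp
    also have "\<dots> \<le> M (p + i) * \<mu> (p + i)"
      using Suc mono[of p "p + i"] \<mu>0[of p] pos[of "p + i"] by (intro mult_mono) auto
    finally show ?case by (simp add: step)
  qed simp
  have down: "M p \<le> M m * \<mu> p ^ (p - m)" if "m \<le> p" for m
    using that
  proof (induction "p - m" arbitrary: m)
    case (Suc i)
    then have m: "Suc m \<le> p" "i = p - Suc m" by auto
    have "M p \<le> M (Suc m) * \<mu> p ^ (p - Suc m)" by (rule Suc.hyps(1)[OF m(2,1)])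
    also have "\<dots> = M m * (\<mu> m * \<mu> p ^ (p - Suc m))" by (simp add: step)
    also have "\<dots> \<le> M m * (\<mu> p * \<mu> p ^ (p - Suc m))"
      using mono[of m p] Suc.prems \<mu>0[of p] pos[of m] by (intro mult_left_mono mult_right_mono) auto
    also have "\<mu> p * \<mu> p ^ (p - Suc m) = \<mu> p ^ (p - m)"
      using m(1) by (simp add: Suc_diff_Suc flip: power_Suc)
    finally show ?case .
  qed simp
  fix m
  have "\<mu> p ^ m / M m \<le> \<mu> p ^ p / M p"
  proof (cases "m \<le> p")
    case True
    have "\<mu> p ^ m * M p \<le> \<mu> p ^ m * (M m * \<mu> p ^ (p - m))"
      using \<mu>0[of p] by (intro mult_left_mono down True) auto
    also have "\<dots> = \<mu> p ^ p * M m" using True by (simp add: mult_ac flip: power_add)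
    finally show ?thesis using pos[of m] pos[of p] by (simp add: divide_simps)
  next
    case False
    then obtain i where m: "m = p + i" using le_Suc_ex nat_le_linear by blast
    have "\<mu> p ^ p * (M p * \<mu> p ^ i) \<le> \<mu> p ^ p * M m"
      unfolding m using \<mu>0[of p] by (intro mult_left_mono up) auto
    then have "\<mu> p ^ m * M p \<le> \<mu> p ^ p * M m" by (simp add: m power_add mult_ac)
    then show ?thesis using pos[of m] pos[of p] by (simp add: divide_simps)
  qed
  then show "(M (p + 1) / M p) ^ m / M m \<le> (M (p + 1) / M p) ^ p / M p" by (simp add: \<mu>_def)
qed

theorem derivation_closed_if_nuclear:
  assumes lc: "\<And>p. p \<ge> 1 \<Longrightarrow> (M p)\<^sup>2 \<le> M (p - 1) * M (p + 1)"
    and nuc: "nuclear_space (S_space M :: (real^'n::finite \<Rightarrow> complex) set) (S_topology M)"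
  shows "\<exists>A>0. \<exists>h>0. \<forall>p. M (p + 1) \<le> A * h ^ p * M p"
proof -
  obtain K \<kappa> where K: "K > 0" "\<kappa> > 0" "\<And>t. t \<ge> 0 \<Longrightarrow> t * assoc_fun t \<le> K * assoc_fun (\<kappa> * t)"
    using nuclear_imp_assoc_fun_growth[OF nuc] by blast
  have "M (p + 1) \<le> (\<kappa> * K) * \<kappa> ^ p * M p" for p
  proof -
    define t where "t = M (p + 1) / M p / \<kappa>"
    have t: "t > 0" using pos K(2) by (simp add: t_def)
    have kt: "\<kappa> * t = M (p + 1) / M p" using K(2) by (simp add: t_def)
    have "t * (t ^ p / M p) \<le> t * assoc_fun t" using t by (intro mult_left_mono assoc_fun_ge) auto
    also have "\<dots> \<le> K * assoc_fun (\<kappa> * t)" using t by (intro K) auto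
    also have "\<dots> \<le> K * ((\<kappa> * t) ^ p / M p)"
      unfolding kt using K(1) by (intro mult_left_mono assoc_fun_at_quotient lc) auto
    also have "\<dots> = K * \<kappa> ^ p * (t ^ p / M p)" by (simp add: power_mult_distrib)
    finally have "t \<le> K * \<kappa> ^ p"
      by (rule mult_right_le_imp_le) (use t pos[of p] in simp)
    then have "M (p + 1) / M p \<le> \<kappa> * (K * \<kappa> ^ p)" unfolding kt[symmetric] using K(2) by (intro mult_left_mono) auto
    then show ?thesis using pos[of p] by (simp add: pos_divide_le_eq mult_ac)
  qed
  then show ?thesis using K by (intro exI[of _ "\<kappa> * K"] conjI exI[of _ \<kappa>]) auto
qed

end

theorem theorem4p3:
  fixes M :: "nat \<Rightarrow> real"
  assumes pos: "\<And>p. M p > 0"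
    and root: "filterlim (\<lambda>p. M p powr (1 / real p)) at_top sequentially"
    and weight: "\<exists>H>0. \<forall>C>0. \<exists>B>0. \<forall>s p.
      sqrt (real s) ^ s * M p \<le> B * C ^ s * H ^ (s + p) * M (s + p)"
    and logconvex: "\<And>p. p \<ge> 1 \<Longrightarrow> (M p)\<^sup>2 \<le> M (p - 1) * M (p + 1)"
  shows "nuclear_space (S_space M :: (real^'n::finite \<Rightarrow> complex) set) (S_topology M) \<longleftrightarrow>
    (\<exists>A>0. \<exists>H>0. \<forall>p. M (p + 1) \<le> A * H ^ p * M p)"
proof -
  obtain H where H: "H > 0" "\<And>C. C > 0 \<Longrightarrow> \<exists>B>0. \<forall>s p.
      sqrt (real s) ^ s * M p \<le> B * C ^ s * H ^ (s + p) * M (s + p)"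
    using weight by blast
  interpret weight_sequence M H
    by unfold_locales (use pos H in auto)
  show ?thesis
    using nuclear_if_derivation_closed[where 'n='n] derivation_closed_if_nuclear[OF logconvex, where 'n='n] by blast
qed

end
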